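(* Let $L|K$ be a finite field extension, $\omega$ a valuation on $L$ and $\nu$ its restriction to $K$. If $\mathcal{O}_\omega$ is essentially finitely generated over $\mathcal{O}_\nu$, then $e(\omega|\nu)=\epsilon(\omega|\nu)$ and $d(\omega|\nu)=1$.
   Context: For a finite field extension $L|K$ and a valuation $\omega$ on $L$ with restriction $\nu$ to $K$: $\mathcal{O}_\omega,\mathcal{O}_\nu$ are the valuation rings, $\Gamma_\omega\supseteq\Gamma_\nu$ the value groups (totally ordered abelian groups), $L\omega\supseteq K\nu$ the residue fields. Put $e(\omega|\nu)=(\Gamma_\omega:\Gamma_\nu)$ and $f(\omega|\nu)=[L\omega:K\nu]$. Initial index: for an extension $\Delta\subseteq\Gamma$ of ordered abelian groups, $\epsilon(\Gamma\mid\Delta)=|\{\gamma\in\Gamma\mid \gamma\ge 0 \text{ and } \gamma<\delta\text{ for all }\delta\in\Delta\text{ with }\delta>0\}|$; and $\epsilon(\omega|\nu)=\epsilon(\Gamma_\omega\mid\Gamma_\nu)$. Defect: fix an extension $\overline\nu$ of $\omega$ to an algebraic closure $\overline K$ of $L$. The henselization $K^h$ of $(K,\nu)$ is the smallest field with $K\subseteq K^h\subseteq\overline K$ such that $\overline\nu$ is the only extension of $\overline\nu|_{K^h}$ to $\overline K$; $L^h$ is defined likewise for $(L,\omega)$. The defect is $d(\omega|\nu)=\dfrac{[L^h:K^h]}{e(\omega|\nu)f(\omega|\nu)}$, a positive integer. A ring extension $A\subseteq B$ is essentially finitely generated if there are $x_1,\ldots,x_r\in B$ and a multiplicative set $S\subseteq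 A[x_1,\ldots,x_r]$ with $B=S^{-1}A[x_1,\ldots,x_r]$. *)

theory Defs
  imports "HOL-Algebra.Algebraic_Closure_Type" "HOL-Algebra.Generated_Rings"
begin

text \<open>
  The algebraic closure of L is a type \<open>'a\<close> of class \<open>field\<close>; K, L and all other fields are
  subsets of \<open>'a\<close>. The ring record of the whole type gives access to \<open>subfield\<close>,
  \<open>algebraic_closure\<close>, \<open>ring.dim\<close> and \<open>generate_ring\<close>.
\<close>

abbreviation ambient :: "'a::field ring"
  where "ambient \<equiv> ring_of_type_algebra"

text \<open>
  Krull valuations are written additively. The value of 0 is infinity by convention: it is not
  represented, and a function \<open>v\<close> is only ever used at nonzero elements of the field \<open>M\<close>.
  The value group is \<open>value_group M v\<close>, a subgroup of the ordered group \<open>'g\<close>. For \<open>K \<subseteq> M\<close>,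
  the restriction of the valuation to K is the same function, used with K in place of \<open>M\<close>.
\<close>

definition valuation_on :: "'a::field set \<Rightarrow> ('a \<Rightarrow> 'g::linordered_ab_group_add) \<Rightarrow> bool"
  where "valuation_on M v \<longleftrightarrow>
    (\<forall>x\<in>M - {0}. \<forall>y\<in>M - {0}. v (x * y) = v x + v y) \<and>
    (\<forall>x\<in>M - {0}. \<forall>y\<in>M - {0}. x + y \<noteq> 0 \<longrightarrow> min (v x) (v y) \<le> v (x + y))"

definition extends_on ::
    "'a::field set \<Rightarrow> ('a \<Rightarrow> 'g::linordered_ab_group_add) \<Rightarrow> ('a \<Rightarrow> 'g) \<Rightarrow> bool"
  where "extends_on M w v \<longleftrightarrow> (\<forall>x\<in>M - {0}. w x = v x)"

definition value_group :: "'a::field set \<Rightarrow> ('a \<Rightarrow> 'g::linordered_ab_group_add) \<Rightarrow> 'g set"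
  where "value_group M v = v ` (M - {0})"

definition valuation_ring :: "'a::field set \<Rightarrow> ('a \<Rightarrow> 'g::linordered_ab_group_add) \<Rightarrow> 'a set"
  where "valuation_ring M v = {x \<in> M. x = 0 \<or> 0 \<le> v x}"

definition maximal_ideal_of :: "'a::field set \<Rightarrow> ('a \<Rightarrow> 'g::linordered_ab_group_add) \<Rightarrow> 'a set"
  where "maximal_ideal_of M v = {x \<in> M. x = 0 \<or> 0 < v x}"

definition residue_field ::
    "'a::field set \<Rightarrow> ('a \<Rightarrow> 'g::linordered_ab_group_add) \<Rightarrow> 'a set ring"
  where "residue_field M v =
    (ambient\<lparr>carrier := valuation_ring M v\<rparr>) Quot (maximal_ideal_of M v)"

text \<open>
  The residue field of K, embedded into the residue field of L: the classes modulo the maximal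
  ideal of L of the elements of the valuation ring of K.
\<close>

definition residue_subfield ::
    "'a::field set \<Rightarrow> 'a set \<Rightarrow> ('a \<Rightarrow> 'g::linordered_ab_group_add) \<Rightarrow> 'a set set"
  where "residue_subfield K L v =
    (\<lambda>x. maximal_ideal_of L v +>\<^bsub>ambient\<lparr>carrier := valuation_ring L v\<rparr>\<^esub> x) ` valuation_ring K v"

definition subgroup_index :: "'g::linordered_ab_group_add set \<Rightarrow> 'g set \<Rightarrow> nat"
  where "subgroup_index \<Gamma> \<Delta> = card ((\<lambda>\<gamma>. (+) \<gamma> ` \<Delta>) ` \<Gamma>)"

definition ramification_index ::
    "'a::field set \<Rightarrow> 'a set \<Rightarrow> ('a \<Rightarrow> 'g::linordered_ab_group_add) \<Rightarrow> nat"
  where "ramification_index K L v = subgroup_index (value_group L v) (value_group K v)"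

definition residue_degree ::
    "'a::field set \<Rightarrow> 'a set \<Rightarrow> ('a \<Rightarrow> 'g::linordered_ab_group_add) \<Rightarrow> nat"
  where "residue_degree K L v =
    ring.dim (residue_field L v) (residue_subfield K L v) (carrier (residue_field L v))"

text \<open>
  If \<open>(\<Gamma> : \<Delta>)\<close> is finite then so is the set below, as its elements are pairwise incongruent
  modulo \<open>\<Delta>\<close> (the difference of two of them is smaller than every positive element of \<open>\<Delta>\<close>).
\<close>

definition group_initial_index :: "'g::linordered_ab_group_add set \<Rightarrow> 'g set \<Rightarrow> nat"
  where "group_initial_index \<Gamma> \<Delta> = card {\<gamma> \<in> \<Gamma>. 0 \<le> \<gamma> \<and> (\<forall>\<delta>\<in>\<Delta>. 0 < \<delta> \<longrightarrow> \<gamma> < \<delta>)}"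

definition initial_index ::
    "'a::field set \<Rightarrow> 'a set \<Rightarrow> ('a \<Rightarrow> 'g::linordered_ab_group_add) \<Rightarrow> nat"
  where "initial_index K L v = group_initial_index (value_group L v) (value_group K v)"

text \<open>
  \<open>\<mu>\<close> is a valuation of the whole algebraic closure \<open>'a\<close>. Letting the competing extension \<open>w\<close>
  take values in the same group \<open>'g\<close>, and asking for equality rather than equivalence of
  valuations, is no restriction: the value group of any extension of \<open>\<mu>\<close> restricted to \<open>M\<close> is the
  divisible hull of \<open>value_group M \<mu>\<close> if \<open>'a\<close> is algebraic over \<open>M\<close>; that hull embeds uniquely over
  \<open>value_group M \<mu>\<close> into \<open>'g\<close>, with image \<open>value_group UNIV \<mu>\<close>.
\<close>

definition unique_extension_from ::
    "('a::field \<Rightarrow> 'g::linordered_ab_group_add) \<Rightarrow> 'a set \<Rightarrow> bool"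
  where "unique_extension_from \<mu> M \<longleftrightarrow>
    (\<forall>w :: 'a \<Rightarrow> 'g. valuation_on UNIV w \<and> extends_on M w \<mu> \<longrightarrow> extends_on UNIV w \<mu>)"

definition henselization ::
    "('a::field \<Rightarrow> 'g::linordered_ab_group_add) \<Rightarrow> 'a set \<Rightarrow> 'a set"
  where "henselization \<mu> K =
    (LEAST M. subfield M ambient \<and> K \<subseteq> M \<and> unique_extension_from \<mu> M)"

definition defect ::
    "('a::field \<Rightarrow> 'g::linordered_ab_group_add) \<Rightarrow> 'a set \<Rightarrow> 'a set \<Rightarrow> ('a \<Rightarrow> 'g) \<Rightarrow> real"
  where "defect \<mu> K L \<omega> =
    real (ring.dim ambient (henselization \<mu> K) (henselization \<mu> L)) /
      (real (ramification_index K L \<omega>) * real (residue_degree K L \<omega>))"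

text \<open>
  A and B are subrings of the field \<open>'a\<close>, so the localisation is the ring of fractions
  inside \<open>'a\<close>. A multiplicative set containing 0 would give the zero ring, which is never B.
\<close>

definition essentially_finitely_generated :: "'a::field set \<Rightarrow> 'a set \<Rightarrow> bool"
  where "essentially_finitely_generated A B \<longleftrightarrow>
    (\<exists>G S. finite G \<and> G \<subseteq> B \<and>
       submonoid S ambient \<and> S \<subseteq> generate_ring ambient (A \<union> G) \<and> 0 \<notin> S \<and>
       B = {a / s | a s. a \<in> generate_ring ambient (A \<union> G) \<and> s \<in> S})"

end

theory Submission
  imports Defs
begin

text \<open>
  Let \<open>Z\<close> be the henselization of \<open>K\<close>. The valuation ring of \<open>L\<close> consists of fractions of the
  ring generated over the valuation ring of \<open>K\<close> by finitely many elements. Since the valuation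
  extends uniquely from \<open>Z\<close>, these generators are integral over the valuation ring \<open>A\<close> of \<open>Z\<close> and
  the denominators are units of the finite \<open>A\<close>-algebra \<open>C\<close> that they generate, so \<open>C\<close> contains the
  valuation ring of \<open>L\<close>. Products of lifts of a residue basis with elements realizing the initial
  values generate \<open>C\<close> modulo the maximal ideal of \<open>A\<close>, hence by Nakayama they generate \<open>C\<close> and
  span the henselization of \<open>L\<close> over \<open>Z\<close>. Its degree is thus at most \<open>\<epsilon> f\<close>. It is at
  least \<open>e f\<close> because \<open>Z\<close> is an immediate extension of \<open>K\<close>, and \<open>\<epsilon> \<le> e\<close> always holds.

  The henselization is obtained as the smallest extension that contains every simple root \<open>z\<close> of a
  polynomial over it such that no other nonzero root has the value of \<open>z\<close>. Such fields are closed
  under intersection, they are exactly the fields from which the valuation extends uniquely, and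
  adjoining such a root is an immediate extension.
\<close>

text \<open>The obstacle is that the valuation ring of \<open>L\<close> need not be a finite module
  over that of \<open>K\<close>: the integral closure in \<open>L\<close> has a maximal ideal for
  every extension of the valuation, and a localization at one of them is still missing. Over a field
  with a unique extension all conjugates have equal value, so elements of the valuation ring are
  integral and units have polynomial inverses; this is why the argument is moved to the
  henselization. The initial index enters because a nonzero element of \<open>L\<close> whose value
  is nonnegative but not initial is divisible by an element of \<open>K\<close> of positive value;
  the values that remain are those counted by \<epsilon>. The henselization is defined as a least
  field, and having a unique extension is not visibly preserved by intersections. Closure under
  isolated roots is, because being such a root does not depend on the field. Neither completions nor
  Galois groups are involved; inseparable elements are replaced by powers, which multiplies values
  by a positive integer and so loses nothing.\<close>

hide_const (open) Polynomials.degree Polynomials.lead_coeff up_ring.coeff up_ring.monom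

section \<open>Subfields of the ambient field in terms of the operations of the type\<close>

lemma ambient_simps [simp]:
  "carrier (ambient :: 'a::field ring) = UNIV"
  "x \<otimes>\<^bsub>ambient\<^esub> y = x * y" "x \<oplus>\<^bsub>ambient\<^esub> y = x + y"
  "\<one>\<^bsub>ambient\<^esub> = (1::'a)" "\<zero>\<^bsub>ambient\<^esub> = (0::'a)"
  by (simp_all add: ring_of_type_algebra_def)

lemma ring_ambient: "ring (ambient :: 'a::field ring)"
  and cring_ambient: "cring (ambient :: 'a ring)"
  and field_ambient: "field (ambient :: 'a ring)"
  by (rule ring_from_type_algebra cring_from_type_algebra field_from_type_algebra)+

lemma a_inv_ambient [simp]: "\<ominus>\<^bsub>ambient\<^esub> x = - (x :: 'a::field)"
proof -
  interpret ring "ambient :: 'a ring" by (rule ring_ambient)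
  show ?thesis by (rule minus_equality) auto
qed

lemma m_inv_ambient [simp]:
  assumes "(x :: 'a::field) \<noteq> 0" shows "inv\<^bsub>ambient\<^esub> x = inverse x"
proof -
  interpret cring "ambient :: 'a ring" by (rule cring_ambient)
  show ?thesis using assms by (intro comm_inv_char) auto
qed

lemma subfield_ambient_iff:
  fixes M :: "'a::field set"
  shows "subfield M ambient \<longleftrightarrow> 0 \<in> M \<and> 1 \<in> M \<and> (\<forall>x\<in>M. \<forall>y\<in>M. x + y \<in> M) \<and>
    (\<forall>x\<in>M. \<forall>y\<in>M. x * y \<in> M) \<and> (\<forall>x\<in>M. - x \<in> M) \<and> (\<forall>x\<in>M. inverse x \<in> M)"
proof
  interpret field "ambient :: 'a ring" by (rule field_ambient)
  assume M: "subfield M ambient"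
  have "inverse x \<in> M" if "x \<in> M" for x
    using subfield_m_inv(1)[OF M, of x] that subringE(2)[OF subfieldE(1)[OF M]]
    by (cases "x = 0") auto
  then show "0 \<in> M \<and> 1 \<in> M \<and> (\<forall>x\<in>M. \<forall>y\<in>M. x + y \<in> M) \<and>
    (\<forall>x\<in>M. \<forall>y\<in>M. x * y \<in> M) \<and> (\<forall>x\<in>M. - x \<in> M) \<and> (\<forall>x\<in>M. inverse x \<in> M)"
    using subringE[OF subfieldE(1)[OF M]] by auto
next
  interpret field "ambient :: 'a ring" by (rule field_ambient)
  assume M: "0 \<in> M \<and> 1 \<in> M \<and> (\<forall>x\<in>M. \<forall>y\<in>M. x + y \<in> M) \<and>
    (\<forall>x\<in>M. \<forall>y\<in>M. x * y \<in> M) \<and> (\<forall>x\<in>M. - x \<in> M) \<and> (\<forall>x\<in>M. inverse x \<in> M)"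
  show "subfield M ambient"
  proof (rule subfieldI'[OF subringI])
    fix k assume "k \<in> M - {\<zero>\<^bsub>ambient\<^esub>}"
    then show "inv\<^bsub>ambient\<^esub> k \<in> M" using M by auto
  qed (use M in auto)
qed

lemma subfield_closed:
  fixes M :: "'a::field set"
  assumes "subfield M ambient"
  shows "0 \<in> M" "1 \<in> M" "x \<in> M \<Longrightarrow> y \<in> M \<Longrightarrow> x + y \<in> M" "x \<in> M \<Longrightarrow> y \<in> M \<Longrightarrow> x * y \<in> M"
    "x \<in> M \<Longrightarrow> - x \<in> M" "x \<in> M \<Longrightarrow> inverse x \<in> M" "x \<in> M \<Longrightarrow> y \<in> M \<Longrightarrow> x - y \<in> M"
    "x \<in> M \<Longrightarrow> y \<in> M \<Longrightarrow> x / y \<in> M" "x \<in> M \<Longrightarrow> x ^ n \<in> M"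
proof -
  note M = assms[unfolded subfield_ambient_iff]
  show "0 \<in> M" "1 \<in> M" "x \<in> M \<Longrightarrow> y \<in> M \<Longrightarrow> x + y \<in> M" "x \<in> M \<Longrightarrow> y \<in> M \<Longrightarrow> x * y \<in> M"
    "x \<in> M \<Longrightarrow> - x \<in> M" "x \<in> M \<Longrightarrow> inverse x \<in> M" using M by auto
  show "x \<in> M \<Longrightarrow> y \<in> M \<Longrightarrow> x - y \<in> M" using M by (metis add_uminus_conv_diff)
  show "x \<in> M \<Longrightarrow> y \<in> M \<Longrightarrow> x / y \<in> M" using M by (metis divide_inverse)
  show "x \<in> M \<Longrightarrow> x ^ n \<in> M" using M by (induction n) auto
qed

lemma subfield_sum:
  fixes M :: "'a::field set"
  assumes "subfield M ambient" "\<And>i. i \<in> A \<Longrightarrow> f i \<in> M"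
  shows "sum f A \<in> M"
  using assms(2) by (induction A rule: infinite_finite_induct) (auto intro: subfield_closed[OF assms(1)])

section \<open>Polynomials with coefficients in a subset\<close>

definition coeffs_in :: "'a::field set \<Rightarrow> 'a poly \<Rightarrow> bool"
  where "coeffs_in S p \<longleftrightarrow> (\<forall>i. coeff p i \<in> S)"

lemma coeffs_in_mono: "coeffs_in S p \<Longrightarrow> S \<subseteq> T \<Longrightarrow> coeffs_in T p"
  by (auto simp: coeffs_in_def)

lemma coeffs_in_mult:
  assumes "coeffs_in S p" "coeffs_in T q" "\<And>a b. a \<in> S \<Longrightarrow> b \<in> T \<Longrightarrow> a * b \<in> U"
    and "0 \<in> U" "\<And>a b. a \<in> U \<Longrightarrow> b \<in> U \<Longrightarrow> a + b \<in> U"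
  shows "coeffs_in U (p * q)"
  unfolding coeffs_in_def coeff_mult
proof
  fix n
  have "finite A \<Longrightarrow> (\<Sum>i\<in>A. coeff p i * coeff q (n - i)) \<in> U" for A
    by (induction A rule: finite_induct) (use assms in \<open>auto simp: coeffs_in_def\<close>)
  then show "(\<Sum>i\<le>n. coeff p i * coeff q (n - i)) \<in> U" by blast
qed

text \<open>A predicate on sets with the operations of the type, so that subfields, valuation rings,
  domains of embeddings and spans \<open>lspan A T\<close> share the same closure facts.\<close>

locale subring_set =
  fixes R :: "'a::field set"
  assumes one_mem [simp]: "1 \<in> R"
    and minus_mem: "x \<in> R \<Longrightarrow> - x \<in> R"
    and add_mem: "x \<in> R \<Longrightarrow> y \<in> R \<Longrightarrow> x + y \<in> R"
    and mult_mem: "x \<in> R \<Longrightarrow> y \<in> R \<Longrightarrow> x * y \<in> R"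
begin

lemma zero_mem [simp]: "0 \<in> R"
  using add_mem[OF one_mem minus_mem[OF one_mem]] by simp

lemma diff_mem: "x \<in> R \<Longrightarrow> y \<in> R \<Longrightarrow> x - y \<in> R"
  using add_mem[of x "- y"] minus_mem[of y] by simp

lemma power_mem: "x \<in> R \<Longrightarrow> x ^ n \<in> R"
  by (induction n) (auto intro: mult_mem)

lemma sum_mem: "(\<And>i. i \<in> A \<Longrightarrow> f i \<in> R) \<Longrightarrow> sum f A \<in> R"
  by (induction A rule: infinite_finite_induct) (auto intro: add_mem)

lemma coeffs_in_closed:
  "coeffs_in R 0" "coeffs_in R 1"
  "coeffs_in R p \<Longrightarrow> coeffs_in R q \<Longrightarrow> coeffs_in R (p + q)"
  "coeffs_in R p \<Longrightarrow> coeffs_in R q \<Longrightarrow> coeffs_in R (p - q)"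
  "coeffs_in R p \<Longrightarrow> coeffs_in R q \<Longrightarrow> coeffs_in R (p * q)"
  "coeffs_in R p \<Longrightarrow> coeffs_in R (- p)"
  "a \<in> R \<Longrightarrow> coeffs_in R p \<Longrightarrow> coeffs_in R (smult a p)"
  "a \<in> R \<Longrightarrow> coeffs_in R (monom a n)"
  "a \<in> R \<Longrightarrow> coeffs_in R p \<Longrightarrow> coeffs_in R (pCons a p)"
  "coeffs_in R p \<Longrightarrow> coeffs_in R (p ^ n)"
proof -
  show *: "coeffs_in R 0" "coeffs_in R 1"
    by (auto simp: coeffs_in_def coeff_1)
  show mult: "coeffs_in R p \<Longrightarrow> coeffs_in R q \<Longrightarrow> coeffs_in R (p * q)" for p q
    by (rule coeffs_in_mult[of R _ R]) (auto intro: mult_mem add_mem)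
  show "a \<in> R \<Longrightarrow> coeffs_in R p \<Longrightarrow> coeffs_in R (pCons a p)"
    by (auto simp: coeffs_in_def coeff_pCons split: nat.split)
  show "coeffs_in R p \<Longrightarrow> coeffs_in R (p ^ n)"
    by (induction n) (auto intro: mult *)
qed (auto simp: coeffs_in_def intro: add_mem diff_mem minus_mem mult_mem)

lemma of_nat_mem: "of_nat n \<in> R"
  by (induction n) (auto intro: add_mem)

lemma poly_mem: "coeffs_in R p \<Longrightarrow> x \<in> R \<Longrightarrow> poly p x \<in> R"
  unfolding poly_altdef by (intro sum_mem mult_mem power_mem) (auto simp: coeffs_in_def)

end

lemma (in subring_set) coeffs_in_pcompose:
  assumes "coeffs_in R p" "coeffs_in R q" shows "coeffs_in R (pcompose p q)"
  using assms(1)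
proof (induction p)
  case 0
  then show ?case by (simp add: coeffs_in_closed)
next
  case (pCons a p)
  from pCons.prems have "a \<in> R" "coeffs_in R p"
    by (auto simp: coeffs_in_def coeff_pCons split: nat.splits)
  then show ?case using pCons.IH assms(2) by (auto simp: pcompose_pCons intro!: coeffs_in_closed)
qed

lemma (in subring_set) coeffs_in_pderiv: "coeffs_in R p \<Longrightarrow> coeffs_in R (pderiv p)"
  by (auto simp: coeffs_in_def coeff_pderiv intro!: mult_mem of_nat_mem simp flip: of_nat_Suc)

lemma subfield_subring_set: "subfield (M :: 'a::field set) ambient \<Longrightarrow> subring_set M"
  by unfold_locales (auto intro: subfield_closed)

text \<open>Dividing by a monic polynomial never inverts a coefficient, so the division stays inside
  any subring and serves valuation rings as well as fields.\<close>

lemma coeffs_in_division: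
  fixes f p :: "'a::field poly"
  assumes "subring_set R" "coeffs_in R f" "lead_coeff f = 1" "coeffs_in R p"
  shows "\<exists>q r. coeffs_in R q \<and> coeffs_in R r \<and> p = f * q + r \<and> (r = 0 \<or> degree r < degree f)"
  using assms(4)
proof (induction "degree p" arbitrary: p rule: less_induct)
  case less
  interpret subring_set R by fact
  show ?case
  proof (cases "p = 0 \<or> degree p < degree f")
    case True
    then show ?thesis using less.prems
      by (intro exI[of _ 0] exI[of _ p]) (auto intro: coeffs_in_closed)
  next
    case False
    define d where "d = degree p - degree f"
    define m where "m = monom (lead_coeff p) d"
    define p' where "p' = p - f * m"
    have m: "coeffs_in R m"
      using less.prems by (auto simp: m_def coeffs_in_def)
    then have p': "coeffs_in R p'"
      unfolding p'_def by (intro coeffs_in_closed less.prems assms)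
    have fnz: "f \<noteq> 0" using assms(3) by auto
    have deg1: "degree (f * m) = degree p"
      using False assms(3) fnz unfolding m_def
      by (auto simp: degree_mult_eq degree_monom_eq d_def)
    have "lead_coeff (f * m) = lead_coeff p"
      using assms(3) unfolding m_def by (simp only: lead_coeff_mult lead_coeff_monom mult_1_left)
    note deg = deg1 this[unfolded deg1]
    have "p' = 0 \<or> degree p' < degree p"
    proof (cases "degree p = 0")
      case True
      with deg have "p' = 0"
        by (metis p'_def cancel_comm_monoid_add_class.diff_cancel degree_0_id)
      then show ?thesis by simp
    next
      case False
      with deg have "degree p' \<le> degree p" "coeff p' (degree p) = 0"
        unfolding p'_def by (auto intro: degree_diff_le)
      then show ?thesis
        by (metis False bot_nat_0.not_eq_extremum degree_0 eq_zero_or_degree_less)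
    qed
    then obtain q r where "coeffs_in R q" "coeffs_in R r" "p' = f * q + r"
      "r = 0 \<or> degree r < degree f"
    proof
      assume "p' = 0"
      then show thesis by (intro that[of 0 0]) (auto intro: coeffs_in_closed)
    qed (use less.hyps p' that in blast)
    then show ?thesis using m
      by (intro exI[of _ "q + m"] exI[of _ r])
        (auto simp: p'_def algebra_simps intro: coeffs_in_closed)
  qed
qed

section \<open>Conjugates\<close>

text \<open>Stated by annihilating polynomials, without irreducibility or automorphisms; symmetry
  and the realization by embeddings are proved below.\<close>

definition conjugate :: "'a::field set \<Rightarrow> 'a \<Rightarrow> 'a \<Rightarrow> bool"
  where "conjugate M a b \<longleftrightarrow> (\<forall>p. coeffs_in M p \<longrightarrow> poly p a = 0 \<longrightarrow> poly p b = 0)"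

definition is_minpoly :: "'a::field set \<Rightarrow> 'a \<Rightarrow> 'a poly \<Rightarrow> bool"
  where "is_minpoly M a f \<longleftrightarrow> coeffs_in M f \<and> lead_coeff f = 1 \<and> poly f a = 0 \<and>
    (\<forall>p. coeffs_in M p \<longrightarrow> poly p a = 0 \<longrightarrow> (\<exists>q. coeffs_in M q \<and> p = f * q))"

lemma is_minpolyD:
  assumes "is_minpoly M a f"
  shows "coeffs_in M f" "lead_coeff f = 1" "poly f a = 0" "f \<noteq> 0" "degree f > 0"
proof -
  show *: "coeffs_in M f" "lead_coeff f = 1" "poly f a = 0"
    using assms by (auto simp: is_minpoly_def)
  then show "f \<noteq> 0" by auto
  show "degree f > 0"
  proof (rule ccontr)
    assume "\<not> degree f > 0"
    then obtain c where "f = [:c:]" by (metis degree_eq_zeroE gr0I)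
    with * show False by auto
  qed
qed

lemma is_minpoly_dvd: 
  "is_minpoly M a f \<Longrightarrow> coeffs_in M p \<Longrightarrow> poly p a = 0 \<Longrightarrow> \<exists>q. coeffs_in M q \<and> p = f * q"
  by (auto simp: is_minpoly_def)

lemma minpoly_root_iff_conjugate:
  "is_minpoly M a f \<Longrightarrow> poly f b = 0 \<longleftrightarrow> conjugate M a b"
  unfolding conjugate_def is_minpoly_def by (metis mult_zero_left poly_mult)

text \<open>The algebraically closed field is the whole type, seen over the base \<open>M\<close>.
  Only \<open>M\<close> varies, so passing to a larger base is an interpretation of the same
  locale.\<close>

locale closed_extension =
  fixes M :: "'a::field set"
  assumes subfield_M: "subfield M ambient"
    and algebraic: "\<exists>p. p \<noteq> 0 \<and> coeffs_in M p \<and> poly p x = 0"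
    and has_root: "degree (p :: 'a poly) > 0 \<Longrightarrow> \<exists>x. poly p x = 0"
begin

sublocale subring_set M
  using subfield_M by (rule subfield_subring_set)

lemma minpoly_exists: "\<exists>f. is_minpoly M a f"
proof -
  define P where "P = (\<lambda>p. p \<noteq> 0 \<and> coeffs_in M p \<and> poly p a = 0)"
  obtain p where p: "P p" "\<And>q. P q \<Longrightarrow> degree p \<le> degree q"
    using algebraic[of a] unfolding P_def[symmetric]
    by (metis arg_min_nat_lemma[of P _ degree])
  define f where "f = smult (inverse (lead_coeff p)) p"
  have f: "coeffs_in M f" "lead_coeff f = 1" "poly f a = 0" "degree f = degree p"
    using p(1) subfield_closed[OF subfield_M]
    by (auto simp: P_def f_def coeffs_in_def)
  have "\<exists>q. coeffs_in M q \<and> g = f * q" if g: "coeffs_in M g" "poly g a = 0" for g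
  proof -
    obtain q r where qr: "coeffs_in M q" "coeffs_in M r" "g = f * q + r" "r = 0 \<or> degree r < degree f"
      using coeffs_in_division[OF subring_set_axioms f(1,2) g(1)] by blast
    then have "poly r a = 0" using g f by auto
    with qr p(2)[of r] f(4) have "r = 0" unfolding P_def by (metis leD)
    with qr show ?thesis by auto
  qed
  with f show ?thesis unfolding is_minpoly_def by blast
qed

text \<open>Write the minimal polynomial as \<open>c + X * g\<close>: then
  \<open>u * g(u) = - c\<close>, and \<open>c = 0\<close> would make \<open>g\<close> an annihilator
  of smaller degree.\<close>

lemma inverse_eq_poly:
  assumes "u \<noteq> 0"
  shows "\<exists>p. coeffs_in M p \<and> inverse u = poly p u"
proof -
  obtain f where f: "is_minpoly M u f" using minpoly_exists by blast
  obtain c g where fg: "f = pCons c g" by (cases f)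
  have cg: "c \<in> M" "coeffs_in M g"
    using is_minpolyD(1)[OF f] unfolding fg
    by (auto simp: coeffs_in_def coeff_pCons split: nat.splits)
  have root: "c + u * poly g u = 0" using is_minpolyD(3)[OF f] by (simp add: fg)
  have "c \<noteq> 0"
  proof
    assume "c = 0"
    with root assms have "poly g u = 0" by auto
    then obtain q where q: "g = f * q" using is_minpoly_dvd[OF f cg(2)] by blast
    have "g \<noteq> 0" using is_minpolyD(4)[OF f] fg \<open>c = 0\<close> by auto
    then have "degree f \<le> degree g" using q by (simp add: degree_mult_eq)
    with \<open>g \<noteq> 0\<close> show False by (simp add: fg)
  qed
  have "u * (- (inverse c) * poly g u) = - inverse c * (u * poly g u)" by simp
  also have "u * poly g u = - c" using root by (simp add: eq_neg_iff_add_eq_0 add.commute)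
  finally have "inverse u = - (inverse c) * poly g u"
    using \<open>c \<noteq> 0\<close> by (intro inverse_unique) simp
  then show ?thesis using cg subfield_closed[OF subfield_M]
    by (intro exI[of _ "smult (- inverse c) g"]) (auto intro!: coeffs_in_closed)
qed

text \<open>A ring between \<open>M\<close> and an algebraic extension is a field, since inverses
  are polynomials in the elements. This turns simple extensions, domains of embeddings and spans
  into fields without fractions.\<close>

lemma intermediate_ring:
  assumes "M \<subseteq> F" "subring_set F"
  shows "closed_extension F"
proof (rule closed_extension.intro)
  interpret F: subring_set F by fact
  have "inverse x \<in> F" if "x \<in> F" for x
    using inverse_eq_poly[of x] F.poly_mem[OF coeffs_in_mono[OF _ assms(1)]] that
    by (cases "x = 0") auto
  then show "subfield F ambient"
    by (auto simp: subfield_ambient_iff intro: F.add_mem F.minus_mem F.mult_mem)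
  show "\<exists>p. p \<noteq> 0 \<and> coeffs_in F p \<and> poly p x = 0" for x
    using algebraic[of x] coeffs_in_mono[OF _ assms(1)] by blast
qed (rule has_root)

lemma intermediate_field: "M \<subseteq> F \<Longrightarrow> subfield F ambient \<Longrightarrow> closed_extension F"
  by (rule intermediate_ring[OF _ subfield_subring_set])

definition adjoin :: "'a \<Rightarrow> 'a set"
  where "adjoin z = {poly p z | p. coeffs_in M p}"

lemma adjoin:
  shows closed_extension_adjoin: "closed_extension (adjoin z)"
    and subset_adjoin: "M \<subseteq> adjoin z" and mem_adjoin: "z \<in> adjoin z"
proof -
  show 1: "M \<subseteq> adjoin z"
  proof
    fix x assume "x \<in> M"
    then show "x \<in> adjoin z" unfolding adjoin_def
      by (auto intro!: exI[of _ "[:x:]"] coeffs_in_closed)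
  qed
  show "z \<in> adjoin z" unfolding adjoin_def
    by (auto intro!: exI[of _ "[:0,1:]"] coeffs_in_closed)
  show "closed_extension (adjoin z)"
  proof (rule intermediate_ring[OF 1])
    show "subring_set (adjoin z)"
    proof
      show "1 \<in> adjoin z" using 1 by auto
      show "- x \<in> adjoin z" if "x \<in> adjoin z" for x
        using that unfolding adjoin_def by (auto simp flip: poly_minus intro: coeffs_in_closed)
      show "x + y \<in> adjoin z" if "x \<in> adjoin z" "y \<in> adjoin z" for x y
        using that unfolding adjoin_def by (auto simp flip: poly_add intro: coeffs_in_closed)
      show "x * y \<in> adjoin z" if "x \<in> adjoin z" "y \<in> adjoin z" for x y
        using that unfolding adjoin_def by (auto simp flip: poly_mult intro: coeffs_in_closed)
    qed
  qed
qed

lemma adjoin_subset: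
  assumes "M \<subseteq> F" "subring_set F" "z \<in> F" shows "adjoin z \<subseteq> F"
  unfolding adjoin_def using subring_set.poly_mem[OF assms(2) coeffs_in_mono[OF _ assms(1)] assms(3)]
  by auto

end

lemma coeffs_in_pCons_iff: "coeffs_in S (pCons a p) \<longleftrightarrow> a \<in> S \<and> coeffs_in S p"
proof -
  have "(\<forall>i. coeff (pCons a p) i \<in> S) \<longleftrightarrow> a \<in> S \<and> (\<forall>i. coeff p i \<in> S)"
    by (metis coeff_pCons_0 coeff_pCons_Suc not0_implies_Suc)
  then show ?thesis by (simp add: coeffs_in_def)
qed

section \<open>Extension of embeddings into an algebraically closed field\<close>

definition coeff_pairs :: "('a::field \<times> 'a) set \<Rightarrow> 'a poly \<Rightarrow> 'a poly \<Rightarrow> bool"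
  where "coeff_pairs G p q \<longleftrightarrow> (\<forall>i. (coeff p i, coeff q i) \<in> G)"

definition root_pairs :: "('a::field \<times> 'a) set \<Rightarrow> 'a \<Rightarrow> 'a \<Rightarrow> ('a \<times> 'a) set"
  where "root_pairs G a b = {(poly p a, poly q b) | p q. coeff_pairs G p q}"

context closed_extension
begin

text \<open>Partial embeddings are represented by their graphs, so that unions of chains are immediate;
  the last condition makes the graph single-valued.\<close>

definition partial_embedding :: "('a \<times> 'a) set \<Rightarrow> bool"
  where "partial_embedding G \<longleftrightarrow> (\<forall>m\<in>M. (m, m) \<in> G) \<and>
    (\<forall>x y x' y'. (x, y) \<in> G \<longrightarrow> (x', y') \<in> G \<longrightarrow> (x + x', y + y') \<in> G \<and> (x * x', y * y') \<in> G) \<and>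
    (\<forall>x y. (x, y) \<in> G \<longrightarrow> (- x, - y) \<in> G) \<and> (\<forall>y. (0, y) \<in> G \<longrightarrow> y = 0)"

lemma partial_embeddingD:
  assumes "partial_embedding G"
  shows "m \<in> M \<Longrightarrow> (m, m) \<in> G"
    "(x, y) \<in> G \<Longrightarrow> (x', y') \<in> G \<Longrightarrow> (x + x', y + y') \<in> G"
    "(x, y) \<in> G \<Longrightarrow> (x', y') \<in> G \<Longrightarrow> (x * x', y * y') \<in> G"
    "(x, y) \<in> G \<Longrightarrow> (- x, - y) \<in> G" "(0, y) \<in> G \<Longrightarrow> y = 0"
  using assms unfolding partial_embedding_def by blast+

lemma partial_embedding_unique:
  assumes "partial_embedding G" "(x, y) \<in> G" "(x, y') \<in> G"
  shows "y = y'"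
proof -
  have "(x + - x, y + - y') \<in> G" by (intro partial_embeddingD[OF assms(1)] assms)
  then have "(0, y - y') \<in> G" by simp
  from partial_embeddingD(5)[OF assms(1) this] show ?thesis by simp
qed

lemma coeff_pairs_mult:
  assumes "partial_embedding G" "coeff_pairs G p q" "coeff_pairs G p' q'"
  shows "coeff_pairs G (p * p') (q * q')"
  unfolding coeff_pairs_def coeff_mult
proof
  fix n
  have "finite A \<Longrightarrow> ((\<Sum>i\<in>A. coeff p i * coeff p' (n - i)), (\<Sum>i\<in>A. coeff q i * coeff q' (n - i))) \<in> G" for A
    by (induction A rule: finite_induct)
      (use assms in \<open>auto simp: coeff_pairs_def intro: partial_embeddingD\<close>)
  then show "((\<Sum>i\<le>n. coeff p i * coeff p' (n - i)), (\<Sum>i\<le>n. coeff q i * coeff q' (n - i))) \<in> G"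
    by blast
qed

text \<open>Sending \<open>a\<close> to \<open>b\<close> is compatible with \<open>G\<close> if
  every polynomial relation of \<open>a\<close> is carried to a relation of \<open>b\<close>; this
  hypothesis makes the new graph single-valued, without reference to a minimal polynomial.\<close>

lemma partial_embedding_root_pairs:
  assumes G: "partial_embedding G" and ab: "\<And>p q. coeff_pairs G p q \<Longrightarrow> poly p a = 0 \<Longrightarrow> poly q b = 0"
  shows "partial_embedding (root_pairs G a b)" "G \<subseteq> root_pairs G a b" "(a, b) \<in> root_pairs G a b"
proof -
  have I: "(poly p a, poly q b) \<in> root_pairs G a b" if "coeff_pairs G p q" for p q
    using that unfolding root_pairs_def by blast
  have const: "coeff_pairs G [:x:] [:y:]" if "(x, y) \<in> G" for x y
    using that partial_embeddingD(1)[OF G zero_mem]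
    by (auto simp: coeff_pairs_def coeff_pCons split: nat.split)
  show sub: "G \<subseteq> root_pairs G a b"
    using I[OF const] by auto
  have "coeff_pairs G [:0, 1:] [:0, 1:]"
    using partial_embeddingD(1)[OF G] by (auto simp: coeff_pairs_def coeff_pCons split: nat.split)
  from I[OF this] show "(a, b) \<in> root_pairs G a b" by simp
  have add: "coeff_pairs G (p + p') (q + q')" and minus: "coeff_pairs G (- p) (- q)"
    if "coeff_pairs G p q" "coeff_pairs G p' q'" for p q p' q'
    using that by (auto simp: coeff_pairs_def intro: partial_embeddingD[OF G])
  show "partial_embedding (root_pairs G a b)"
    unfolding partial_embedding_def
  proof (intro conjI allI impI ballI)
    fix m assume "m \<in> M" then show "(m, m) \<in> root_pairs G a b"
      using sub partial_embeddingD(1)[OF G] by blast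
  next
    fix x y x' y' assume "(x, y) \<in> root_pairs G a b" "(x', y') \<in> root_pairs G a b"
    then obtain p q p' q' where "x = poly p a" "y = poly q b" "x' = poly p' a" "y' = poly q' b"
      "coeff_pairs G p q" "coeff_pairs G p' q'"
      unfolding root_pairs_def by blast
    then show "(x + x', y + y') \<in> root_pairs G a b" "(x * x', y * y') \<in> root_pairs G a b"
      using I[OF add] I[OF coeff_pairs_mult[OF G]] by force+
  next
    fix x y assume "(x, y) \<in> root_pairs G a b"
    then show "(- x, - y) \<in> root_pairs G a b"
      using I[OF minus] unfolding root_pairs_def by force
  next
    fix y assume "(0, y) \<in> root_pairs G a b"
    then show "y = 0" using ab unfolding root_pairs_def by auto
  qed
qed

text \<open>Zorn's lemma for graphs containing \<open>(a, b)\<close>. The domain of a maximal graph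
  is everything, because the minimal polynomial of a missing element can be transported and the
  result has a root.\<close>

theorem conjugate_embedding:
  assumes "conjugate M a b"
  obtains \<sigma> where "\<And>x y. \<sigma> (x + y) = \<sigma> x + \<sigma> y" "\<And>x y. \<sigma> (x * y) = \<sigma> x * \<sigma> y"
    "\<And>m. m \<in> M \<Longrightarrow> \<sigma> m = m" "\<sigma> a = b"
proof -
  define \<A> where "\<A> = {G. partial_embedding G \<and> (a, b) \<in> G}"
  have Id: "partial_embedding (Id_on M)"
    by (auto simp: partial_embedding_def intro: add_mem mult_mem minus_mem)
  have "coeffs_in M p \<and> q = p" if "coeff_pairs (Id_on M) p q" for p q
    using that by (auto simp: coeff_pairs_def coeffs_in_def Id_on_def poly_eq_iff)
  then have "root_pairs (Id_on M) a b \<in> \<A>"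
    unfolding \<A>_def
    using partial_embedding_root_pairs[OF Id, of a b] assms unfolding conjugate_def by blast
  moreover have "\<Union>\<C> \<in> \<A>" if C: "\<C> \<noteq> {}" "subset.chain \<A> \<C>" for \<C>
  proof -
    have sub: "G \<in> \<A>" if "G \<in> \<C>" for G using that C(2) by (auto simp: subset_chain_def)
    have two: "\<exists>G\<in>\<C>. u \<in> G \<and> v \<in> G" if "u \<in> \<Union>\<C>" "v \<in> \<Union>\<C>" for u v
    proof -
      obtain G H where "G \<in> \<C>" "u \<in> G" "H \<in> \<C>" "v \<in> H" using \<open>u \<in> \<Union>\<C>\<close> \<open>v \<in> \<Union>\<C>\<close> by blast
      moreover from this have "G \<subseteq> H \<or> H \<subseteq> G" using C(2) by (auto simp: subset_chain_def)
      ultimately show ?thesis by blast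
    qed
    have pe: "partial_embedding G" if "G \<in> \<C>" for G using sub[OF that] by (simp add: \<A>_def)
    obtain G0 where G0: "G0 \<in> \<C>" using C(1) by blast
    have "partial_embedding (\<Union>\<C>)"
      unfolding partial_embedding_def
    proof (intro conjI allI impI ballI)
      fix m assume "m \<in> M" then show "(m, m) \<in> \<Union>\<C>"
        using G0 partial_embeddingD(1)[OF pe[OF G0]] by blast
    next
      fix x y x' y' assume "(x, y) \<in> \<Union>\<C>" "(x', y') \<in> \<Union>\<C>"
      then obtain G where "G \<in> \<C>" "(x, y) \<in> G" "(x', y') \<in> G" using two by blast
      then show "(x + x', y + y') \<in> \<Union>\<C>" "(x * x', y * y') \<in> \<Union>\<C>"
        using partial_embeddingD(2,3)[OF pe] by blast+
    next
      fix x y assume "(x, y) \<in> \<Union>\<C>"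
      then show "(- x, - y) \<in> \<Union>\<C>" using partial_embeddingD(4)[OF pe] by blast
    next
      fix y assume "(0, y) \<in> \<Union>\<C>"
      then show "y = 0" using partial_embeddingD(5)[OF pe] by blast
    qed
    moreover have "(a, b) \<in> \<Union>\<C>" using G0 sub[OF G0] by (auto simp: \<A>_def)
    ultimately show ?thesis by (simp add: \<A>_def)
  qed
  ultimately obtain G where G: "G \<in> \<A>" and max: "\<And>H. H \<in> \<A> \<Longrightarrow> G \<subseteq> H \<Longrightarrow> H = G"
    using subset_Zorn_nonempty[of \<A>] by blast
  have pe: "partial_embedding G" and ab: "(a, b) \<in> G" using G by (auto simp: \<A>_def)
  have MF: "M \<subseteq> Domain G" using partial_embeddingD(1)[OF pe] by blast
  have "subring_set (Domain G)"
  proof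
    show "1 \<in> Domain G" using MF by auto
    show "- x \<in> Domain G" if "x \<in> Domain G" for x
      using that partial_embeddingD(4)[OF pe] by blast
    show "x + y \<in> Domain G" "x * y \<in> Domain G" if "x \<in> Domain G" "y \<in> Domain G" for x y
      using that partial_embeddingD(2,3)[OF pe] by blast+
  qed
  then interpret F: closed_extension "Domain G" by (rule intermediate_ring[OF MF])
  have lift: "\<exists>q. coeff_pairs G p q" if p: "coeffs_in (Domain G) p" for p
  proof -
    from p have "\<forall>i. \<exists>y. (coeff p i, y) \<in> G" by (auto simp: coeffs_in_def)
    then obtain y where y: "\<And>i. (coeff p i, y i) \<in> G" by metis
    have "y i = 0" if "i > degree p" for i
      using y[of i] that partial_embeddingD(5)[OF pe] by (simp add: coeff_eq_0)
    then have "coeff (Poly (map y [0..<Suc (degree p)])) i = y i" for i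
      by (auto simp: nth_default_def simp del: upt_Suc)
    with y show ?thesis unfolding coeff_pairs_def by metis
  qed
  have total: "x \<in> Domain G" for x
  proof -
    obtain f where f: "is_minpoly (Domain G) x f" using F.minpoly_exists by blast
    obtain g where g: "coeff_pairs G f g" using lift is_minpolyD(1)[OF f] by blast
    \<comment> \<open>The leading coefficient 1 is transported to 1, so \<open>g\<close> is not
      constant and has a root to which \<open>x\<close> can be sent.\<close>
    have "(1, coeff g (degree f)) \<in> G"
      using g is_minpolyD(2)[OF f] unfolding coeff_pairs_def by metis
    then have "coeff g (degree f) = 1"
      using partial_embedding_unique[OF pe] partial_embeddingD(1)[OF pe one_mem] by blast
    then have "degree g > 0" using is_minpolyD(5)[OF f]
      by (metis le_degree less_le_trans one_neq_zero)
    then obtain y where y: "poly g y = 0" using has_root by blast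
    have "poly q y = 0" if pq: "coeff_pairs G p q" "poly p x = 0" for p q
    proof -
      have "coeffs_in (Domain G) p" using pq by (auto simp: coeff_pairs_def coeffs_in_def)
      then obtain s where s: "coeffs_in (Domain G) s" "p = f * s"
        using is_minpoly_dvd[OF f] pq by blast
      obtain t where t: "coeff_pairs G s t" using lift s by blast
      have "coeff_pairs G p (g * t)" unfolding s(2) by (rule coeff_pairs_mult[OF pe g t])
      then have "q = g * t"
        using pq(1) partial_embedding_unique[OF pe] unfolding coeff_pairs_def
        by (intro poly_eqI) metis
      with y show ?thesis by simp
    qed
    then have "partial_embedding (root_pairs G x y)" "G \<subseteq> root_pairs G x y" "(x, y) \<in> root_pairs G x y"
      using partial_embedding_root_pairs[OF pe, of x y] by blast+
    then have "root_pairs G x y \<in> \<A>" "G \<subseteq> root_pairs G x y" "(x, y) \<in> root_pairs G x y"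
      using ab by (auto simp: \<A>_def)
    with max show ?thesis by blast
  qed
  define \<sigma> where "\<sigma> x = (SOME y. (x, y) \<in> G)" for x
  have \<sigma>: "(x, \<sigma> x) \<in> G" for x
    unfolding \<sigma>_def using total[of x] by (auto intro: someI)
  have eq: "\<sigma> x = y" if "(x, y) \<in> G" for x y
    using partial_embedding_unique[OF pe \<sigma> that] .
  show thesis
    by (rule that[of \<sigma>]; rule eq) (auto intro: partial_embeddingD[OF pe] \<sigma> ab)
qed

end

locale field_embedding =
  fixes \<sigma> :: "'a::field \<Rightarrow> 'a" and M
  assumes hom_add: "\<sigma> (x + y) = \<sigma> x + \<sigma> y" and hom_mult: "\<sigma> (x * y) = \<sigma> x * \<sigma> y"
    and fixes_M: "m \<in> M \<Longrightarrow> \<sigma> m = m" and one_M: "1 \<in> M"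
begin

lemma hom_0: "\<sigma> 0 = 0"
  using hom_add[of 0 0] by (metis add_0_left add_cancel_right_left)

lemma hom_1: "\<sigma> 1 = 1"
  using fixes_M one_M by blast

lemma hom_eq_0_iff: "\<sigma> x = 0 \<longleftrightarrow> x = 0"
  using hom_mult[of x "inverse x"] by (cases "x = 0") (auto simp: hom_0 hom_1)

lemma hom_minus: "\<sigma> (- x) = - \<sigma> x"
  using hom_add[of x "- x"] by (simp add: hom_0 eq_neg_iff_add_eq_0 add.commute)

lemma inj_hom: "inj \<sigma>"
proof
  fix x y assume "\<sigma> x = \<sigma> y"
  then have "\<sigma> (x + - y) = 0" by (simp only: hom_add hom_minus) simp
  then show "x = y" by (simp add: hom_eq_0_iff)
qed

lemma hom_power: "\<sigma> (x ^ n) = \<sigma> x ^ n"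
  by (induction n) (auto simp: hom_1 hom_mult)

lemma hom_prod: "\<sigma> (prod f A) = (\<Prod>x\<in>A. \<sigma> (f x))"
  by (induction A rule: infinite_finite_induct) (auto simp: hom_1 hom_mult)

lemma hom_poly: "coeffs_in M p \<Longrightarrow> \<sigma> (poly p x) = poly p (\<sigma> x)"
  by (induction p) (auto simp: hom_0 hom_add hom_mult fixes_M coeffs_in_pCons_iff)

lemma hom_conjugate: "conjugate M x (\<sigma> x)"
  unfolding conjugate_def by (metis hom_poly hom_0)

end

context closed_extension
begin

lemma conjugate_field_embedding:
  assumes "conjugate M a b"
  obtains \<sigma> where "field_embedding \<sigma> M" "\<sigma> a = b"
proof -
  obtain \<sigma> where "\<And>x y. \<sigma> (x + y) = \<sigma> x + \<sigma> y" "\<And>x y. \<sigma> (x * y) = \<sigma> x * \<sigma> y"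
    "\<And>m. m \<in> M \<Longrightarrow> \<sigma> m = m" "\<sigma> a = b" using conjugate_embedding[OF assms] by metis
  then show thesis by (intro that[of \<sigma>]) (auto simp: field_embedding_def)
qed

end

section \<open>Valuations\<close>

locale valued_field =
  fixes \<mu> :: "'a::field \<Rightarrow> 'g::linordered_ab_group_add"
  assumes valuation: "valuation_on UNIV \<mu>"
begin

definition vring :: "'a set" where "vring = valuation_ring UNIV \<mu>"

definition vmax :: "'a set" where "vmax = maximal_ideal_of UNIV \<mu>"

lemma val_mult: "x \<noteq> 0 \<Longrightarrow> y \<noteq> 0 \<Longrightarrow> \<mu> (x * y) = \<mu> x + \<mu> y"
  using valuation by (auto simp: valuation_on_def)

lemma val_add: "x \<noteq> 0 \<Longrightarrow> y \<noteq> 0 \<Longrightarrow> x + y \<noteq> 0 \<Longrightarrow> min (\<mu> x) (\<mu> y) \<le> \<mu> (x + y)"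
  using valuation by (auto simp: valuation_on_def)

lemma val_add_ge: "x \<noteq> 0 \<Longrightarrow> y \<noteq> 0 \<Longrightarrow> x + y \<noteq> 0 \<Longrightarrow> \<gamma> \<le> \<mu> x \<Longrightarrow> \<gamma> \<le> \<mu> y \<Longrightarrow> \<gamma> \<le> \<mu> (x + y)"
  by (rule order_trans[OF _ val_add]) auto

lemma val_add_gt: "x \<noteq> 0 \<Longrightarrow> y \<noteq> 0 \<Longrightarrow> x + y \<noteq> 0 \<Longrightarrow> \<gamma> < \<mu> x \<Longrightarrow> \<gamma> < \<mu> y \<Longrightarrow> \<gamma> < \<mu> (x + y)"
  by (rule less_le_trans[OF _ val_add]) auto

lemma val_1 [simp]: "\<mu> 1 = 0"
  using val_mult[of 1 1] by simp

lemma val_minus_1: "\<mu> (-1) = 0"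
proof -
  have "\<mu> (-1) + \<mu> (-1) = 0" using val_mult[of "-1" "-1"] by simp
  then show ?thesis by (simp add: double_zero_sym)
qed

lemma val_minus [simp]: "\<mu> (- x) = \<mu> x"
  using val_mult[of "-1" x] by (cases "x = 0") (auto simp: val_minus_1)

lemma val_inverse: "x \<noteq> 0 \<Longrightarrow> \<mu> (inverse x) = - \<mu> x"
  using val_mult[of x "inverse x"] by (simp add: eq_neg_iff_add_eq_0 add.commute)

lemma val_divide: "x \<noteq> 0 \<Longrightarrow> y \<noteq> 0 \<Longrightarrow> \<mu> (x / y) = \<mu> x - \<mu> y"
  by (simp add: divide_inverse val_mult val_inverse)

lemma vring_iff: "x \<in> vring \<longleftrightarrow> x = 0 \<or> 0 \<le> \<mu> x"
  by (auto simp: vring_def valuation_ring_def)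

lemma vmax_iff: "x \<in> vmax \<longleftrightarrow> x = 0 \<or> 0 < \<mu> x"
  by (auto simp: vmax_def maximal_ideal_of_def)

lemma vmax_subset: "vmax \<subseteq> vring"
  by (auto simp: vmax_iff vring_iff)

sublocale vring: subring_set vring
proof
  show "x + y \<in> vring" if "x \<in> vring" "y \<in> vring" for x y
    using that val_add_ge[of x y 0] by (cases "x = 0 \<or> y = 0") (auto simp: vring_iff)
  show "x * y \<in> vring" if "x \<in> vring" "y \<in> vring" for x y
    using that by (cases "x = 0 \<or> y = 0") (auto simp: vring_iff val_mult)
qed (auto simp: vring_iff)

lemma vmax_closed:
  shows "0 \<in> vmax" "x \<in> vmax \<Longrightarrow> y \<in> vmax \<Longrightarrow> x + y \<in> vmax" "x \<in> vmax \<Longrightarrow> - x \<in> vmax"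
    "x \<in> vring \<Longrightarrow> y \<in> vmax \<Longrightarrow> x * y \<in> vmax" "x \<in> vmax \<Longrightarrow> y \<in> vring \<Longrightarrow> x * y \<in> vmax"
proof -
  show "0 \<in> vmax" "x \<in> vmax \<Longrightarrow> - x \<in> vmax" by (auto simp: vmax_iff)
  show "x \<in> vmax \<Longrightarrow> y \<in> vmax \<Longrightarrow> x + y \<in> vmax"
    using val_add_gt[of x y 0] by (cases "x = 0 \<or> y = 0") (auto simp: vmax_iff)
  show "x \<in> vring \<Longrightarrow> y \<in> vmax \<Longrightarrow> x * y \<in> vmax" "x \<in> vmax \<Longrightarrow> y \<in> vring \<Longrightarrow> x * y \<in> vmax"
    by (cases "x = 0 \<or> y = 0"; auto simp: vmax_iff vring_iff val_mult intro: add_nonneg_pos add_pos_nonneg)+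
qed

lemma vmax_diff: "x \<in> vmax \<Longrightarrow> y \<in> vmax \<Longrightarrow> x - y \<in> vmax"
  using vmax_closed(2)[of x "- y"] vmax_closed(3)[of y] by simp

lemma vmax_sum: "(\<And>i. i \<in> A \<Longrightarrow> f i \<in> vmax) \<Longrightarrow> sum f A \<in> vmax"
  by (induction A rule: infinite_finite_induct) (auto intro: vmax_closed)

lemma val_power_pos: "x \<noteq> 0 \<Longrightarrow> n > 0 \<Longrightarrow> 0 < \<mu> x \<Longrightarrow> 0 < \<mu> (x ^ n)"
proof (induction n)
  case (Suc n)
  then show ?case by (cases "n = 0") (auto simp: val_mult intro: add_pos_pos)
qed simp

lemma val_power_eq_0_iff:
  assumes "x \<noteq> 0" "n > 0" shows "\<mu> (x ^ n) = 0 \<longleftrightarrow> \<mu> x = 0"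
proof -
  have "\<mu> x = 0 \<Longrightarrow> \<mu> (x ^ n) = 0"
    using assms(1) by (induction n) (auto simp: val_mult)
  moreover have "\<mu> (x ^ n) \<noteq> 0" if "\<mu> x < 0"
    using val_power_pos[of "inverse x" n] assms that by (simp add: val_inverse power_inverse)
  moreover have "\<mu> (x ^ n) \<noteq> 0" if "\<mu> x > 0"
    using val_power_pos[of x n] assms that by simp
  ultimately show ?thesis by (metis linorder_cases)
qed

lemma val_prod: "(\<And>i. i \<in> A \<Longrightarrow> f i \<noteq> 0) \<Longrightarrow> \<mu> (prod f A) = (\<Sum>i\<in>A. \<mu> (f i))"
  by (induction A rule: infinite_finite_induct) (auto simp: val_mult)

text \<open>Two elements agree modulo the subgroup \<open>1 + vmax\<close> of the multiplicative
  group. If every nonzero element of an extension is near one of the base field, value group and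
  residue field are both unchanged, so \<open>near\<close> expresses immediacy by a single
  multiplicative condition.\<close>

definition near :: "'a \<Rightarrow> 'a \<Rightarrow> bool"
  where "near x d \<longleftrightarrow> d \<noteq> 0 \<and> x / d - 1 \<in> vmax"

lemma near_val: assumes "near x d" shows "x \<noteq> 0" "d \<noteq> 0" "\<mu> x = \<mu> d"
proof -
  define u where "u = x / d - 1"
  have u: "u \<in> vmax" and d: "d \<noteq> 0" and x: "x = d * (1 + u)"
    using assms by (auto simp: near_def u_def field_simps)
  have 1: "1 + u \<noteq> 0" using u by (auto simp: vmax_iff add_eq_0_iff)
  then have "1 + u \<in> vring" using u vmax_subset by (intro vring.add_mem) auto
  moreover have "1 + u \<notin> vmax" using vmax_diff[of "1 + u" u] u by (auto simp: vmax_iff)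
  ultimately have "\<mu> (1 + u) = 0" using 1 by (auto simp: vring_iff vmax_iff)
  then show "x \<noteq> 0" "d \<noteq> 0" "\<mu> x = \<mu> d" using 1 d x by (auto simp: val_mult)
qed

lemma near_refl: "d \<noteq> 0 \<Longrightarrow> near d d"
  by (simp add: near_def vmax_iff)

lemma near_mult: assumes "near x d" "near y e" shows "near (x * y) (d * e)"
proof -
  have "(x * y) / (d * e) - 1 = (x / d - 1) * (y / e) + (y / e - 1)"
    using near_val[OF assms(1)] near_val[OF assms(2)] by (simp add: field_simps)
  moreover have "y / e \<in> vring" using near_val[OF assms(2)] by (simp add: vring_iff val_divide)
  moreover have "x / d - 1 \<in> vmax" "y / e - 1 \<in> vmax" using assms by (auto simp: near_def)
  ultimately have "(x * y) / (d * e) - 1 \<in> vmax" by (simp only: vmax_closed)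
  then show ?thesis using near_val[OF assms(1)] near_val[OF assms(2)] by (simp add: near_def)
qed

lemma near_inverse: assumes "near x d" shows "near (inverse x) (inverse d)"
proof -
  have "inverse x / inverse d - 1 = - (d / x) * (x / d - 1)"
    using near_val[OF assms] by (simp add: field_simps)
  moreover have "- (d / x) \<in> vring" using near_val[OF assms] by (simp add: vring_iff val_divide)
  moreover have "x / d - 1 \<in> vmax" using assms by (auto simp: near_def)
  ultimately have "inverse x / inverse d - 1 \<in> vmax" by (simp only: vmax_closed)
  then show ?thesis using near_val[OF assms] by (simp add: near_def)
qed

lemma near_divide: "near x d \<Longrightarrow> near y e \<Longrightarrow> near (x / y) (d / e)"
  unfolding divide_inverse by (intro near_mult near_inverse)

lemma near_power: "near x d \<Longrightarrow> near (x ^ n) (d ^ n)"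
  by (induction n) (auto intro: near_mult near_refl)

lemma near_trans: assumes "near x d" "near d e" shows "near x e"
proof -
  have "x * d / (d * e) = x / e" using near_val[OF assms(1)] by simp
  with near_mult[OF assms] near_val[OF assms(2)] show ?thesis by (simp add: near_def)
qed

lemma near_sym: assumes "near x d" shows "near d x"
proof -
  have "inverse x * (x * d) = d" "inverse d * (x * d) = x"
    using near_val[OF assms] by (simp_all add: field_simps)
  with near_mult[OF near_inverse[OF assms] near_refl[of "x * d"]] near_val[OF assms]
  show ?thesis by simp
qed

lemma near_diff_vmax: "near x d \<Longrightarrow> x \<in> vring \<Longrightarrow> x - d \<in> vmax"
proof -
  assume *: "near x d" "x \<in> vring"
  then have "d \<in> vring" using near_val[OF *(1)] by (simp add: vring_iff)
  moreover have "x - d = d * (x / d - 1)" using near_val[OF *(1)] by (simp add: field_simps)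
  moreover have "x / d - 1 \<in> vmax" using *(1) by (simp add: near_def)
  ultimately show ?thesis by (simp only: vmax_closed)
qed

text \<open>Zero is excluded both as \<open>z\<close> and as a competing root, since
  \<open>\<mu>\<close> has no meaning there. No base field is mentioned, so fields closed under such
  roots can be intersected.\<close>

definition isolated_root :: "'a poly \<Rightarrow> 'a \<Rightarrow> bool"
  where "isolated_root p z \<longleftrightarrow> z \<noteq> 0 \<and> poly p z = 0 \<and> poly (pderiv p) z \<noteq> 0 \<and>
    (\<forall>y. poly p y = 0 \<longrightarrow> y \<noteq> 0 \<longrightarrow> y \<noteq> z \<longrightarrow> \<mu> y \<noteq> \<mu> z)"

definition isolated_closed :: "'a set \<Rightarrow> bool"
  where "isolated_closed N \<longleftrightarrow> (\<forall>p z. coeffs_in N p \<longrightarrow> isolated_root p z \<longrightarrow> z \<in> N)"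

end

section \<open>Reduction of polynomials at isolated roots\<close>

locale valued_closure = closed_extension M + valued_field \<mu>
  for M :: "'a::field set" and \<mu> :: "'a \<Rightarrow> 'g::linordered_ab_group_add"
begin

text \<open>Split off one linear factor at a time. Up to a scalar, \<open>X - s\<close> reduces to
  \<open>X\<close> if \<open>s\<close> lies in the maximal ideal and to a nonzero constant if
  \<open>inverse s\<close> does; no root of value 0 is there to give another factor. Thus
  \<open>h\<close> counts the roots in the maximal ideal.\<close>

lemma reduction_monomial:
  assumes "r \<noteq> 0" "\<And>y. poly r y = 0 \<Longrightarrow> y \<noteq> 0 \<Longrightarrow> \<mu> y \<noteq> 0"
  shows "\<exists>c h e. c \<noteq> 0 \<and> coeffs_in vmax e \<and> r = smult c (e + monom 1 h)"
  using assms
proof (induction "degree r" arbitrary: r)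
  case 0
  then obtain c where c: "r = [:c:]" by (metis degree_eq_zeroE)
  then have "c \<noteq> 0" using 0(2) by auto
  moreover have "coeffs_in vmax 0" by (simp add: coeffs_in_def vmax_closed)
  moreover have "r = smult c (0 + monom 1 0)" by (simp add: c monom_0)
  ultimately show ?case by blast
next
  case (Suc n)
  obtain s where s: "poly r s = 0" using has_root[of r] Suc(2) by auto
  then obtain r' where r': "r = [:-s, 1:] * r'" by (metis dvdE poly_eq_0_iff_dvd)
  have nz: "r' \<noteq> 0" using Suc.prems(1) r' by auto
  then have "degree r = Suc (degree r')" unfolding r' by (subst degree_mult_eq) auto
  then have "n = degree r'" using Suc(2) by simp
  moreover have "\<mu> y \<noteq> 0" if "poly r' y = 0" "y \<noteq> 0" for y
    using Suc.prems(2)[of y] that unfolding r' by simp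
  ultimately obtain c h e where IH: "c \<noteq> 0" "coeffs_in vmax e" "r' = smult c (e + monom 1 h)"
    using Suc(1)[of r'] nz by metis
  have mult: "coeffs_in vmax (p * q)" if "coeffs_in vring p" "coeffs_in vmax q" for p q
    by (rule coeffs_in_mult[OF that]) (auto intro: vmax_closed)
  have add: "coeffs_in vmax (p + q)" if "coeffs_in vmax p" "coeffs_in vmax q" for p q
    using that by (auto simp: coeffs_in_def intro: vmax_closed)
  show ?case
  proof (cases "s \<in> vmax")
    case True
    \<comment> \<open>The factor \<open>X - s\<close> raises the exponent of the monomial by one;
      the term \<open>- s * X^h\<close> is absorbed in the error.\<close>
    define e' where "e' = [:-s, 1:] * e + smult (- s) (monom 1 h)"
    have "coeffs_in vmax e'" unfolding e'_def
    proof (intro add mult)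
      show "coeffs_in vring [:- s, 1:]" using True vmax_subset
        by (auto simp: coeffs_in_pCons_iff intro: vring.minus_mem vring.coeffs_in_closed)
      show "coeffs_in vmax (smult (- s) (monom 1 h))" using True
        by (auto simp: coeffs_in_def vmax_closed)
    qed (rule IH)
    moreover have "monom 1 (Suc h) = [:0, 1:] * (monom 1 h :: 'a poly)"
      by (simp add: monom_Suc)
    then have "[:-s, 1:] * (e + monom 1 h) = e' + monom 1 (Suc h)"
      unfolding e'_def by (simp add: algebra_simps smult_add_right)
    then have "r = smult c (e' + monom 1 (Suc h))"
      unfolding r' IH(3) by (simp only: mult_smult_right)
    ultimately show ?thesis using IH(1) by blast
  next
    case False
    have s0: "s \<noteq> 0" using False by (auto simp: vmax_closed)
    then have "\<mu> s \<noteq> 0" using Suc.prems(2)[of s] s by blast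
    then have inv: "inverse s \<in> vmax" using False s0 by (auto simp: vmax_iff val_inverse)
    \<comment> \<open>Here \<open>X - s\<close> is \<open>- s\<close> times
      \<open>1 - inverse s * X\<close>, so the exponent is kept and only the error changes.\<close>
    define e' where "e' = [:1, - inverse s:] * e + [:0, - inverse s:] * monom 1 h"
    have "coeffs_in vmax [:0, - inverse s:]" using inv
      by (auto simp: coeffs_in_pCons_iff coeffs_in_def[of _ 0] intro: vmax_closed)
    moreover have "coeffs_in vring (monom 1 h)" by (auto simp: coeffs_in_def)
    ultimately have tail: "coeffs_in vmax ([:0, - inverse s:] * monom 1 h)"
      by (subst mult.commute) (rule mult)
    have "coeffs_in vring [:1, - inverse s:]"
      using inv vmax_subset by (auto simp: coeffs_in_pCons_iff intro: vring.minus_mem vring.coeffs_in_closed)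
    then have "coeffs_in vmax e'" unfolding e'_def using add[OF mult[OF _ IH(2)] tail] by blast
    have "[:- s, 1:] = smult (- s) [:1, - inverse s:]" using s0 by simp
    then have 1: "r = smult (- s * c) ([:1, - inverse s:] * (e + monom 1 h))"
      unfolding r' IH(3) by (simp only: mult_smult_left mult_smult_right smult_smult mult.commute[of c])
    have 2: "[:1, - inverse s:] * (e + monom 1 h) = e' + monom 1 h"
      unfolding e'_def by (simp add: algebra_simps smult_add_right)
    show ?thesis
    proof (intro exI conjI)
      show "- s * c \<noteq> 0" using s0 IH(1) by simp
      show "r = smult (- s * c) (e' + monom 1 h)" by (rule 1[unfolded 2])
    qed fact
  qed
qed

text \<open>After the substitution of \<open>z * X\<close> for \<open>X\<close>, the polynomial reduces to a multiple of
  \<open>X ^ h * (X - 1)\<close>, so \<open>z\<close> is close to the quotient of two adjacent coefficients.\<close>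

lemma isolated_root_near:
  assumes p: "coeffs_in M p" and iso: "isolated_root p z"
  shows "\<exists>d\<in>M. near z d"
proof -
  have z: "z \<noteq> 0" "poly p z = 0" "poly (pderiv p) z \<noteq> 0"
    and val: "\<And>y. poly p y = 0 \<Longrightarrow> y \<noteq> 0 \<Longrightarrow> y \<noteq> z \<Longrightarrow> \<mu> y \<noteq> \<mu> z"
    using iso by (auto simp: isolated_root_def)
  define q where "q = pcompose p [:0, z:]"
  have "poly q 1 = 0" using z by (simp add: q_def poly_pcompose)
  then obtain r where r: "q = [:-1, 1:] * r" by (metis dvdE poly_eq_0_iff_dvd)
  have "poly (pderiv q) 1 \<noteq> 0" using z
    by (simp add: q_def pderiv_pcompose poly_pcompose pderiv_pCons)
  then have r1: "poly r 1 \<noteq> 0" unfolding r pderiv_mult by (simp add: pderiv_pCons)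
  have "\<mu> y \<noteq> 0" if y: "poly r y = 0" "y \<noteq> 0" for y
  proof -
    have "poly q y = 0" unfolding r using y(1) by simp
    then have "poly p (z * y) = 0" by (simp add: q_def poly_pcompose mult.commute)
    moreover have "y \<noteq> 1" using r1 y by auto
    ultimately show ?thesis using val[of "z * y"] z y by (simp add: val_mult)
  qed
  moreover have "r \<noteq> 0" using r1 by auto
  ultimately obtain c h e where ceh: "c \<noteq> 0" "coeffs_in vmax e" "r = smult c (e + monom 1 h)"
    using reduction_monomial[of r] by blast
  \<comment> \<open>Modulo the maximal ideal, \<open>q\<close> divided by \<open>c\<close> is
    \<open>(X - 1) * X^h\<close>, so \<open>- a\<close> and \<open>b\<close> are the two
    coefficients that reduce to -1 and 1.\<close>
  define a where "a = - (coeff q h / c)"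
  define b where "b = coeff q (Suc h) / c"
  have q: "q = pCons 0 r - r" unfolding r by simp
  have em: "coeff e i \<in> vmax" for i using ceh(2) by (simp add: coeffs_in_def)
  have cr: "coeff r i = c * (coeff e i + (if i = h then 1 else 0))" for i
    by (simp add: ceh(3) coeff_monom)
  have "coeff q h = c * ((if h = 0 then 0 else coeff e (h - 1)) - coeff e h - 1)"
    unfolding q by (cases h) (simp_all add: cr algebra_simps)
  then have "a - 1 = coeff e h - (if h = 0 then 0 else coeff e (h - 1))"
    using ceh(1) by (simp add: a_def)
  then have "near a 1" using em vmax_diff by (simp add: near_def vmax_closed)
  moreover have "coeff q (Suc h) = c * (1 + coeff e h - coeff e (Suc h))"
    unfolding q by (simp add: cr algebra_simps)
  then have "b - 1 = coeff e h - coeff e (Suc h)" using ceh(1) by (simp add: b_def)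
  then have "near b 1" using em vmax_diff by (simp add: near_def)
  ultimately have near: "near (a / b) 1" using near_divide[of a 1 b 1] by simp
  define d where "d = - coeff p h / coeff p (Suc h)"
  \<comment> \<open>The substitution multiplied the i-th coefficient by \<open>z^i\<close>; in the
    quotient everything but one factor \<open>z\<close> cancels, and what remains is
    \<open>d\<close>, built from coefficients of \<open>p\<close>.\<close>
  have "coeff q i = z ^ i * coeff p i" for i
    by (simp add: q_def coeff_pcompose_linear)
  then have "a / b = - (z ^ h * coeff p h / c) / (z ^ Suc h * coeff p (Suc h) / c)"
    unfolding a_def b_def by simp
  also have "\<dots> = d / z" using ceh(1) z(1) unfolding d_def by simp
  finally have "a / b = d / z" .
  with near z(1) have "near d z" by (simp add: near_def)
  then have "near z d" by (rule near_sym)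
  moreover have "d \<in> M" using p subfield_closed[OF subfield_M]
    by (auto simp: d_def coeffs_in_def)
  ultimately show ?thesis by blast
qed

end

section \<open>Conjugacy, separability and powers\<close>

lemma degree_pderiv_le:
  fixes p :: "'a::field poly" shows "degree (pderiv p) \<le> degree p - 1"
  by (intro degree_le) (auto simp: coeff_pderiv coeff_eq_0)

context closed_extension
begin

lemma conjugate_refl: "conjugate M a a"
  by (simp add: conjugate_def)

lemma conjugate_trans: "conjugate M a b \<Longrightarrow> conjugate M b c \<Longrightarrow> conjugate M a c"
  by (auto simp: conjugate_def)

text \<open>Factor the minimal polynomial \<open>f\<close> of \<open>a\<close> as
  \<open>g * q\<close>, with \<open>g\<close> that of \<open>b\<close>. Since \<open>q\<close> has
  smaller degree than \<open>f\<close>, it does not vanish at \<open>a\<close>, so \<open>g\<close>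
  does.\<close>

lemma conjugate_sym:
  assumes "conjugate M a b" shows "conjugate M b a"
proof -
  obtain f where f: "is_minpoly M a f" using minpoly_exists by blast
  obtain g where g: "is_minpoly M b g" using minpoly_exists by blast
  have "poly f b = 0" using f assms minpoly_root_iff_conjugate by blast
  then obtain q where q: "coeffs_in M q" "f = g * q"
    using is_minpoly_dvd[OF g is_minpolyD(1)[OF f]] by blast
  have "poly q a \<noteq> 0"
  proof
    assume "poly q a = 0"
    then obtain s where "q = f * s" using is_minpoly_dvd[OF f q(1)] by blast
    moreover have nz: "q \<noteq> 0" using q(2) is_minpolyD(4)[OF f] by auto
    ultimately have "degree f \<le> degree q"
      by (metis degree_mult_eq le_add1 mult_zero_right is_minpolyD(4)[OF f])
    with q(2) nz is_minpolyD[OF g] show False by (auto simp: degree_mult_eq)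
  qed
  moreover have "poly g a * poly q a = 0"
    using is_minpolyD(3)[OF f] q(2) by simp
  ultimately have "poly g a = 0" by simp
  then show ?thesis using g minpoly_root_iff_conjugate by blast
qed

lemma conjugate_nonzero: "conjugate M a b \<Longrightarrow> a \<noteq> 0 \<Longrightarrow> b \<noteq> 0"
  using conjugate_field_embedding field_embedding.hom_eq_0_iff by metis

lemma finite_conjugates: "finite {b. conjugate M a b}"
proof -
  obtain f where f: "is_minpoly M a f" using minpoly_exists by blast
  then show ?thesis
    using poly_roots_finite[OF is_minpolyD(4)[OF f]] by (simp add: minpoly_root_iff_conjugate)
qed

text \<open>All roots of the minimal polynomial are conjugates, so \<open>z\<close> is its only
  root; separability makes this root simple and the polynomial linear.\<close>

lemma mem_if_only_conjugate:
  assumes f: "is_minpoly M z f" "poly (pderiv f) z \<noteq> 0" and only: "\<And>b. conjugate M z b \<Longrightarrow> b = z"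
  shows "z \<in> M"
proof -
  obtain g where g: "f = [:-z, 1:] * g"
    using is_minpolyD(3)[OF f(1)] by (metis dvdE poly_eq_0_iff_dvd)
  have "degree g = 0"
  proof (rule ccontr)
    assume "degree g \<noteq> 0"
    then obtain b where b: "poly g b = 0" using has_root[of g] by auto
    then have "poly f b = 0" unfolding g by simp
    then have "b = z" using only f(1) minpoly_root_iff_conjugate by blast
    with b have "poly (pderiv f) z = 0" unfolding g pderiv_mult by (simp add: pderiv_pCons)
    with f(2) show False ..
  qed
  then obtain c where "g = [:c:]" by (metis degree_eq_zeroE)
  with g is_minpolyD(2)[OF f(1)] have "f = [:- z, 1:]" by (auto split: if_splits)
  then have "- z \<in> M" using is_minpolyD(1)[OF f(1)] by (simp add: coeffs_in_pCons_iff)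
  then show ?thesis using minus_mem by fastforce
qed

lemma minpoly_pderiv_eq_0:
  assumes "is_minpoly M z f" "poly (pderiv f) z = 0"
  shows "pderiv f = 0"
proof (rule ccontr)
  assume nz: "pderiv f \<noteq> 0"
  obtain q where "pderiv f = f * q"
    using is_minpoly_dvd[OF assms(1) coeffs_in_pderiv assms(2)] is_minpolyD(1)[OF assms(1)] by blast
  with nz have "degree f \<le> degree (pderiv f)" by (auto simp: degree_mult_eq)
  with is_minpolyD(5)[OF assms(1)] degree_pderiv_le[of f] show False by linarith
qed

end

lemma pderiv_eq_0_CHAR:
  fixes f :: "'a::field poly"
  assumes "pderiv f = 0" "degree f > 0"
  shows "prime CHAR('a)" "\<not> CHAR('a) dvd i \<Longrightarrow> coeff f i = 0"
proof -
  have *: "of_nat i * coeff f i = 0" for i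
    using arg_cong[OF assms(1), of "\<lambda>p. coeff p (i - 1)"] by (cases i) (auto simp: coeff_pderiv)
  have "of_nat (degree f) = (0 :: 'a)" using *[of "degree f"] assms(2) by auto
  then have "CHAR('a) > 0" using assms(2) CHAR_pos_iff by blast
  then show "prime CHAR('a)" using prime_CHAR_semidom by blast
  show "\<not> CHAR('a) dvd i \<Longrightarrow> coeff f i = 0"
    using *[of i] by (auto simp: of_nat_eq_0_iff_char_dvd)
qed

lemma poly_eq_sum_atMost:
  fixes p :: "'a::field poly"
  assumes "degree p \<le> n" shows "poly p x = (\<Sum>i\<le>n. coeff p i * x ^ i)"
  unfolding poly_altdef using assms by (intro sum.mono_neutral_left) (auto simp: coeff_eq_0)

text \<open>In characteristic \<open>p\<close> a polynomial with zero derivative is a polynomial in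
  \<open>X^p\<close>; \<open>h\<close> collects its coefficients and has strictly smaller
  degree.\<close>

lemma pderiv_eq_0_poly_power:
  fixes f :: "'a::field poly"
  assumes "pderiv f = 0" "degree f > 0"
  obtains h where "\<And>i. coeff h i = coeff f (i * CHAR('a))" "degree h < degree f" "h \<noteq> 0"
    "\<And>x. poly h (x ^ CHAR('a)) = poly f x"
proof -
  define p where "p = CHAR('a)"
  note f = pderiv_eq_0_CHAR[OF assms, folded p_def]
  have p: "p \<ge> 2" using f(1) prime_ge_2_nat by blast
  define n where "n = degree f"
  \<comment> \<open>As the characteristic is at least 2, the coefficients beyond half the degree of
    \<open>f\<close> vanish; this bounds the degree of \<open>h\<close> and permits the generous
    list length \<open>Suc n\<close> below.\<close>
  have big: "coeff f (i * p) = 0" if "i * 2 > n" for i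
    using that p unfolding n_def
    by (intro coeff_eq_0) (metis less_le_trans mult_le_mono2)
  define h where "h = Poly (map (\<lambda>i. coeff f (i * p)) [0..<Suc n])"
  have h: "coeff h i = coeff f (i * p)" for i
    using big[of i] by (auto simp: h_def nth_default_def simp del: upt_Suc)
  have "coeff f n \<noteq> 0" using assms(2) unfolding n_def by auto
  then have "p dvd n" using f(2)[of n] by blast
  then obtain k where "n = k * p" by (metis dvdE mult.commute)
  with \<open>coeff f n \<noteq> 0\<close> have "coeff h k \<noteq> 0" by (simp add: h)
  then have "h \<noteq> 0" by auto
  have deg: "degree h * 2 \<le> n"
    using big[of "degree h"] \<open>h \<noteq> 0\<close> h[of "degree h"] by (metis leading_coeff_0_iff not_less)
  have "poly h (x ^ p) = poly f x" for x
  proof -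
    have "poly f x = (\<Sum>i\<le>n * p. coeff f i * x ^ i)"
      using p by (intro poly_eq_sum_atMost) (simp add: n_def)
    also have "\<dots> = (\<Sum>i\<in>(\<lambda>j. j * p) ` {..n}. coeff f i * x ^ i)"
    proof (rule sum.mono_neutral_right)
      show "\<forall>i\<in>{..n * p} - (\<lambda>j. j * p) ` {..n}. coeff f i * x ^ i = 0"
      proof
        fix i assume i: "i \<in> {..n * p} - (\<lambda>j. j * p) ` {..n}"
        have "\<not> p dvd i"
        proof
          assume "p dvd i"
          then obtain j where "i = j * p" by (metis dvdE mult.commute)
          with i p show False by auto
        qed
        then show "coeff f i * x ^ i = 0" using f(2) by simp
      qed
    qed auto
    also have "\<dots> = (\<Sum>j\<le>n. coeff f (j * p) * x ^ (j * p))"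
      using p by (subst sum.reindex) (auto simp: inj_on_def)
    also have "\<dots> = poly h (x ^ p)"
      using deg by (subst poly_eq_sum_atMost[of _ n]) (auto simp: h mult.commute simp flip: power_mult)
    finally show ?thesis ..
  qed
  then show thesis
    using that[of h] h \<open>h \<noteq> 0\<close> deg assms(2) unfolding p_def n_def by auto
qed

text \<open>If the minimal polynomial of \<open>x\<close> is a polynomial in \<open>X^p\<close>,
  then \<open>x^p\<close> has smaller degree, so taking p-th powers ends at a separable element.
  Comparisons of values survive this, since an ordered group has no torsion.\<close>

lemma (in closed_extension) separable_power:
  "\<exists>q>0. \<exists>f. is_minpoly M (x ^ q) f \<and> poly (pderiv f) (x ^ q) \<noteq> 0"
proof -
  obtain f where "is_minpoly M x f" using minpoly_exists by blast
  then show ?thesis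
  proof (induction "degree f" arbitrary: f x rule: less_induct)
    case less
    note f = less.prems
    show ?case
    proof (cases "poly (pderiv f) x = 0")
      case False
      with f show ?thesis by (intro exI[of _ 1]) auto
    next
      case True
      then have "pderiv f = 0" by (rule minpoly_pderiv_eq_0[OF f])
      then obtain h where h: "\<And>i. coeff h i = coeff f (i * CHAR('a))" "degree h < degree f" "h \<noteq> 0"
        "\<And>x. poly h (x ^ CHAR('a)) = poly f x" and p: "CHAR('a) > 0"
        using pderiv_eq_0_poly_power[of f] pderiv_eq_0_CHAR(1)[of f] is_minpolyD(5)[OF f] prime_gt_0_nat
        by metis
      have "coeffs_in M h" using is_minpolyD(1)[OF f] h(1) by (auto simp: coeffs_in_def)
      moreover have "poly h (x ^ CHAR('a)) = 0" using h(4) is_minpolyD(3)[OF f] by simp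
      moreover obtain g where g: "is_minpoly M (x ^ CHAR('a)) g" using minpoly_exists by blast
      ultimately obtain s where "h = g * s" using is_minpoly_dvd by blast
      with h(3) have "degree g \<le> degree h" by (auto simp: degree_mult_eq)
      with h(2) less.hyps[of g "x ^ CHAR('a)"] g obtain q f' where
        "q > 0" "is_minpoly M ((x ^ CHAR('a)) ^ q) f'" "poly (pderiv f') ((x ^ CHAR('a)) ^ q) \<noteq> 0"
        by auto
      then show ?thesis using p by (intro exI[of _ "CHAR('a) * q"]) (auto simp: power_mult)
    qed
  qed
qed

section \<open>Values of conjugates and uniqueness of the extension\<close>

context valued_closure
begin

text \<open>Composing \<open>\<mu>\<close> with an embedding over \<open>M\<close> gives a second
  extension from \<open>M\<close>, which must be \<open>\<mu>\<close> again.\<close>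

lemma conjugate_val_if_unique_extension:
  assumes uniq: "unique_extension_from \<mu> M" and "conjugate M x y" "x \<noteq> 0"
  shows "\<mu> x = \<mu> y"
proof -
  obtain \<sigma> where \<sigma>: "field_embedding \<sigma> M" "\<sigma> x = y"
    using conjugate_field_embedding[OF assms(2)] .
  interpret field_embedding \<sigma> M by fact
  have "valuation_on UNIV (\<lambda>x. \<mu> (\<sigma> x))"
    unfolding valuation_on_def
  proof (intro conjI ballI impI)
    fix a b assume "a \<in> UNIV - {0::'a}" "b \<in> UNIV - {0::'a}"
    then show "\<mu> (\<sigma> (a * b)) = \<mu> (\<sigma> a) + \<mu> (\<sigma> b)"
      by (auto simp: hom_mult val_mult hom_eq_0_iff)
    assume "a + b \<noteq> 0"
    then show "min (\<mu> (\<sigma> a)) (\<mu> (\<sigma> b)) \<le> \<mu> (\<sigma> (a + b))"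
      using val_add[of "\<sigma> a" "\<sigma> b"] \<open>a \<in> _\<close> \<open>b \<in> _\<close> by (simp add: hom_eq_0_iff flip: hom_add)
  qed
  moreover have "extends_on M (\<lambda>x. \<mu> (\<sigma> x)) \<mu>"
    by (auto simp: extends_on_def fixes_M)
  ultimately have "extends_on UNIV (\<lambda>x. \<mu> (\<sigma> x)) \<mu>"
    using uniq by (auto simp: unique_extension_from_def)
  then show ?thesis using assms(3) \<sigma>(2) by (auto simp: extends_on_def)
qed

lemma isolated_closed_if_unique_extension:
  assumes "unique_extension_from \<mu> M" shows "isolated_closed M"
  unfolding isolated_closed_def
proof (intro allI impI)
  fix p z assume p: "coeffs_in M p" and z: "isolated_root p z"
  obtain f where f: "is_minpoly M z f" using minpoly_exists by blast
  obtain q where q: "p = f * q" using is_minpoly_dvd[OF f p] z by (auto simp: isolated_root_def)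
  have "poly (pderiv f) z \<noteq> 0"
    using z is_minpolyD(3)[OF f] unfolding q isolated_root_def pderiv_mult by auto
  moreover have "b = z" if "conjugate M z b" for b
    using that z conjugate_val_if_unique_extension[OF assms that] conjugate_nonzero[OF that] p
    unfolding isolated_root_def conjugate_def by metis
  ultimately show "z \<in> M" by (rule mem_if_only_conjugate[OF f])
qed

text \<open>The product \<open>P\<close> of the conjugates of minimal value has a power that is separable over \<open>M\<close>
  and an isolated root of its minimal polynomial, hence lies in \<open>M\<close>. An embedding that maps one of
  these conjugates to one of larger value would change the value of \<open>P\<close>.\<close>

lemma conjugate_val_if_isolated_closed:
  assumes closed: "isolated_closed M" and ab: "conjugate M a b" and a: "a \<noteq> 0"
  shows "\<mu> a = \<mu> b"
proof -
  define R where "R = {r. conjugate M a r}"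
  define \<gamma> where "\<gamma> = Min (\<mu> ` R)"
  define S where "S = {r \<in> R. \<mu> r = \<gamma>}"
  define P where "P = \<Prod>S"
  have R: "finite R" "a \<in> R" "b \<in> R" and R0: "\<And>r. r \<in> R \<Longrightarrow> r \<noteq> 0"
    using finite_conjugates conjugate_refl ab conjugate_nonzero a by (auto simp: R_def)
  have min: "\<gamma> \<le> \<mu> r" if "r \<in> R" for r using R that by (auto simp: \<gamma>_def)
  have "\<gamma> \<in> \<mu> ` R" unfolding \<gamma>_def using R by (intro Min_in) auto
  then obtain s where s: "s \<in> S" by (auto simp: S_def)
  have S: "finite S" "S \<subseteq> R" using R by (auto simp: S_def)
  have P0: "P \<noteq> 0" using S R0 by (auto simp: P_def)
  \<comment> \<open>An embedding maps conjugates of \<open>a\<close> injectively to conjugates of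
    \<open>a\<close>. So the image of \<open>S\<close> has the size of \<open>S\<close> and members
    of value at least \<gamma>, and the product keeps its value only if all of them lie in
    \<open>S\<close>.\<close>
  have image: "\<sigma> P = \<Prod>(\<sigma> ` S) \<and> (\<mu> (\<sigma> P) = \<mu> P \<longrightarrow> \<sigma> ` S = S)" if "field_embedding \<sigma> M" for \<sigma>
  proof -
    interpret field_embedding \<sigma> M by fact
    have inj: "inj_on \<sigma> S" using inj_hom by (rule inj_on_subset) simp
    have sub: "\<sigma> ` S \<subseteq> R"
      using S hom_conjugate conjugate_trans unfolding R_def by blast
    have 1: "\<sigma> P = \<Prod>(\<sigma> ` S)" using inj by (simp add: P_def hom_prod prod.reindex)
    have "\<sigma> ` S = S" if "\<mu> (\<sigma> P) = \<mu> P"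
    proof (rule ccontr)
      assume "\<sigma> ` S \<noteq> S"
      then have "\<not> \<sigma> ` S \<subseteq> S" using inj S(1) by (metis card_image card_subset_eq)
      then obtain t where t: "t \<in> \<sigma> ` S" "t \<notin> S" by blast
      have "\<mu> P = (\<Sum>r\<in>S. \<gamma>)"
        using S R0 unfolding P_def by (subst val_prod) (auto simp: S_def)
      also have "\<dots> = (\<Sum>r\<in>\<sigma> ` S. \<gamma>)" using inj by (simp add: sum.reindex)
      also have "\<dots> < (\<Sum>r\<in>\<sigma> ` S. \<mu> r)"
      proof (rule sum_strict_mono_ex1)
        show "\<exists>r\<in>\<sigma> ` S. \<gamma> < \<mu> r"
          using t sub min by (intro bexI[of _ t]) (auto simp: S_def less_le)
      qed (use S sub min in auto)
      also have "\<dots> = \<mu> (\<sigma> P)"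
        unfolding 1 using sub R0 by (subst val_prod) auto
      finally show False using that by simp
    qed
    with 1 show ?thesis by blast
  qed
  obtain q f where q: "q > 0" and f: "is_minpoly M (P ^ q) f" "poly (pderiv f) (P ^ q) \<noteq> 0"
    using separable_power by blast
  have power_val: "\<mu> u = \<mu> P" if "\<mu> (u ^ q) = \<mu> (P ^ q)" "u \<noteq> 0" for u
  proof -
    have "\<mu> ((u / P) ^ q) = 0" using that P0 by (simp add: power_divide val_divide)
    then show ?thesis using that P0 q val_power_eq_0_iff[of "u / P" q] by (simp add: val_divide)
  qed
  have "y = P ^ q" if y: "poly f y = 0" "\<mu> y = \<mu> (P ^ q)" for y
  proof -
    have "conjugate M (P ^ q) y" using y f minpoly_root_iff_conjugate by blast
    then obtain \<sigma> where \<sigma>: "field_embedding \<sigma> M" "\<sigma> (P ^ q) = y" by (rule conjugate_field_embedding)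
    interpret field_embedding \<sigma> M by fact
    have "\<mu> (\<sigma> P) = \<mu> P" using y(2) \<sigma>(2) P0 by (intro power_val) (auto simp: hom_power hom_eq_0_iff)
    then have "\<sigma> P = P" using image[OF \<sigma>(1)] P_def by simp
    then show ?thesis using \<sigma>(2) by (simp add: hom_power)
  qed
  then have "isolated_root f (P ^ q)"
    unfolding isolated_root_def using f is_minpolyD(3)[OF f(1)] P0 by auto
  then have PM: "P ^ q \<in> M" using closed is_minpolyD(1)[OF f(1)] by (auto simp: isolated_closed_def)
  \<comment> \<open>An embedding that takes \<open>s\<close> to \<open>r\<close> fixes
    \<open>P ^ q\<close>, hence keeps the value of \<open>P\<close> and preserves \<open>S\<close>;
    thus every conjugate has the minimal value.\<close>
  have "r \<in> S" if r: "r \<in> R" for r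
  proof -
    have "conjugate M s r"
      using r s conjugate_sym conjugate_trans unfolding S_def R_def by blast
    then obtain \<sigma> where \<sigma>: "field_embedding \<sigma> M" "\<sigma> s = r" by (rule conjugate_field_embedding)
    interpret field_embedding \<sigma> M by fact
    have "\<mu> (\<sigma> P) = \<mu> P"
      using fixes_M[OF PM] P0 by (intro power_val) (auto simp: hom_power hom_eq_0_iff)
    then have "\<sigma> ` S = S" using image[OF \<sigma>(1)] by blast
    then show ?thesis using \<sigma>(2) s by blast
  qed
  with R(2,3) show ?thesis by (auto simp: S_def)
qed

lemma roots_integral:
  assumes "lead_coeff f = 1" "\<And>r. poly f r = 0 \<Longrightarrow> r \<in> vring"
  shows "coeffs_in vring f"
  using assms
proof (induction "degree f" arbitrary: f)
  case 0
  then obtain c where "f = [:c:]" by (metis degree_eq_zeroE)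
  with 0 show ?case by (auto simp: coeffs_in_pCons_iff vring.coeffs_in_closed)
next
  case (Suc n)
  obtain s where s: "poly f s = 0" using has_root[of f] Suc(2) by auto
  then obtain g where g: "f = [:-s, 1:] * g" by (metis dvdE poly_eq_0_iff_dvd)
  have lead: "lead_coeff g = 1" using Suc.prems(1) unfolding g by (simp only: lead_coeff_mult) simp
  have "degree f = Suc (degree g)" unfolding g using lead by (subst degree_mult_eq) auto
  then have "coeffs_in vring g"
    using Suc(2) Suc.prems(2) by (intro Suc(1) lead) (auto simp: g)
  moreover have "coeffs_in vring [:-s, 1:]"
    using Suc.prems(2)[OF s] by (auto simp: coeffs_in_pCons_iff intro: vring.minus_mem vring.coeffs_in_closed)
  ultimately show ?case unfolding g by (intro vring.coeffs_in_closed(5))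
qed

text \<open>The constant coefficient is up to sign the product of the roots, all of value \<gamma>.
  The sum stands for the multiple of \<gamma> by the degree.\<close>

lemma val_coeff_0:
  assumes "lead_coeff f = 1" "\<And>r. poly f r = 0 \<Longrightarrow> r \<noteq> 0 \<and> \<mu> r = \<gamma>"
  shows "coeff f 0 \<noteq> 0 \<and> \<mu> (coeff f 0) = (\<Sum>i<degree f. \<gamma>)"
  using assms
proof (induction "degree f" arbitrary: f)
  case 0
  then obtain c where "f = [:c:]" by (metis degree_eq_zeroE)
  with 0 show ?case by auto
next
  case (Suc n)
  obtain s where s: "poly f s = 0" using has_root[of f] Suc(2) by auto
  then obtain g where g: "f = [:-s, 1:] * g" by (metis dvdE poly_eq_0_iff_dvd)
  have lead: "lead_coeff g = 1" using Suc.prems(1) unfolding g by (simp only: lead_coeff_mult) simp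
  have deg: "degree f = Suc (degree g)" unfolding g using lead by (subst degree_mult_eq) auto
  have IH: "coeff g 0 \<noteq> 0 \<and> \<mu> (coeff g 0) = (\<Sum>i<degree g. \<gamma>)"
    using Suc(2) Suc.prems(2) deg by (intro Suc(1) lead) (auto simp: g)
  have "coeff f 0 = - s * coeff g 0" unfolding g by simp
  then show ?case using IH Suc.prems(2)[OF s] unfolding deg by (simp add: val_mult add.commute)
qed

end

lemma (in valued_field) val_power: "x \<noteq> 0 \<Longrightarrow> \<mu> (x ^ n) = (\<Sum>i<n. \<mu> x)"
  by (induction n) (auto simp: val_mult add.commute)

text \<open>Valuation rings are integrally closed: if \<open>x\<close> had negative value, dividing
  the equation by the leading power of \<open>x\<close> would put 1 into the maximal ideal.\<close>

lemma (in valued_field) integral_root: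
  assumes "coeffs_in vring f" "lead_coeff f = 1" "poly f x = 0"
  shows "x \<in> vring"
proof (rule ccontr)
  assume "x \<notin> vring"
  then have x: "x \<noteq> 0" "inverse x \<in> vmax"
    by (auto simp: vring_iff vmax_iff val_inverse)
  have "degree f > 0"
  proof (rule ccontr)
    assume "\<not> degree f > 0"
    then obtain c where "f = [:c:]" by (metis degree_eq_zeroE gr0I)
    with assms show False by auto
  qed
  then obtain n where n: "degree f = Suc n" using gr0_implies_Suc by blast
  have "0 = inverse x ^ Suc n * poly f x" using assms by simp
  also have "\<dots> = (\<Sum>i\<le>Suc n. coeff f i * inverse x ^ (Suc n - i))"
    unfolding poly_altdef n sum_distrib_left
    by (intro sum.cong refl) (use x(1) in \<open>auto simp: power_diff field_simps power_inverse\<close>)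
  also have "\<dots> = (\<Sum>i\<le>n. coeff f i * inverse x ^ (Suc n - i)) + 1"
    using assms(2) n by simp
  finally have "1 = - (\<Sum>i\<le>n. coeff f i * inverse x ^ (Suc n - i))"
    by (simp add: eq_neg_iff_add_eq_0 add.commute)
  moreover have "(\<Sum>i\<le>n. coeff f i * inverse x ^ (Suc n - i)) \<in> vmax"
  proof (rule vmax_sum)
    fix i assume "i \<in> {..n}"
    then have "inverse x ^ (Suc n - i) = inverse x * inverse x ^ (n - i)" by (simp add: Suc_diff_le)
    moreover have "inverse x ^ (n - i) \<in> vring"
      using x vmax_subset by (intro vring.power_mem) auto
    ultimately have "inverse x ^ (Suc n - i) \<in> vmax" using x(2) vmax_closed(5) by simp
    then show "coeff f i * inverse x ^ (Suc n - i) \<in> vmax"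
      using assms(1) by (intro vmax_closed(4)) (auto simp: coeffs_in_def)
  qed
  ultimately have "1 \<in> vmax" using vmax_closed(3) by metis
  then show False by (simp add: vmax_iff)
qed

text \<open>Conjugates have equal values, so an element of the valuation ring of
  \<open>\<mu>\<close> has an integral minimal polynomial over \<open>M\<close>, where
  \<open>w\<close> and \<open>\<mu>\<close> agree; hence \<open>w\<close> is nonnegative on it. For
  \<open>x\<close> of degree \<open>n\<close> over \<open>M\<close>, with \<open>c\<close> the
  constant coefficient of its minimal polynomial, \<open>x^n / c\<close> is then a unit for both
  valuations, so the values of \<open>x\<close> agree after multiplication by
  \<open>n\<close>.\<close>

lemma (in valued_closure) unique_extension_if_isolated_closed:
  assumes "isolated_closed M" shows "unique_extension_from \<mu> M"
  unfolding unique_extension_from_def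
proof (intro allI impI)
  fix w :: "'a \<Rightarrow> 'g" assume w: "valuation_on UNIV w \<and> extends_on M w \<mu>"
  then interpret w: valued_field w by unfold_locales blast
  have wM: "w c = \<mu> c" if "c \<in> M" "c \<noteq> 0" for c using w that by (auto simp: extends_on_def)
  have integral: "0 \<le> w u" if u: "u \<noteq> 0" "0 \<le> \<mu> u" for u
  proof -
    obtain f where f: "is_minpoly M u f" using minpoly_exists by blast
    have "coeffs_in vring f"
    proof (rule roots_integral[OF is_minpolyD(2)[OF f]])
      fix r assume "poly f r = 0"
      then have "conjugate M u r" using f minpoly_root_iff_conjugate by blast
      then show "r \<in> vring"
        using conjugate_val_if_isolated_closed[OF assms _ u(1)] u(2) by (auto simp: vring_iff)
    qed
    then have "coeffs_in w.vring f"
      using is_minpolyD(1)[OF f] wM unfolding coeffs_in_def vring_iff w.vring_iff by metis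
    then show ?thesis using w.integral_root is_minpolyD(2,3)[OF f] u(1) by (auto simp: w.vring_iff)
  qed
  have unit: "w u = 0" if "u \<noteq> 0" "\<mu> u = 0" for u
    using integral[of u] integral[of "inverse u"] that by (simp add: val_inverse w.val_inverse)
  show "extends_on UNIV w \<mu>"
    unfolding extends_on_def
  proof
    fix x assume "x \<in> UNIV - {0::'a}"
    then have x: "x \<noteq> 0" by simp
    obtain f where f: "is_minpoly M x f" using minpoly_exists by blast
    define c where "c = coeff f 0"
    define n where "n = degree f"
    have c: "c \<noteq> 0" "\<mu> c = (\<Sum>i<n. \<mu> x)"
      using val_coeff_0[OF is_minpolyD(2)[OF f], of "\<mu> x"] conjugate_nonzero[OF _ x]
        conjugate_val_if_isolated_closed[OF assms _ x] minpoly_root_iff_conjugate[OF f]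
      unfolding c_def n_def by metis+
    have "c \<in> M" using is_minpolyD(1)[OF f] by (simp add: c_def coeffs_in_def)
    then have "w c = \<mu> c" using wM c by blast
    moreover have "w (x ^ n / c) = 0" using x c by (intro unit) (auto simp: val_divide val_power)
    ultimately have eq: "(\<Sum>i<n. w x) = (\<Sum>i<n. \<mu> x)"
      using x c by (simp add: w.val_divide w.val_power)
    have n: "n > 0" using is_minpolyD(5)[OF f] by (simp add: n_def)
    show "w x = \<mu> x"
    proof (rule linorder_cases[of "w x" "\<mu> x"])
      assume "w x < \<mu> x"
      then have "(\<Sum>i<n. w x) < (\<Sum>i<n. \<mu> x)" using n by (intro sum_strict_mono) auto
      with eq show ?thesis by simp
    next
      assume "w x > \<mu> x"
      then have "(\<Sum>i<n. w x) > (\<Sum>i<n. \<mu> x)" using n by (intro sum_strict_mono) auto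
      with eq show ?thesis by simp
    qed
  qed
qed

section \<open>Adjoining an isolated root is immediate\<close>

context closed_extension
begin

lemma power_CHAR_mem_adjoin:
  assumes p: "prime CHAR('a)" and r: "coeffs_in M r"
  shows "poly r y ^ CHAR('a) \<in> adjoin (y ^ CHAR('a))"
  using r
proof (induction r)
  case 0
  interpret A: closed_extension "adjoin (y ^ CHAR('a))" by (rule closed_extension_adjoin)
  show ?case using p by (auto simp: power_0_left)
next
  case (pCons a r)
  interpret A: closed_extension "adjoin (y ^ CHAR('a))" by (rule closed_extension_adjoin)
  have "a \<in> M" "coeffs_in M r" using pCons.prems by (auto simp: coeffs_in_pCons_iff)
  then have "a ^ CHAR('a) \<in> adjoin (y ^ CHAR('a))" "poly r y ^ CHAR('a) \<in> adjoin (y ^ CHAR('a))"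
    using pCons.IH subset_adjoin power_mem by blast+
  moreover have "y ^ CHAR('a) \<in> adjoin (y ^ CHAR('a))" by (rule mem_adjoin)
  ultimately show ?case
    using p by (simp add: freshmans_dream power_mult_distrib A.add_mem A.mult_mem)
qed

text \<open>If \<open>z\<close> is separable over \<open>M\<close> and no other conjugate of \<open>z\<close> yields the value \<open>y = g(z)\<close>,
  then \<open>M(y) = M(z)\<close>. In characteristic p, \<open>z\<close> lies in \<open>M(z ^ p)\<close> and so \<open>y\<close> in \<open>M(y ^ p)\<close>,
  which gives a polynomial \<open>X - s(X ^ p)\<close> with root \<open>y\<close> and derivative 1.\<close>

lemma generator_separable:
  assumes f: "is_minpoly M z f" "poly (pderiv f) z \<noteq> 0"
    and g: "coeffs_in M g" "y = poly g z" and only: "\<And>r. conjugate M z r \<Longrightarrow> poly g r = y \<Longrightarrow> r = z"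
    and G: "is_minpoly M y G"
  shows "poly (pderiv G) y \<noteq> 0"
proof
  assume "poly (pderiv G) y = 0"
  then have "pderiv G = 0" by (rule minpoly_pderiv_eq_0[OF G])
  then have p: "prime CHAR('a)" using pderiv_eq_0_CHAR(1) is_minpolyD(5)[OF G] by blast
  define p where "p = CHAR('a)"
  \<comment> \<open>A polynomial over \<open>M(u)\<close> whose only zero among the conjugates of
    \<open>z\<close> is \<open>z\<close> leaves no other conjugate over \<open>M(u)\<close>; as
    \<open>z\<close> is separable, it lies in \<open>M(u)\<close>.\<close>
  have sep: "z \<in> adjoin u"
    if h: "coeffs_in (adjoin u) h" "poly h z = 0"
      and h_only: "\<And>b. conjugate M z b \<Longrightarrow> poly h b = 0 \<Longrightarrow> b = z" for u h
  proof -
    interpret A: closed_extension "adjoin u" by (rule closed_extension_adjoin)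
    obtain \<phi> where \<phi>: "is_minpoly (adjoin u) z \<phi>" using A.minpoly_exists by blast
    have fA: "coeffs_in (adjoin u) f" using is_minpolyD(1)[OF f(1)] coeffs_in_mono subset_adjoin by blast
    then obtain q where q: "f = \<phi> * q" using is_minpoly_dvd[OF \<phi>] is_minpolyD(3)[OF f(1)] by blast
    have "poly (pderiv \<phi>) z \<noteq> 0"
      using f(2) is_minpolyD(3)[OF \<phi>] unfolding q pderiv_mult by auto
    moreover have "b = z" if b: "conjugate (adjoin u) z b" for b
    proof (rule h_only)
      show "conjugate M z b" "poly h b = 0"
        using b h coeffs_in_mono subset_adjoin unfolding conjugate_def by blast+
    qed
    ultimately show ?thesis by (rule A.mem_if_only_conjugate[OF \<phi>])
  qed
  have "z \<in> adjoin y"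
  proof (rule sep)
    interpret A: closed_extension "adjoin y" by (rule closed_extension_adjoin)
    have "coeffs_in (adjoin y) g" using g(1) coeffs_in_mono subset_adjoin by blast
    then show "coeffs_in (adjoin y) (g - [:y:])"
      by (intro A.coeffs_in_closed mem_adjoin)
  qed (use g(2) only in auto)
  then obtain r where r: "coeffs_in M r" "z = poly r y" by (auto simp: adjoin_def)
  \<comment> \<open>\<open>X^p - z^p\<close> is the p-th power of \<open>X - z\<close>, so
    \<open>z\<close> is its only root.\<close>
  have "z \<in> adjoin (z ^ p)"
  proof (rule sep)
    interpret A: closed_extension "adjoin (z ^ p)" by (rule closed_extension_adjoin)
    show "coeffs_in (adjoin (z ^ p)) (monom 1 p - [:z ^ p:])"
      by (intro A.coeffs_in_closed mem_adjoin) auto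
    show "poly (monom 1 p - [:z ^ p:]) z = 0" by (simp add: poly_monom)
    fix b assume "poly (monom 1 p - [:z ^ p:]) b = 0"
    then have "b ^ p = z ^ p" by (simp add: poly_monom)
    moreover have "(b - z + z) ^ p = (b - z) ^ p + z ^ p"
      using freshmans_dream[OF p p_def] .
    ultimately have "(b - z) ^ p = 0" by simp
    then show "b = z" by simp
  qed
  moreover have "adjoin (z ^ p) \<subseteq> adjoin (y ^ p)"
    using power_CHAR_mem_adjoin[OF p r(1), of y] closed_extension.subfield_M[OF closed_extension_adjoin]
    unfolding r(2)[symmetric] p_def
    by (intro adjoin_subset subset_adjoin subfield_subring_set)
  ultimately have "z \<in> adjoin (y ^ p)" by blast
  then have "y \<in> adjoin (y ^ p)"
    unfolding g(2) using g(1) subset_adjoin closed_extension.subfield_M[OF closed_extension_adjoin]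
    by (intro subring_set.poly_mem subfield_subring_set coeffs_in_mono[OF g(1)]) auto
  then obtain s where s: "coeffs_in M s" "y = poly s (y ^ p)" by (auto simp: adjoin_def)
  \<comment> \<open>A vanishing derivative of \<open>G\<close> would make \<open>y\<close> a
    multiple root of \<open>P\<close>, but \<open>s(X^p)\<close> contributes nothing to the
    derivative of \<open>P\<close>, which is 1.\<close>
  define P where "P = [:0, 1:] - pcompose s (monom 1 p)"
  have "coeffs_in M P"
    unfolding P_def by (intro coeffs_in_closed coeffs_in_pcompose s zero_mem one_mem)
  moreover have "poly P y = 0" using s(2) by (simp add: P_def poly_pcompose poly_monom)
  ultimately obtain q where q: "P = G * q" using is_minpoly_dvd[OF G] by blast
  have "pderiv P = 1"
    by (simp add: P_def pderiv_diff pderiv_pcompose pderiv_monom pderiv_pCons p_def)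
  moreover have "poly (pderiv P) y = 0"
    using is_minpolyD(3)[OF G] \<open>pderiv G = 0\<close> unfolding q pderiv_mult by simp
  ultimately show False by simp
qed

end

context valued_closure
begin

text \<open>An element \<open>x = g(z)\<close> may share its value with conjugates, but multiplying
  by a suitable power of \<open>z\<close> separates it from them: for each other conjugate
  \<open>r\<close> of \<open>z\<close> the values of \<open>g(r) * r^k\<close> and
  \<open>x * z^k\<close> agree for at most one \<open>k\<close>, as \<open>r\<close> and
  \<open>z\<close> have different values. The product is then an isolated root of its minimal
  polynomial, hence near an element of \<open>M\<close>, and so is the power of \<open>z\<close>
  that is divided out.\<close>

lemma adjoin_isolated_near:
  assumes p: "coeffs_in M p" and iso: "isolated_root p z" and x: "x \<in> adjoin z" "x \<noteq> 0"
  shows "\<exists>d\<in>M. near x d"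
proof -
  have z: "z \<noteq> 0" "poly p z = 0" "poly (pderiv p) z \<noteq> 0"
    and val: "\<And>y. poly p y = 0 \<Longrightarrow> y \<noteq> 0 \<Longrightarrow> y \<noteq> z \<Longrightarrow> \<mu> y \<noteq> \<mu> z"
    using iso by (auto simp: isolated_root_def)
  obtain f where f: "is_minpoly M z f" using minpoly_exists by blast
  obtain q where q: "p = f * q" using is_minpoly_dvd[OF f p z(2)] by blast
  have sep: "poly (pderiv f) z \<noteq> 0"
    using z(3) is_minpolyD(3)[OF f] unfolding q pderiv_mult by auto
  obtain g where g: "coeffs_in M g" "x = poly g z" using x(1) by (auto simp: adjoin_def)
  define R where "R = {r. conjugate M z r} - {z}"
  have R: "finite R" unfolding R_def using finite_conjugates by blast
  have Rval: "r \<noteq> 0" "\<mu> r \<noteq> \<mu> z" "poly g r \<noteq> 0" if "r \<in> R" for r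
  proof -
    have r: "conjugate M z r" "r \<noteq> z" using that by (auto simp: R_def)
    show "r \<noteq> 0" using conjugate_nonzero[OF r(1) z(1)] .
    then show "\<mu> r \<noteq> \<mu> z" using r val p z(2) by (auto simp: conjugate_def)
    obtain \<sigma> where \<sigma>: "field_embedding \<sigma> M" "\<sigma> z = r" using conjugate_field_embedding[OF r(1)] .
    then have "\<sigma> x = poly g r" using field_embedding.hom_poly[OF \<sigma>(1) g(1)] g(2) by simp
    then show "poly g r \<noteq> 0" using field_embedding.hom_eq_0_iff[OF \<sigma>(1)] x(2) by metis
  qed
  have "finite {k. \<mu> (poly g r * r ^ k) = \<mu> (x * z ^ k)}" if r: "r \<in> R" for r
  proof -
    have one: "k = l" if kl: "\<mu> (poly g r * r ^ k) = \<mu> (x * z ^ k)" "\<mu> (poly g r * r ^ l) = \<mu> (x * z ^ l)"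
      "k \<le> l" for k l
    proof (rule ccontr)
      assume "k \<noteq> l"
      with kl(3) have "l = k + (l - k)" "l - k > 0" by auto
      then obtain n where n: "l = k + n" "n > 0" by blast
      have *: "\<mu> (poly g r) + \<mu> (r ^ k) = \<mu> x + \<mu> (z ^ k)"
        using kl(1) Rval[OF r] z(1) x(2) by (simp add: val_mult)
      have "(\<mu> (poly g r) + \<mu> (r ^ k)) + \<mu> (r ^ n) = (\<mu> x + \<mu> (z ^ k)) + \<mu> (z ^ n)"
        using kl(2) Rval[OF r] z(1) x(2) by (simp add: n(1) power_add val_mult add.assoc)
      then have "\<mu> (r ^ n) = \<mu> (z ^ n)" unfolding * by simp
      then have "\<mu> ((r / z) ^ n) = 0" using Rval[OF r] z(1) by (simp add: power_divide val_divide)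
      then have "\<mu> (r / z) = 0" using val_power_eq_0_iff[of "r / z" n] n(2) Rval[OF r] z(1) by simp
      then show False using Rval[OF r] z(1) by (simp add: val_divide)
    qed
    then have inj: "k = l" if "\<mu> (poly g r * r ^ k) = \<mu> (x * z ^ k)" "\<mu> (poly g r * r ^ l) = \<mu> (x * z ^ l)" for k l
      using that nat_le_linear[of k l] by blast
    show ?thesis
    proof (cases "\<exists>k. \<mu> (poly g r * r ^ k) = \<mu> (x * z ^ k)")
      case True
      then obtain l where "\<mu> (poly g r * r ^ l) = \<mu> (x * z ^ l)" by blast
      then have "{k. \<mu> (poly g r * r ^ k) = \<mu> (x * z ^ k)} \<subseteq> {l}" using inj by blast
      then show ?thesis using finite_subset by blast
    qed auto
  qed
  then have "finite (\<Union>r\<in>R. {k. \<mu> (poly g r * r ^ k) = \<mu> (x * z ^ k)})" using R by blast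
  then obtain k where "k \<notin> (\<Union>r\<in>R. {k. \<mu> (poly g r * r ^ k) = \<mu> (x * z ^ k)})"
    using ex_new_if_finite[OF infinite_UNIV_nat] by blast
  then have k: "\<And>r. r \<in> R \<Longrightarrow> \<mu> (poly g r * r ^ k) \<noteq> \<mu> (x * z ^ k)" by blast
  define y where "y = x * z ^ k"
  define g' where "g' = g * monom 1 k"
  have g': "coeffs_in M g'" "poly g' r = poly g r * r ^ k" for r
    unfolding g'_def by (intro coeffs_in_closed g one_mem) (simp add: poly_monom)
  have y: "y = poly g' z" "y \<noteq> 0" using g'(2)[of z] g(2) z(1) x(2) by (simp_all add: y_def)
  obtain G where G: "is_minpoly M y G" using minpoly_exists by blast
  have "poly (pderiv G) y \<noteq> 0"
  proof (rule generator_separable[OF f sep g'(1) y(1) _ G])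
    fix r assume "conjugate M z r" "poly g' r = y"
    then show "r = z" using k[of r] unfolding R_def y_def g'(2) by auto
  qed
  moreover have "y' = y" if y': "poly G y' = 0" "\<mu> y' = \<mu> y" for y'
  proof -
    have "conjugate M y y'" using y'(1) G minpoly_root_iff_conjugate by blast
    then obtain \<sigma> where \<sigma>: "field_embedding \<sigma> M" "\<sigma> y = y'" by (rule conjugate_field_embedding)
    then have eq: "y' = poly g' (\<sigma> z)" using field_embedding.hom_poly[OF \<sigma>(1) g'(1)] y(1) by auto
    have "conjugate M z (\<sigma> z)" using field_embedding.hom_conjugate[OF \<sigma>(1)] .
    moreover have "\<sigma> z \<notin> R" using k[of "\<sigma> z"] y'(2) unfolding eq g'(2) y_def by blast
    ultimately have "\<sigma> z = z" by (auto simp: R_def)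
    then show ?thesis using eq y(1) by simp
  qed
  ultimately have "isolated_root G y"
    unfolding isolated_root_def using y(2) is_minpolyD(3)[OF G] by auto
  then obtain d where d: "d \<in> M" "near y d" using isolated_root_near is_minpolyD(1)[OF G] by blast
  obtain e where e: "e \<in> M" "near z e" using isolated_root_near[OF p iso] by blast
  have "near (y / z ^ k) (d / e ^ k)" by (intro near_divide near_power d e)
  moreover have "y / z ^ k = x" using z(1) by (simp add: y_def)
  moreover have "d / e ^ k \<in> M" using d e by (intro subfield_closed[OF subfield_M])
  ultimately show ?thesis by auto
qed

section \<open>The henselization\<close>

definition isolated_closure :: "'a set"
  where "isolated_closure = \<Inter>{N. subfield N ambient \<and> M \<subseteq> N \<and> isolated_closed N}"

lemma isolated_closure:
  shows subfield_isolated_closure: "subfield isolated_closure ambient"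
    and subset_isolated_closure: "M \<subseteq> isolated_closure"
    and isolated_closed_isolated_closure: "isolated_closed isolated_closure"
    and isolated_closure_least:
      "subfield N ambient \<Longrightarrow> M \<subseteq> N \<Longrightarrow> isolated_closed N \<Longrightarrow> isolated_closure \<subseteq> N"
proof -
  show "subfield isolated_closure ambient"
    unfolding subfield_ambient_iff isolated_closure_def by blast
  show "M \<subseteq> isolated_closure" unfolding isolated_closure_def by auto
  show "isolated_closed isolated_closure"
    unfolding isolated_closed_def
  proof (intro allI impI)
    fix p z assume pz: "coeffs_in isolated_closure p" "isolated_root p z"
    have "z \<in> N" if N: "subfield N ambient" "M \<subseteq> N" "isolated_closed N" for N
    proof -
      have "coeffs_in N p" using pz(1) N unfolding coeffs_in_def isolated_closure_def by blast
      then show ?thesis using N(3) pz(2) unfolding isolated_closed_def by blast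
    qed
    then show "z \<in> isolated_closure" unfolding isolated_closure_def by blast
  qed
  show "subfield N ambient \<Longrightarrow> M \<subseteq> N \<Longrightarrow> isolated_closed N \<Longrightarrow> isolated_closure \<subseteq> N"
    unfolding isolated_closure_def by auto
qed

lemma valued_closure_intermediate:
  "M \<subseteq> N \<Longrightarrow> subfield N ambient \<Longrightarrow> valued_closure N \<mu>"
  by (intro valued_closure.intro intermediate_field valued_field_axioms)

text \<open>One direction of the equivalence between isolated closure and unique extension shows
  that the intersection qualifies, the other that it is minimal. This justifies the
  \<open>LEAST\<close> operator in the definition.\<close>

theorem henselization:
  shows henselization_eq: "henselization \<mu> M = isolated_closure"
    and unique_extension_henselization: "unique_extension_from \<mu> (henselization \<mu> M)"
    and henselization_least: "\<And>N. subfield N ambient \<Longrightarrow> M \<subseteq> N \<Longrightarrow> unique_extension_from \<mu> N \<Longrightarrow>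
      henselization \<mu> M \<subseteq> N"
proof -
  interpret I: valued_closure isolated_closure \<mu>
    using subset_isolated_closure subfield_isolated_closure by (rule valued_closure_intermediate)
  have uniq: "unique_extension_from \<mu> isolated_closure"
    using isolated_closed_isolated_closure by (rule I.unique_extension_if_isolated_closed)
  have least: "isolated_closure \<subseteq> N" if "subfield N ambient" "M \<subseteq> N" "unique_extension_from \<mu> N" for N
    using valued_closure.isolated_closed_if_unique_extension[OF valued_closure_intermediate] that
    by (intro isolated_closure_least) auto
  show "henselization \<mu> M = isolated_closure"
    unfolding henselization_def
    by (rule Least_equality)
      (use uniq least subset_isolated_closure subfield_isolated_closure in auto)
  with uniq least show "unique_extension_from \<mu> (henselization \<mu> M)"
    "\<And>N. subfield N ambient \<Longrightarrow> M \<subseteq> N \<Longrightarrow> unique_extension_from \<mu> N \<Longrightarrow> henselization \<mu> M \<subseteq> N"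
    by auto
qed

lemma subfield_henselization: "subfield (henselization \<mu> M) ambient"
  and subset_henselization: "M \<subseteq> henselization \<mu> M"
  unfolding henselization_eq by (rule subfield_isolated_closure subset_isolated_closure)+

text \<open>A maximal immediate extension \<open>N\<close> of \<open>M\<close> contains all isolated
  roots of polynomials over it, because adjoining one is immediate again; so it contains the
  henselization. \<open>N\<close> itself may be larger, but immediacy passes to intermediate
  fields.\<close>

theorem henselization_near:
  assumes "x \<in> henselization \<mu> M" "x \<noteq> 0"
  shows "\<exists>d\<in>M. near x d"
proof -
  define immediate where "immediate N \<longleftrightarrow> (\<forall>x\<in>N. x \<noteq> 0 \<longrightarrow> (\<exists>d\<in>M. near x d))" for N
  define \<A> where "\<A> = {N. subfield N ambient \<and> M \<subseteq> N \<and> immediate N}"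
  have "M \<in> \<A>" using subfield_M near_refl by (auto simp: \<A>_def immediate_def)
  moreover have "\<Union>\<C> \<in> \<A>" if C: "\<C> \<noteq> {}" "subset.chain \<A> \<C>" for \<C>
  proof -
    have sub: "subfield N ambient" "M \<subseteq> N" "immediate N" if "N \<in> \<C>" for N
      using that C(2) by (auto simp: subset_chain_def \<A>_def)
    have two: "\<exists>N\<in>\<C>. u \<in> N \<and> v \<in> N" if uv: "u \<in> \<Union>\<C>" "v \<in> \<Union>\<C>" for u v
    proof -
      obtain N N' where "N \<in> \<C>" "u \<in> N" "N' \<in> \<C>" "v \<in> N'" using uv by blast
      moreover from this have "N \<subseteq> N' \<or> N' \<subseteq> N" using C(2) by (auto simp: subset_chain_def)
      ultimately show ?thesis by blast
    qed
    have M: "M \<subseteq> \<Union>\<C>" using C(1) sub(2) by blast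
    have "subfield (\<Union>\<C>) ambient"
      unfolding subfield_ambient_iff
    proof (intro conjI ballI)
      show "0 \<in> \<Union>\<C>" "1 \<in> \<Union>\<C>" using M zero_mem one_mem by blast+
    next
      fix x y assume "x \<in> \<Union>\<C>" "y \<in> \<Union>\<C>"
      then obtain N where N: "N \<in> \<C>" "x \<in> N" "y \<in> N" using two by blast
      then have "x + y \<in> N" "x * y \<in> N" using subfield_closed(3,4)[OF sub(1)[OF N(1)]] by blast+
      with N(1) show "x + y \<in> \<Union>\<C>" "x * y \<in> \<Union>\<C>" by blast+
    next
      fix x assume "x \<in> \<Union>\<C>"
      then obtain N where N: "N \<in> \<C>" "x \<in> N" by blast
      then have "- x \<in> N" "inverse x \<in> N" using subfield_closed(5,6)[OF sub(1)[OF N(1)]] by blast+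
      with N(1) show "- x \<in> \<Union>\<C>" "inverse x \<in> \<Union>\<C>" by blast+
    qed
    moreover have "immediate (\<Union>\<C>)" using sub(3) unfolding immediate_def by blast
    ultimately show ?thesis using M by (auto simp: \<A>_def)
  qed
  ultimately obtain N where N: "N \<in> \<A>" and max: "\<And>N'. N' \<in> \<A> \<Longrightarrow> N \<subseteq> N' \<Longrightarrow> N' = N"
    using subset_Zorn_nonempty[of \<A>] by blast
  have NA: "subfield N ambient" "M \<subseteq> N" "immediate N" using N by (auto simp: \<A>_def)
  interpret N: valued_closure N \<mu> by (rule valued_closure_intermediate) fact+
  have "isolated_closed N"
    unfolding isolated_closed_def
  proof (intro allI impI)
    fix p z assume pz: "coeffs_in N p" "isolated_root p z"
    have "immediate (N.adjoin z)"
      unfolding immediate_def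
    proof (intro ballI impI)
      fix x assume "x \<in> N.adjoin z" "x \<noteq> 0"
      then obtain e where e: "e \<in> N" "near x e" using N.adjoin_isolated_near[OF pz] by blast
      then obtain d where "d \<in> M" "near e d" using NA(3) near_val(2) unfolding immediate_def by blast
      with near_trans[OF e(2)] show "\<exists>d\<in>M. near x d" by blast
    qed
    then have "N.adjoin z \<in> \<A>"
      using closed_extension.subfield_M[OF N.closed_extension_adjoin] N.subset_adjoin NA(2)
      by (auto simp: \<A>_def)
    then show "z \<in> N" using max N.subset_adjoin N.mem_adjoin by blast
  qed
  then have "henselization \<mu> M \<subseteq> N"
    unfolding henselization_eq using NA by (intro isolated_closure_least)
  then show ?thesis using assms NA(3) by (auto simp: immediate_def)
qed

end

section \<open>Finitely generated modules\<close>

text \<open>Finite combinations of elements of \<open>T\<close> with coefficients in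
  \<open>S\<close>. Nothing is assumed of \<open>S\<close>, which will be a ring, a field or the
  maximal ideal of a ring.\<close>

inductive_set lspan :: "'a::field set \<Rightarrow> 'a set \<Rightarrow> 'a set" for S T where
  lspan_zero: "0 \<in> lspan S T"
| lspan_step: "s \<in> S \<Longrightarrow> t \<in> T \<Longrightarrow> u \<in> lspan S T \<Longrightarrow> s * t + u \<in> lspan S T"

lemma lspan_base: "s \<in> S \<Longrightarrow> t \<in> T \<Longrightarrow> s * t \<in> lspan S T"
  using lspan_step[OF _ _ lspan_zero] by fastforce

lemma lspan_add: "u \<in> lspan S T \<Longrightarrow> v \<in> lspan S T \<Longrightarrow> u + v \<in> lspan S T"
  by (induction rule: lspan.induct) (auto simp: add.assoc intro: lspan_step)

lemma lspan_sum: "(\<And>i. i \<in> A \<Longrightarrow> f i \<in> lspan S T) \<Longrightarrow> sum f A \<in> lspan S T"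
  by (induction A rule: infinite_finite_induct) (auto intro: lspan_add lspan_zero)

lemma lspan_least:
  assumes "0 \<in> U" "\<And>u v. u \<in> U \<Longrightarrow> v \<in> U \<Longrightarrow> u + v \<in> U" "\<And>s t. s \<in> S \<Longrightarrow> t \<in> T \<Longrightarrow> s * t \<in> U"
  shows "lspan S T \<subseteq> U"
proof
  fix u assume "u \<in> lspan S T"
  then show "u \<in> U" by (induction rule: lspan.induct) (auto intro: assms)
qed

lemma lspan_scale:
  assumes "u \<in> lspan S T" "\<And>s. s \<in> S \<Longrightarrow> a * s \<in> S'" shows "a * u \<in> lspan S' T"
  using assms(1)
proof (induction rule: lspan.induct)
  case (lspan_step s t u)
  have "a * (s * t + u) = (a * s) * t + a * u" by (simp add: algebra_simps)
  with lspan_step show ?case using assms(2) by (auto intro: lspan.lspan_step)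
qed (simp add: lspan_zero)

lemma lspan_mono: "S \<subseteq> S' \<Longrightarrow> T \<subseteq> T' \<Longrightarrow> lspan S T \<subseteq> lspan S' T'"
  by (intro lspan_least) (auto intro: lspan_zero lspan_add lspan_base)

lemma lspan_subset:
  assumes "\<And>s s'. s \<in> S \<Longrightarrow> s' \<in> S' \<Longrightarrow> s * s' \<in> S'" "T \<subseteq> lspan S' T'"
  shows "lspan S T \<subseteq> lspan S' T'"
  using assms by (intro lspan_least) (auto intro: lspan_zero lspan_add lspan_scale)

lemma lspan_mult:
  assumes S: "\<And>s s'. s \<in> S \<Longrightarrow> s' \<in> S \<Longrightarrow> s * s' \<in> S"
    and T: "\<And>t t'. t \<in> T \<Longrightarrow> t' \<in> T' \<Longrightarrow> t * t' \<in> lspan S T''"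
    and uv: "u \<in> lspan S T" "v \<in> lspan S T'"
  shows "u * v \<in> lspan S T''"
proof -
  have 1: "t * v \<in> lspan S T''" if t: "t \<in> T" for t
    using uv(2)
  proof (induction rule: lspan.induct)
    case (lspan_step s t' u)
    have "s * (t * t') \<in> lspan S T''" using lspan_step t by (intro lspan_scale[OF T] S)
    then have "s * (t * t') + t * u \<in> lspan S T''" using lspan_step lspan_add by blast
    then show ?case by (simp add: algebra_simps)
  qed (simp add: lspan_zero)
  show ?thesis using uv(1)
  proof (induction rule: lspan.induct)
    case (lspan_step s t u)
    have "s * (t * v) \<in> lspan S T''" using lspan_step by (intro lspan_scale[OF 1] S)
    then have "s * (t * v) + u * v \<in> lspan S T''" using lspan_step lspan_add by blast
    then show ?case by (simp add: algebra_simps)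
  qed (simp add: lspan_zero)
qed

lemma lspan_subring_set:
  assumes S: "subring_set S" and T: "1 \<in> T" "\<And>t t'. t \<in> T \<Longrightarrow> t' \<in> T \<Longrightarrow> t * t' \<in> lspan S T"
  shows "subring_set (lspan S T)"
proof
  interpret subring_set S by fact
  show "1 \<in> lspan S T" using lspan_base[OF one_mem T(1)] by simp
  show "- x \<in> lspan S T" if "x \<in> lspan S T" for x
    using lspan_scale[OF that, of "-1" S] minus_mem mult_mem by simp
  show "x + y \<in> lspan S T" if "x \<in> lspan S T" "y \<in> lspan S T" for x y
    using that by (rule lspan_add)
  show "x * y \<in> lspan S T" if "x \<in> lspan S T" "y \<in> lspan S T" for x y
    using lspan_mult[OF mult_mem T(2) that] .
qed

lemma lspan_powers:
  assumes "subring_set A" "coeffs_in A f" "lead_coeff f = 1" "poly f g = 0" "coeffs_in A p"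
  shows "poly p g \<in> lspan A ((\<lambda>i. g ^ i) ` {..<degree f})"
proof -
  obtain q r where qr: "coeffs_in A r" "p = f * q + r" "r = 0 \<or> degree r < degree f"
    using coeffs_in_division[OF assms(1-3,5)] by blast
  have "poly r g \<in> lspan A ((\<lambda>i. g ^ i) ` {..<degree f})"
  proof (cases "r = 0")
    case False
    then show ?thesis using qr unfolding poly_altdef
      by (intro lspan_sum lspan_base) (auto simp: coeffs_in_def)
  qed (simp add: lspan_zero)
  then show ?thesis using assms(4) by (simp add: qr(2))
qed

text \<open>Generators are added one at a time: the module generators are multiplied by the powers
  of the new element below the degree of its equation. They are kept inside \<open>B\<close> because
  later they are decomposed as elements of the valuation ring of \<open>L\<close>.\<close>

lemma finite_integral_extension:
  assumes A: "subring_set A" and "finite G"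
    and int: "\<And>g. g \<in> G \<Longrightarrow> \<exists>f. coeffs_in A f \<and> lead_coeff f = 1 \<and> poly f g = 0"
    and B: "subring_set B" "G \<subseteq> B"
  shows "\<exists>T. finite T \<and> T \<subseteq> B \<and> 1 \<in> T \<and> subring_set (lspan A T) \<and> G \<subseteq> lspan A T"
  using assms(2,3,5)
proof (induction G rule: finite_induct)
  case empty
  interpret A: subring_set A by fact
  have "subring_set (lspan A {1})"
    using lspan_base[of 1 A 1 "{1}"] by (intro lspan_subring_set A) auto
  then show ?case using subring_set.one_mem[OF B(1)] by (intro exI[of _ "{1}"]) auto
next
  case (insert g G)
  interpret A: subring_set A by fact
  interpret B: subring_set B by fact
  obtain T where T: "finite T" "T \<subseteq> B" "1 \<in> T" "subring_set (lspan A T)" "G \<subseteq> lspan A T"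
    using insert by auto
  obtain f where f: "coeffs_in A f" "lead_coeff f = 1" "poly f g = 0" using insert.prems by blast
  have "degree f > 0"
  proof (rule ccontr)
    assume "\<not> degree f > 0"
    then obtain c where "f = [:c:]" by (metis degree_eq_zeroE gr0I)
    with f show False by auto
  qed
  define V where "V = (\<lambda>i. g ^ i) ` {..<degree f}"
  define T' where "T' = (\<lambda>(t, v). t * v) ` (T \<times> V)"
  have V: "1 \<in> V" unfolding V_def using \<open>degree f > 0\<close> by (intro image_eqI[of _ _ 0]) auto
  have span: "t * v \<in> lspan A T'" if "t \<in> T" "v \<in> V" for t v
    using lspan_base[OF A.one_mem, of "t * v" T'] that by (auto simp: T'_def)
  have TT: "t * t' \<in> lspan A T" if "t \<in> T" "t' \<in> T" for t t'
  proof -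
    have "t \<in> lspan A T" "t' \<in> lspan A T" using that lspan_base[OF A.one_mem] by fastforce+
    then show ?thesis using subring_set.mult_mem[OF T(4)] by blast
  qed
  have VV: "v * v' \<in> lspan A V" if "v \<in> V" "v' \<in> V" for v v'
  proof -
    obtain i j where "v = g ^ i" "v' = g ^ j"
      using \<open>v \<in> V\<close> \<open>v' \<in> V\<close> unfolding V_def by blast
    then have "v * v' = poly (monom 1 (i + j)) g" by (simp add: poly_monom power_add)
    then show ?thesis unfolding V_def
      using lspan_powers[OF A f, of "monom 1 (i + j)"] A.coeffs_in_closed(8) by simp
  qed
  have "subring_set (lspan A T')"
  proof (rule lspan_subring_set[OF A])
    show "1 \<in> T'" unfolding T'_def using T(3) V by (intro image_eqI[of _ _ "(1, 1)"]) auto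
    fix s s' assume "s \<in> T'" "s' \<in> T'"
    then obtain t v t' v' where s: "s = t * v" "s' = t' * v'" "t \<in> T" "t' \<in> T" "v \<in> V" "v' \<in> V"
      by (auto simp: T'_def)
    have "(t * t') * (v * v') \<in> lspan A T'"
      using lspan_mult[OF A.mult_mem span TT VV] s by blast
    then show "s * s' \<in> lspan A T'" by (simp add: s mult_ac)
  qed
  moreover have "lspan A T \<subseteq> lspan A T'"
    using span[OF _ V] by (intro lspan_subset A.mult_mem) auto
  moreover have "poly [:0, 1:] g \<in> lspan A V"
    unfolding V_def using A.coeffs_in_closed by (intro lspan_powers[OF A f]) simp
  then have "1 * g \<in> lspan A T'"
    using lspan_mult[OF A.mult_mem span, of "{1}" V 1 g] T(3) lspan_base[of 1 A 1 "{1}"] lspan_mult by auto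
  moreover have "T' \<subseteq> B" using T(2) insert.prems(2)
    by (auto simp: T'_def V_def intro!: B.mult_mem B.power_mem)
  moreover have "1 \<in> T'" unfolding T'_def using T(3) V by (intro image_eqI[of _ _ "(1, 1)"]) auto
  moreover have "finite T'" using T(1) by (simp add: T'_def V_def)
  ultimately show ?case using T(5) by (intro exI[of _ T']) auto
qed

text \<open>The generators in \<open>T\<close> are eliminated one by one: from
  \<open>t = w + m * t + v\<close> with \<open>m\<close> in \<open>I\<close>, the unit
  \<open>1 - m\<close> expresses \<open>t\<close> through \<open>W\<close> and the remaining
  generators. The elementwise hypothesis survives each elimination, and for empty \<open>T\<close>
  it is the claim.\<close>

lemma nakayama:
  assumes A: "subring_set A" and I: "0 \<in> I" "\<And>x y. x \<in> I \<Longrightarrow> y \<in> I \<Longrightarrow> x + y \<in> I"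
      "\<And>x y. x \<in> A \<Longrightarrow> y \<in> I \<Longrightarrow> x * y \<in> I" "I \<subseteq> A"
    and inv: "1 \<notin> I" "\<And>x. x \<in> I \<Longrightarrow> inverse (1 - x) \<in> A"
    and "finite T" "T \<subseteq> C" "\<And>c. c \<in> C \<Longrightarrow> \<exists>w\<in>lspan A W. \<exists>u\<in>lspan I T. c = w + u"
  shows "C \<subseteq> lspan A W"
  using assms(8-10)
proof (induction T rule: finite_induct)
  case empty
  have "lspan I {} = {0}" by (auto elim: lspan.cases intro: lspan_zero)
  then show ?case using empty by force
next
  case (insert t T)
  interpret A: subring_set A by fact
  have split: "\<exists>m\<in>I. \<exists>v\<in>lspan I T. u = m * t + v" if "u \<in> lspan I (insert t T)" for u
    using that
  proof (induction rule: lspan.induct)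
    case lspan_zero
    then show ?case using I(1) by (intro bexI[of _ 0] bexI[of _ "0::'a"] lspan.lspan_zero) auto
  next
    case (lspan_step s t' u)
    then obtain m v where mv: "m \<in> I" "v \<in> lspan I T" "u = m * t + v" by blast
    show ?case
    proof (cases "t' = t")
      case True
      then have "s * t' + u = (s + m) * t + v" using mv by (simp add: algebra_simps)
      then show ?thesis using mv lspan_step I(2) by blast
    next
      case False
      then have "s * t' + v \<in> lspan I T" using lspan_step mv by (intro lspan.lspan_step) auto
      moreover have "s * t' + u = m * t + (s * t' + v)" using mv by (simp add: algebra_simps)
      ultimately show ?thesis using mv by blast
    qed
  qed
  have scale: "a * w \<in> lspan A W" if "a \<in> A" "w \<in> lspan A W" for a w
    using that lspan_scale A.mult_mem by metis
  have scale': "a * w \<in> lspan I T" if "a \<in> A" "w \<in> lspan I T" for a w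
    using that lspan_scale I(3) by metis
  obtain w u where wu: "w \<in> lspan A W" "u \<in> lspan I (insert t T)" "t = w + u"
    using insert.prems by blast
  obtain m v where mv: "m \<in> I" "v \<in> lspan I T" "u = m * t + v" using split[OF wu(2)] by blast
  define i where "i = inverse (1 - m)"
  have "1 - m \<noteq> 0" using mv(1) inv(1) by auto
  moreover have "(1 - m) * t = w + v" using wu(3) mv(3) by (simp add: algebra_simps)
  then have "i * ((1 - m) * t) = i * w + i * v" by (simp only: distrib_left)
  moreover have "i * ((1 - m) * t) = t"
    using \<open>1 - m \<noteq> 0\<close> unfolding i_def mult.assoc[symmetric] by simp
  ultimately have t: "t = i * w + i * v" by simp
  have iA: "i \<in> A" using inv(2) mv(1) by (simp add: i_def)
  show ?case
  proof (rule insert.IH)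
    show "T \<subseteq> C" using insert.prems by blast
    fix c assume "c \<in> C"
    then obtain w' u' where c: "w' \<in> lspan A W" "u' \<in> lspan I (insert t T)" "c = w' + u'"
      using insert.prems by blast
    obtain m' v' where mv': "m' \<in> I" "v' \<in> lspan I T" "u' = m' * t + v'" using split[OF c(2)] by blast
    have "m' * i \<in> A" using A.mult_mem iA mv'(1) I(4) by blast
    then have "w' + m' * i * w \<in> lspan A W" "m' * i * v + v' \<in> lspan I T"
      using scale[OF _ wu(1)] scale'[OF _ mv(2)] c(1) mv'(2) lspan_add by blast+
    moreover have "c = (w' + m' * i * w) + (m' * i * v + v')"
      unfolding c(3) mv'(3) by (subst t) (simp add: algebra_simps)
    ultimately show "\<exists>w\<in>lspan A W. \<exists>u\<in>lspan I T. c = w + u" by blast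
  qed
qed

section \<open>Bounds for the degree of the henselizations\<close>

text \<open>Dividing by the term of least value leaves 1 plus an element of the maximal
  ideal.\<close>

lemma (in valued_field) sum_distinct_values_nonzero:
  assumes "finite A" "A \<noteq> {}" "\<And>a. a \<in> A \<Longrightarrow> f a \<noteq> 0" "inj_on (\<lambda>a. \<mu> (f a)) A"
  shows "sum f A \<noteq> 0"
proof
  assume 0: "sum f A = 0"
  obtain a where a: "a \<in> A" "\<And>b. b \<in> A \<Longrightarrow> \<mu> (f a) \<le> \<mu> (f b)"
    using arg_min_if_finite[OF assms(1,2), of "\<lambda>a. \<mu> (f a)"] not_less by metis
  have "f b / f a \<in> vmax" if b: "b \<in> A - {a}" for b
  proof -
    have "\<mu> (f a) \<noteq> \<mu> (f b)" using assms(4) a(1) b by (auto dest: inj_onD)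
    then show ?thesis using a b assms(3) by (auto simp: vmax_iff val_divide less_le)
  qed
  then have "(\<Sum>b\<in>A - {a}. f b / f a) \<in> vmax" by (rule vmax_sum)
  also have "(\<Sum>b\<in>A - {a}. f b / f a) = (sum f A - f a) / f a"
    using assms(1) a(1) by (simp add: sum_diff1 flip: sum_divide_distrib)
  also have "\<dots> = -1" using 0 assms(3) a(1) by simp
  finally show False by (simp add: vmax_iff)
qed

lemma (in valued_closure) integral_minpoly:
  assumes "unique_extension_from \<mu> M" "x \<in> vring" "is_minpoly M x f"
  shows "coeffs_in (vring \<inter> M) f"
proof -
  have "r \<in> vring" if "poly f r = 0" for r
  proof (cases "x = 0")
    case True
    have "coeffs_in M [:0, 1:]" by (intro coeffs_in_closed) auto
    with that True assms(3) have "r = 0"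
      using minpoly_root_iff_conjugate[of M x f r] by (fastforce simp: conjugate_def)
    then show ?thesis by simp
  next
    case False
    then show ?thesis
      using that assms(2) conjugate_val_if_unique_extension[OF assms(1) _ False, of r]
        minpoly_root_iff_conjugate[OF assms(3), of r] by (auto simp: vring_iff)
  qed
  then have "coeffs_in vring f" using is_minpolyD(2)[OF assms(3)] by (intro roots_integral)
  then show ?thesis using is_minpolyD(1)[OF assms(3)] by (auto simp: coeffs_in_def)
qed

text \<open>The constant coefficient of the minimal polynomial is up to sign a product of conjugates
  of value 0, hence a unit; so the usual formula for the inverse has integral coefficients.\<close>

lemma (in valued_closure) inverse_unit_eq_poly:
  assumes "unique_extension_from \<mu> M" "x \<noteq> 0" "\<mu> x = 0"
  shows "\<exists>p. coeffs_in (vring \<inter> M) p \<and> inverse x = poly p x"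
proof -
  obtain f where f: "is_minpoly M x f" using minpoly_exists by blast
  obtain c g where fg: "f = pCons c g" by (cases f)
  have int: "coeffs_in (vring \<inter> M) f"
    using assms by (intro integral_minpoly[OF _ _ f]) (auto simp: vring_iff)
  have "coeff f 0 \<noteq> 0 \<and> \<mu> (coeff f 0) = (\<Sum>i<degree f. 0)"
    using conjugate_nonzero[OF _ assms(2)] conjugate_val_if_unique_extension[OF assms(1) _ assms(2)]
      minpoly_root_iff_conjugate[OF f] assms(3)
    by (intro val_coeff_0 is_minpolyD(2)[OF f]) metis
  then have c: "c \<noteq> 0" "\<mu> c = 0" by (auto simp: fg)
  have cM: "c \<in> M" and g: "coeffs_in (vring \<inter> M) g"
    using int by (auto simp: fg coeffs_in_pCons_iff)
  have "c + x * poly g x = 0" using is_minpolyD(3)[OF f] by (simp add: fg)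
  then have eq: "x * poly g x = - c" by (simp add: eq_neg_iff_add_eq_0 add.commute)
  have "x * poly (smult (- inverse c) g) x = - inverse c * (x * poly g x)" by simp
  then have eq': "inverse x = poly (smult (- inverse c) g) x"
    unfolding eq using c by (intro inverse_unique) simp
  have "- inverse c \<in> vring" using c by (simp add: vring_iff val_inverse)
  moreover have "- inverse c \<in> M" by (intro minus_mem subfield_closed(6)[OF subfield_M] cM)
  ultimately have "coeffs_in (vring \<inter> M) (smult (- inverse c) g)"
    using g vring.mult_mem mult_mem by (simp only: coeffs_in_def coeff_smult Int_iff) blast
  with eq' show ?thesis by blast
qed

section \<open>Lifts of residues and generators of the valuation ring\<close>

locale valued_extension = valued_closure K \<mu>
  for K :: "'a::field set" and \<mu> :: "'a \<Rightarrow> 'g::linordered_ab_group_add" +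
  fixes L :: "'a set"
  assumes K_subset_L: "K \<subseteq> L" and subfield_L: "subfield L ambient"
begin

definition initial_values :: "'g set"
  where "initial_values =
    {\<gamma> \<in> value_group L \<mu>. 0 \<le> \<gamma> \<and> (\<forall>\<delta>\<in>value_group K \<mu>. 0 < \<delta> \<longrightarrow> \<gamma> < \<delta>)}"

text \<open>Spanning and independence of residue classes are expressed by lifts and congruences
  modulo \<open>vmax\<close>, which keeps the quotient ring out of all arguments with
  values.\<close>

definition residue_spanning :: "'a set \<Rightarrow> bool"
  where "residue_spanning Y \<longleftrightarrow> Y \<subseteq> valuation_ring L \<mu> \<and> (\<forall>b\<in>valuation_ring L \<mu>.
    \<exists>a. (\<forall>y\<in>Y. a y \<in> valuation_ring K \<mu>) \<and> b - (\<Sum>y\<in>Y. a y * y) \<in> vmax)"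

definition residue_independent :: "'a set \<Rightarrow> bool"
  where "residue_independent Y \<longleftrightarrow> Y \<subseteq> valuation_ring L \<mu> \<and>
    (\<forall>a. (\<forall>y\<in>Y. a y \<in> valuation_ring K \<mu>) \<longrightarrow> (\<Sum>y\<in>Y. a y * y) \<in> vmax \<longrightarrow> (\<forall>y\<in>Y. a y \<in> vmax))"

lemma valuation_ring_eq: "valuation_ring N \<mu> = vring \<inter> N"
  by (auto simp: valuation_ring_def vring_iff)

lemma maximal_ideal_eq: "maximal_ideal_of N \<mu> = vmax \<inter> N"
  by (auto simp: maximal_ideal_of_def vmax_iff)

lemma subring_valuation_ring: "subfield N ambient \<Longrightarrow> subring_set (valuation_ring N \<mu>)"
  unfolding valuation_ring_eq
  by unfold_locales (auto intro: vring.minus_mem vring.add_mem vring.mult_mem subfield_closed(2-5))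

text \<open>Coefficients in an immediate extension of \<open>K\<close> can be replaced, up to a common factor and
  modulo the maximal ideal, by elements of the valuation ring of \<open>K\<close>.\<close>

lemma residue_combination:
  assumes near: "\<And>x. x \<in> N \<Longrightarrow> x \<noteq> 0 \<Longrightarrow> \<exists>d\<in>K. near x d"
    and Y: "finite Y" "residue_independent Y" and c: "\<And>y. y \<in> Y \<Longrightarrow> c y \<in> N"
    and nz: "\<exists>y\<in>Y. c y \<noteq> 0"
  shows "(\<Sum>y\<in>Y. c y * y) \<noteq> 0" "\<mu> (\<Sum>y\<in>Y. c y * y) \<in> value_group K \<mu>"
proof -
  define Y' where "Y' = {y \<in> Y. c y \<noteq> 0}"
  have Y': "finite Y'" "Y' \<noteq> {}" using Y nz by (auto simp: Y'_def)
  \<comment> \<open>Dividing by a nonzero coefficient of least value makes all coefficients integral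
    and one of them 1, so independence applies.\<close>
  define v where "v = arg_min_on (\<lambda>y. \<mu> (c y)) Y'"
  have v: "v \<in> Y'" "\<And>y. y \<in> Y' \<Longrightarrow> \<mu> (c v) \<le> \<mu> (c y)"
    using arg_min_if_finite[OF Y', of "\<lambda>y. \<mu> (c y)"] by (auto simp: v_def not_less)
  have cv: "c v \<noteq> 0" "v \<in> Y" using v(1) by (auto simp: Y'_def)
  have "\<exists>d\<in>K. near (c y) d" if "y \<in> Y'" for y using that near c by (auto simp: Y'_def)
  then obtain d where d: "\<And>y. y \<in> Y' \<Longrightarrow> d y \<in> K \<and> near (c y) (d y)" by metis
  define a where "a y = (if y \<in> Y' then d y / d v else 0)" for y
  have a: "a y \<in> valuation_ring K \<mu> \<and> c y / c v - a y \<in> vmax" if y: "y \<in> Y" for y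
  proof (cases "y \<in> Y'")
    case True
    have near: "near (c y / c v) (a y)"
      using near_divide[of "c y" "d y" "c v" "d v"] d[OF True] d[OF v(1)] True by (simp add: a_def)
    moreover have "c y / c v \<in> vring"
      using v(2)[OF True] True cv by (simp add: vring_iff val_divide Y'_def)
    moreover have "a y \<in> K" using d[OF True] d[OF v(1)] True subfield_closed(8)[OF subfield_M]
      by (simp add: a_def)
    moreover have "a y \<in> vring"
      using near_val[OF near] \<open>c y / c v \<in> vring\<close> by (simp add: vring_iff)
    ultimately show ?thesis
      using near_diff_vmax[OF near] by (simp add: valuation_ring_eq)
  next
    case False
    then show ?thesis using y by (simp add: a_def Y'_def valuation_ring_eq vmax_closed)
  qed
  have YL: "Y \<subseteq> vring" using Y(2) by (auto simp: residue_independent_def valuation_ring_eq)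
  define s where "s = (\<Sum>y\<in>Y. c y * y) / c v"
  have "s - (\<Sum>y\<in>Y. a y * y) = (\<Sum>y\<in>Y. (c y / c v - a y) * y)"
    by (simp add: s_def sum_divide_distrib algebra_simps flip: sum_subtractf)
  also have "\<dots> \<in> vmax" using a YL by (intro vmax_sum vmax_closed(5)) auto
  finally have sa: "s - (\<Sum>y\<in>Y. a y * y) \<in> vmax" .
  have dv: "d v \<in> K" "d v \<noteq> 0" "\<mu> (c v) = \<mu> (d v)" using d[OF v(1)] near_val[of "c v" "d v"] by auto
  then have "a v = 1" using v(1) by (simp add: a_def)
  then have "a v \<notin> vmax" by (simp add: vmax_iff)
  then have "(\<Sum>y\<in>Y. a y * y) \<notin> vmax"
    using Y(2) a cv(2) unfolding residue_independent_def by blast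
  then have "s \<notin> vmax" using vmax_diff[OF _ sa] by force
  moreover have "(\<Sum>y\<in>Y. a y * y) \<in> vring"
    using a YL by (intro vring.sum_mem vring.mult_mem) (auto simp: valuation_ring_eq)
  then have "s \<in> vring" using vring.add_mem[of "s - (\<Sum>y\<in>Y. a y * y)"] sa vmax_subset by fastforce
  ultimately have s: "s \<noteq> 0" "\<mu> s = 0" by (auto simp: vring_iff vmax_iff)
  have eq: "(\<Sum>y\<in>Y. c y * y) = s * c v" using cv by (simp add: s_def)
  show "(\<Sum>y\<in>Y. c y * y) \<noteq> 0" using s cv by (simp add: eq)
  have "\<mu> (s * c v) = \<mu> (d v)" using s cv dv by (simp add: val_mult)
  then show "\<mu> (\<Sum>y\<in>Y. c y * y) \<in> value_group K \<mu>"
    unfolding eq value_group_def using dv by auto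
qed

lemma value_group_diff:
  assumes "\<gamma> \<in> value_group N \<mu>" "\<delta> \<in> value_group N \<mu>" "subfield N ambient"
  shows "\<gamma> - \<delta> \<in> value_group N \<mu>"
proof -
  obtain x y where "x \<in> N" "x \<noteq> 0" "y \<in> N" "y \<noteq> 0" "\<gamma> = \<mu> x" "\<delta> = \<mu> y"
    using assms(1,2) by (auto simp: value_group_def)
  then have "\<gamma> - \<delta> = \<mu> (x / y)" "x / y \<in> N - {0}"
    using subfield_closed(8)[OF assms(3)] by (auto simp: val_divide)
  then show ?thesis unfolding value_group_def by blast
qed

text \<open>The inner sums have values in the value group of \<open>K\<close>, so terms with
  different \<open>x\<close> have values in different cosets, and a sum of terms with distinct
  values does not vanish. This is the independence behind the bound \<open>e f \<le> [E : N]\<close>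
  for \<open>N\<close> immediate over \<open>K\<close>.\<close>

lemma products_independent:
  assumes near: "\<And>x. x \<in> N \<Longrightarrow> x \<noteq> 0 \<Longrightarrow> \<exists>d\<in>K. near x d"
    and U: "finite U" "0 \<notin> U"
      "\<And>x x'. x \<in> U \<Longrightarrow> x' \<in> U \<Longrightarrow> x \<noteq> x' \<Longrightarrow> \<mu> x - \<mu> x' \<notin> value_group K \<mu>"
    and Y: "finite Y" "residue_independent Y" and c: "\<And>x y. x \<in> U \<Longrightarrow> y \<in> Y \<Longrightarrow> c x y \<in> N"
    and zero: "(\<Sum>x\<in>U. \<Sum>y\<in>Y. c x y * (x * y)) = 0" and xy: "x \<in> U" "y \<in> Y"
  shows "c x y = 0"
proof (rule ccontr)
  assume nz: "c x y \<noteq> 0"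
  define s where "s x = (\<Sum>y\<in>Y. c x y * y)" for x
  define U' where "U' = {x \<in> U. \<exists>y\<in>Y. c x y \<noteq> 0}"
  have s: "s x \<noteq> 0" "\<mu> (s x) \<in> value_group K \<mu>" if "x \<in> U'" for x
    using residue_combination[where c = "c x", OF near Y] c that unfolding s_def U'_def by auto
  have "(\<Sum>x\<in>U'. x * s x) \<noteq> 0"
  proof (rule sum_distinct_values_nonzero)
    show "finite U'" "U' \<noteq> {}" using U(1) xy nz by (auto simp: U'_def)
    show "x * s x \<noteq> 0" if "x \<in> U'" for x using s[OF that] U(2) that by (auto simp: U'_def)
    show "inj_on (\<lambda>x. \<mu> (x * s x)) U'"
    proof (rule inj_onI, rule ccontr)
      fix x x' assume x: "x \<in> U'" "x' \<in> U'" "\<mu> (x * s x) = \<mu> (x' * s x')" "x \<noteq> x'"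
      have "x \<noteq> 0" "x' \<noteq> 0" using x U(2) by (auto simp: U'_def)
      then have "\<mu> x - \<mu> x' = \<mu> (s x') - \<mu> (s x)"
        using x(3) s[OF x(1)] s[OF x(2)] by (simp add: val_mult algebra_simps)
      then have "\<mu> x - \<mu> x' \<in> value_group K \<mu>"
        using value_group_diff[OF s(2)[OF x(2)] s(2)[OF x(1)] subfield_M] by simp
      then show False using U(3)[of x x'] x by (auto simp: U'_def)
    qed
  qed
  moreover have "(\<Sum>x\<in>U'. x * s x) = (\<Sum>x\<in>U. x * s x)"
    using U(1) by (intro sum.mono_neutral_left) (auto simp: U'_def s_def)
  moreover have "\<dots> = (\<Sum>x\<in>U. \<Sum>y\<in>Y. c x y * (x * y))"
    unfolding s_def sum_distrib_left by (simp add: mult_ac)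
  ultimately show False using zero by simp
qed

text \<open>If the value of \<open>b\<close> is not initial, an element of \<open>K\<close> of
  positive value divides \<open>b\<close>. Otherwise the residue of \<open>b / z \<gamma>\<close> is
  matched by a combination of \<open>Y\<close>; subtracting it raises the value, which can happen
  only finitely often since fewer initial values lie at or above it each time.\<close>

lemma valuation_ring_decomposition:
  assumes "finite initial_values" and z: "\<And>\<gamma>. \<gamma> \<in> initial_values \<Longrightarrow> z \<gamma> \<in> L - {0} \<and> \<mu> (z \<gamma>) = \<gamma>"
    and Y: "finite Y" "residue_spanning Y" and b: "b \<in> valuation_ring L \<mu>"
  defines "W \<equiv> (\<lambda>(y, \<gamma>). y * z \<gamma>) ` (Y \<times> initial_values)"
  shows "\<exists>w\<in>lspan (valuation_ring K \<mu>) W. \<exists>d\<in>vmax \<inter> K. \<exists>b'\<in>valuation_ring L \<mu>. b = w + d * b'"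
  using b
proof (induction "card {\<gamma> \<in> initial_values. \<mu> b \<le> \<gamma>}" arbitrary: b rule: less_induct)
  case less
  interpret B: subring_set "valuation_ring L \<mu>" by (rule subring_valuation_ring[OF subfield_L])
  have trivial: ?case if "b = 0"
    using that vmax_closed(1) by (intro bexI[of _ 0] lspan_zero) auto
  show ?case
  proof (cases "b = 0")
    case False
    have b: "b \<in> L" "0 \<le> \<mu> b" "\<mu> b \<in> value_group L \<mu>"
      using less.prems False by (auto simp: valuation_ring_eq vring_iff value_group_def)
    show ?thesis
    proof (cases "\<mu> b \<in> initial_values")
      case False
      then obtain \<delta> where "\<delta> \<in> value_group K \<mu>" "0 < \<delta>" "\<delta> \<le> \<mu> b"
        using b by (auto simp: initial_values_def not_less)
      then obtain d where d: "d \<in> K" "d \<noteq> 0" "0 < \<mu> d" "\<mu> d \<le> \<mu> b"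
        by (auto simp: value_group_def)
      then have "b / d \<in> valuation_ring L \<mu>"
        using b \<open>b \<noteq> 0\<close> K_subset_L subfield_closed(8)[OF subfield_L]
        by (auto simp: valuation_ring_eq vring_iff val_divide)
      moreover have "b = 0 + d * (b / d)" using d by simp
      moreover have "d \<in> vmax \<inter> K" using d by (simp add: vmax_iff)
      ultimately show ?thesis using lspan_zero by blast
    next
      case True
      define \<gamma> where "\<gamma> = \<mu> b"
      have z\<gamma>: "z \<gamma> \<in> L" "z \<gamma> \<noteq> 0" "\<mu> (z \<gamma>) = \<mu> b" using z[OF True] by (auto simp: \<gamma>_def)
      then have "b / z \<gamma> \<in> valuation_ring L \<mu>"
        using b(1) \<open>b \<noteq> 0\<close> subfield_closed(8)[OF subfield_L]
        by (auto simp: valuation_ring_eq vring_iff val_divide)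
      then obtain a where a: "\<And>y. y \<in> Y \<Longrightarrow> a y \<in> valuation_ring K \<mu>"
        "b / z \<gamma> - (\<Sum>y\<in>Y. a y * y) \<in> vmax" using Y(2) unfolding residue_spanning_def by blast
      define w where "w = (\<Sum>y\<in>Y. a y * (y * z \<gamma>))"
      have w: "w \<in> lspan (valuation_ring K \<mu>) W"
        unfolding w_def using a(1) True by (intro lspan_sum lspan_base) (auto simp: W_def \<gamma>_def)
      define r where "r = b / z \<gamma> - (\<Sum>y\<in>Y. a y * y)"
      have bw: "b - w = r * z \<gamma>"
        using z\<gamma> by (simp add: r_def w_def algebra_simps sum_distrib_left)
      have "a y * (y * z \<gamma>) \<in> L" if "y \<in> Y" for y
      proof -
        have "a y \<in> L" "y \<in> L"
          using a(1)[OF that] that Y(2) K_subset_L by (auto simp: residue_spanning_def valuation_ring_eq)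
        then show ?thesis using z\<gamma>(1) subfield_closed(4)[OF subfield_L] by blast
      qed
      then have "w \<in> L" unfolding w_def by (rule subfield_sum[OF subfield_L])
      then have bwL: "b - w \<in> L" using b(1) subfield_closed(7)[OF subfield_L] by blast
      have "r \<in> vmax" using a(2) by (simp add: r_def)
      have val: "b - w = 0 \<or> \<mu> b < \<mu> (b - w)"
        unfolding bw using \<open>r \<in> vmax\<close> z\<gamma> by (cases "r = 0") (auto simp: vmax_iff val_mult)
      then have bwB: "b - w \<in> valuation_ring L \<mu>"
        using bwL b(2) by (auto simp: valuation_ring_eq vring_iff)
      have "\<exists>w'\<in>lspan (valuation_ring K \<mu>) W. \<exists>d\<in>vmax \<inter> K. \<exists>b'\<in>valuation_ring L \<mu>. b - w = w' + d * b'"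
      proof (cases "b - w = 0")
        case True
        then show ?thesis
          using vmax_closed(1) by (intro bexI[of _ 0] lspan_zero) auto
      next
        case False
        have "{\<gamma> \<in> initial_values. \<mu> (b - w) \<le> \<gamma>} \<subset> {\<gamma> \<in> initial_values. \<mu> b \<le> \<gamma>}"
        proof (intro psubsetI notI)
          show "{\<gamma> \<in> initial_values. \<mu> (b - w) \<le> \<gamma>} \<subseteq> {\<gamma> \<in> initial_values. \<mu> b \<le> \<gamma>}"
            using val False by auto
          assume "{\<gamma> \<in> initial_values. \<mu> (b - w) \<le> \<gamma>} = {\<gamma> \<in> initial_values. \<mu> b \<le> \<gamma>}"
          then have "\<mu> (b - w) \<le> \<mu> b" using \<open>\<mu> b \<in> initial_values\<close> by blast
          then show False using val False by auto
        qed
        then have "card {\<gamma> \<in> initial_values. \<mu> (b - w) \<le> \<gamma>} < card {\<gamma> \<in> initial_values. \<mu> b \<le> \<gamma>}"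
          using assms(1) by (intro psubset_card_mono) auto
        then show ?thesis using less.hyps bwB by blast
      qed
      then obtain w' d b' where "w' \<in> lspan (valuation_ring K \<mu>) W" "d \<in> vmax \<inter> K"
        "b' \<in> valuation_ring L \<mu>" "b = (w + w') + d * b'" by (auto simp: algebra_simps)
      then show ?thesis using lspan_add[OF w] by blast
    qed
  qed (rule trivial)
qed

text \<open>Over the henselization \<open>Z\<close> of \<open>K\<close>, the generators of the valuation ring of \<open>L\<close> are integral
  and the denominators are units of the finite ring extension that they generate.\<close>

theorem henselization_eq_lspan:
  assumes efg: "essentially_finitely_generated (valuation_ring K \<mu>) (valuation_ring L \<mu>)"
    and "finite initial_values" and z: "\<And>\<gamma>. \<gamma> \<in> initial_values \<Longrightarrow> z \<gamma> \<in> L - {0} \<and> \<mu> (z \<gamma>) = \<gamma>"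
    and Y: "finite Y" "residue_spanning Y"
  shows "henselization \<mu> L =
    lspan (henselization \<mu> K) ((\<lambda>(y, \<gamma>). y * z \<gamma>) ` (Y \<times> initial_values))"
proof -
  define Z where "Z = henselization \<mu> K"
  define W where "W = (\<lambda>(y, \<gamma>). y * z \<gamma>) ` (Y \<times> initial_values)"
  define B where "B = valuation_ring L \<mu>"
  interpret Z: valued_closure Z \<mu>
    unfolding Z_def by (rule valued_closure_intermediate[OF subset_henselization subfield_henselization])
  interpret L: valued_closure L \<mu>
    by (rule valued_closure_intermediate[OF K_subset_L subfield_L])
  have uniq: "unique_extension_from \<mu> Z" unfolding Z_def by (rule unique_extension_henselization)
  have KZ: "K \<subseteq> Z" unfolding Z_def by (rule subset_henselization)
  define A where "A = vring \<inter> Z"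
  interpret A: subring_set A
    unfolding A_def using subring_valuation_ring[OF Z.subfield_M] by (simp add: valuation_ring_eq)
  have KA: "valuation_ring K \<mu> \<subseteq> A" using KZ by (auto simp: A_def valuation_ring_eq)
  interpret B: subring_set B unfolding B_def by (rule subring_valuation_ring[OF subfield_L])
  have Bv: "B \<subseteq> vring" by (auto simp: B_def valuation_ring_eq)
  obtain G S where GS: "finite G" "G \<subseteq> B" "submonoid S ambient"
    "S \<subseteq> generate_ring ambient (valuation_ring K \<mu> \<union> G)" "0 \<notin> S"
    "B = {a / s | a s. a \<in> generate_ring ambient (valuation_ring K \<mu> \<union> G) \<and> s \<in> S}"
    using efg unfolding essentially_finitely_generated_def B_def by blast
  have "\<exists>f. coeffs_in A f \<and> lead_coeff f = 1 \<and> poly f g = 0" if "g \<in> G" for g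
  proof -
    obtain f where "is_minpoly Z g f" using Z.minpoly_exists by blast
    then show ?thesis
      using Z.integral_minpoly[OF uniq, of g f] is_minpolyD that GS(2) Bv unfolding A_def by blast
  qed
  then obtain T where T: "finite T" "T \<subseteq> B" "1 \<in> T" "subring_set (lspan A T)" "G \<subseteq> lspan A T"
    using finite_integral_extension[OF A.subring_set_axioms GS(1) _ B.subring_set_axioms GS(2)] by blast
  define C where "C = lspan A T"
  interpret C: subring_set C unfolding C_def by (rule T(4))
  have AC: "A \<subseteq> C" using lspan_base[OF _ T(3), of _ A] by (auto simp: C_def)
  have gen: "generate_ring ambient (valuation_ring K \<mu> \<union> G) \<subseteq> C"
  proof
    fix x assume "x \<in> generate_ring ambient (valuation_ring K \<mu> \<union> G)"
    then show "x \<in> C"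
      by (induction rule: generate_ring.induct)
        (use KA AC T(5) in \<open>auto simp: C_def[symmetric] intro: C.minus_mem C.add_mem C.mult_mem\<close>)
  qed
  have "inverse s \<in> C" if s: "s \<in> S" for s
  proof -
    have gens: "s \<in> generate_ring ambient (valuation_ring K \<mu> \<union> G)"
      "1 \<in> generate_ring ambient (valuation_ring K \<mu> \<union> G)"
      using s GS(4) generate_ring.one[of ambient] by auto
    have "1 \<in> S" using submonoid.one_closed[OF GS(3)] by simp
    \<comment> \<open>Both \<open>s\<close> and its inverse lie in the valuation ring of
      \<open>L\<close>, so \<open>s\<close> is a unit and its inverse is a polynomial in
      \<open>s\<close> over \<open>A\<close>.\<close>
    then have "s / 1 \<in> B" "1 / s \<in> B" using gens s unfolding GS(6) by blast+
    then have "0 \<le> \<mu> s" "0 \<le> \<mu> (inverse s)" using Bv GS(5) s by (auto simp: vring_iff divide_inverse)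
    moreover have s0: "s \<noteq> 0" using s GS(5) by auto
    ultimately have "\<mu> s = 0" by (simp add: val_inverse)
    then obtain p where "coeffs_in A p" "inverse s = poly p s"
      using Z.inverse_unit_eq_poly[OF uniq s0] unfolding A_def by blast
    then show ?thesis using gen gens(1) by (auto intro!: C.poly_mem intro: coeffs_in_mono[OF _ AC])
  qed
  then have BC: "B \<subseteq> C"
    using gen unfolding GS(6) by (auto simp: divide_inverse intro!: C.mult_mem)
  \<comment> \<open>The ideal is the maximal ideal of \<open>A\<close>; elements of \<open>C\<close>
    are reduced modulo it by decomposing the generators in \<open>T\<close>, which lie in
    \<open>B\<close>.\<close>
  have "C \<subseteq> lspan A W"
  proof (rule nakayama[OF A.subring_set_axioms, of "vmax \<inter> Z" T])
    show "0 \<in> vmax \<inter> Z" "1 \<notin> vmax \<inter> Z" by (auto simp: vmax_closed) (auto simp: vmax_iff)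
    show "vmax \<inter> Z \<subseteq> A" using vmax_subset by (auto simp: A_def)
    show "x + y \<in> vmax \<inter> Z" if "x \<in> vmax \<inter> Z" "y \<in> vmax \<inter> Z" for x y
      using that by (auto intro: vmax_closed Z.add_mem)
    show "x * y \<in> vmax \<inter> Z" if "x \<in> A" "y \<in> vmax \<inter> Z" for x y
      using that by (auto simp: A_def intro: vmax_closed Z.mult_mem)
    show "inverse (1 - x) \<in> A" if x: "x \<in> vmax \<inter> Z" for x
    proof -
      have "near (1 - x) 1" using x vmax_closed(3) by (simp add: near_def)
      then have "\<mu> (inverse (1 - x)) = 0" using near_val[of "1 - x" 1] by (simp add: val_inverse)
      moreover have "inverse (1 - x) \<in> Z"
        using x by (intro subfield_closed(6)[OF Z.subfield_M] Z.diff_mem) auto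
      ultimately show ?thesis by (simp add: A_def vring_iff)
    qed
    show "finite T" "T \<subseteq> C" using T(1,2) BC by auto
    fix c assume "c \<in> C"
    then have "c \<in> lspan A T" by (simp add: C_def)
    then show "\<exists>w\<in>lspan A W. \<exists>u\<in>lspan (vmax \<inter> Z) T. c = w + u"
    proof (induction rule: lspan.induct)
      case lspan_zero
      show ?case by (intro bexI[of _ 0] lspan.lspan_zero) simp
    next
      case (lspan_step s t u)
      obtain w d b where wdb: "w \<in> lspan (valuation_ring K \<mu>) W" "d \<in> vmax \<inter> K"
        "b \<in> B" "t = w + d * b"
        using valuation_ring_decomposition[OF assms(2) z Y, of t] T(2) lspan_step(2)
        unfolding W_def B_def by blast
      have "w \<in> lspan A W" using wdb(1) lspan_mono[OF KA order_refl] by blast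
      then have sw: "s * w \<in> lspan A W" using lspan_step(1) lspan_scale A.mult_mem by metis
      have sd: "(s * d) * a \<in> vmax \<inter> Z" if "a \<in> A" for a
      proof -
        have "s * d \<in> vmax" using lspan_step(1) wdb(2) by (intro vmax_closed(4)) (auto simp: A_def)
        moreover have "a \<in> vring" using that by (simp add: A_def)
        ultimately have "(s * d) * a \<in> vmax" by (rule vmax_closed(5))
        moreover have "(s * d) * a \<in> Z"
          using lspan_step(1) wdb(2) KZ that by (intro Z.mult_mem) (auto simp: A_def)
        ultimately show ?thesis by blast
      qed
      have "b \<in> lspan A T" using wdb(3) BC by (auto simp: C_def)
      then have "(s * d) * b \<in> lspan (vmax \<inter> Z) T" using sd by (rule lspan_scale)
      moreover obtain w' u' where "w' \<in> lspan A W" "u' \<in> lspan (vmax \<inter> Z) T" "u = w' + u'"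
        using lspan_step by blast
      moreover from this have "s * t + u = (s * w + w') + (s * d * b + u')"
        by (simp add: wdb(4) algebra_simps)
      ultimately show ?case using sw lspan_add by blast
    qed
  qed
  moreover have "lspan A W \<subseteq> lspan Z W" by (intro lspan_mono) (auto simp: A_def)
  ultimately have BW: "B \<subseteq> lspan Z W" using BC by blast
  have B1: "b \<in> lspan Z B" if "b \<in> B" for b using lspan_base[OF Z.one_mem that] by simp
  \<comment> \<open>\<open>lspan Z B\<close> is the compositum of \<open>L\<close> and
    \<open>Z\<close>: a ring over \<open>Z\<close>, hence a field, containing \<open>L\<close>
    because every nonzero element of \<open>L\<close> or its inverse is in \<open>B\<close>.\<close>
  have ring: "subring_set (lspan Z B)"
    using B1 B.mult_mem by (intro lspan_subring_set Z.subring_set_axioms) auto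
  have ZB: "Z \<subseteq> lspan Z B" using lspan_base[OF _ B.one_mem, of _ Z] by auto
  interpret F: valued_closure "lspan Z B" \<mu>
    using closed_extension.subfield_M[OF Z.intermediate_ring[OF ZB ring]]
    by (rule Z.valued_closure_intermediate[OF ZB])
  have LF: "L \<subseteq> lspan Z B"
  proof
    fix l assume l: "l \<in> L"
    show "l \<in> lspan Z B"
    proof (cases "l \<in> B")
      case False
      then have "inverse l \<in> B"
        using l subfield_closed(6)[OF subfield_L]
        by (cases "l = 0") (auto simp: B_def valuation_ring_eq vring_iff val_inverse)
      then have "inverse (inverse l) \<in> lspan Z B"
        by (intro subfield_closed(6)[OF F.subfield_M] B1)
      then show ?thesis by simp
    qed (rule B1)
  qed
  \<comment> \<open>An extension from a field containing \<open>Z\<close> is one from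
    \<open>Z\<close>, so uniqueness is inherited.\<close>
  have uniqF: "unique_extension_from \<mu> (lspan Z B)"
    using uniq ZB unfolding unique_extension_from_def extends_on_def by blast
  have "henselization \<mu> L \<subseteq> lspan Z B"
    by (rule L.henselization_least[OF F.subfield_M LF uniqF])
  also have "\<dots> \<subseteq> lspan Z W" by (rule lspan_subset[OF Z.mult_mem BW])
  finally have 1: "henselization \<mu> L \<subseteq> lspan Z W" .
  \<comment> \<open>The henselization of \<open>L\<close> contains \<open>K\<close> and has a unique
    extension, so minimality puts \<open>Z\<close> inside it.\<close>
  have "Z \<subseteq> henselization \<mu> L"
    unfolding Z_def using L.subset_henselization K_subset_L
    by (intro henselization_least L.subfield_henselization L.unique_extension_henselization) auto
  moreover have "W \<subseteq> L"
    using Y(2) z subfield_closed(4)[OF subfield_L]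
    by (auto simp: W_def residue_spanning_def valuation_ring_eq)
  ultimately have "lspan Z W \<subseteq> henselization \<mu> L"
    using L.subset_henselization subfield_closed(1,3,4)[OF L.subfield_henselization]
    by (intro lspan_least) blast+
  with 1 show ?thesis unfolding Z_def W_def by blast
qed

end

section \<open>Dimensions\<close>

lemma combine_map_ambient:
  "ring.combine (ambient :: 'a::field ring) (map c ps) (map f ps) = (\<Sum>p\<leftarrow>ps. c p * f p)"
proof -
  interpret R: ring "ambient :: 'a ring" by (rule ring_ambient)
  show ?thesis by (induction ps) auto
qed

lemma map_map_of_zip:
  assumes "distinct ps" "length ks = length ps"
  shows "map (\<lambda>p. the (map_of (zip ps ks) p)) ps = ks"
  using assms by (intro nth_equalityI) (auto simp: map_of_zip_nth)

text \<open>The index list is distinct, not the list of vectors \<open>f p\<close>: products from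
  different pairs are not known to differ beforehand.\<close>

lemma independent_ambientI:
  fixes Z :: "'a::field set"
  assumes Z: "subfield Z ambient" and ps: "distinct ps"
    and c: "\<And>c. (\<And>p. p \<in> set ps \<Longrightarrow> c p \<in> Z) \<Longrightarrow> (\<Sum>p\<in>set ps. c p * f p) = 0 \<Longrightarrow> \<forall>p\<in>set ps. c p = 0"
  shows "ring.independent ambient Z (map f ps)"
proof (rule ccontr)
  interpret R: field "ambient :: 'a ring" by (rule field_ambient)
  assume dep: "R.dependent Z (map f ps)"
  obtain ks where ks: "length ks = length (map f ps)" "R.combine ks (map f ps) = \<zero>\<^bsub>ambient\<^esub>"
    "set ks \<subseteq> Z" "set ks \<noteq> {\<zero>\<^bsub>ambient\<^esub>}"
    using R.dependent_imp_non_trivial_combine[OF Z _ dep] by auto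
  define c where "c p = the (map_of (zip ps ks) p)" for p
  have c_ks: "map c ps = ks" unfolding c_def using ks(1) ps by (intro map_map_of_zip) auto
  have "(\<Sum>p\<in>set ps. c p * f p) = 0"
    using ks(2) combine_map_ambient[of c ps f] ps by (simp add: c_ks sum_list_distinct_conv_sum_set)
  moreover have "c p \<in> Z" if "p \<in> set ps" for p
    using ks(3) that unfolding c_ks[symmetric] by auto
  ultimately have "\<forall>p\<in>set ps. c p = 0" using assms(3) by blast
  then have "set ks \<subseteq> {0}" unfolding c_ks[symmetric] by auto
  moreover have "ps \<noteq> []" using dep by auto
  then have "set ks \<noteq> {}" using ks(1) by auto
  ultimately show False using ks(4) by (auto simp: subset_singleton_iff)
qed

lemma Span_eq_lspan:
  fixes Z :: "'a::field set"
  assumes Z: "subfield Z ambient"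
  shows "ring.Span ambient Z Us = lspan Z (set Us)"
proof
  interpret R: field "ambient :: 'a ring" by (rule field_ambient)
  show "R.Span Z Us \<subseteq> lspan Z (set Us)"
  proof (induction Us)
    case Nil
    then show ?case by (auto intro: lspan_zero)
  next
    case (Cons u Us)
    show ?case
    proof
      fix x assume "x \<in> R.Span Z (u # Us)"
      then obtain k v where "k \<in> Z" "v \<in> R.Span Z Us" "x = k * u + v"
        by (auto simp: R.line_extension_mem_iff)
      moreover have "lspan Z (set Us) \<subseteq> lspan Z (set (u # Us))" by (intro lspan_mono) auto
      ultimately show "x \<in> lspan Z (set (u # Us))" using Cons by (auto intro!: lspan_step)
    qed
  qed
  show "lspan Z (set Us) \<subseteq> R.Span Z Us"
  proof (rule lspan_least)
    show "0 \<in> R.Span Z Us" using R.Span_subgroup_props(2)[OF Z, of Us] by simp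
    show "u + v \<in> R.Span Z Us" if "u \<in> R.Span Z Us" "v \<in> R.Span Z Us" for u v
      using R.Span_subgroup_props(3)[OF Z, of Us] that by simp
    show "s * t \<in> R.Span Z Us" if "s \<in> Z" "t \<in> set Us" for s t
      using R.Span_smult_closed[OF Z, of Us s t] R.Span_base_incl[OF Z, of Us] that by auto
  qed
qed

lemma dimension_lspan:
  fixes Z :: "'a::field set"
  assumes Z: "subfield Z ambient" and W: "finite W"
  shows "\<exists>n\<le>card W. ring.dimension ambient n Z (lspan Z W)"
proof -
  interpret R: field "ambient :: 'a ring" by (rule field_ambient)
  have *: "\<exists>n\<le>length Us. R.dimension n Z (R.Span Z Us)" for Us
  proof (induction Us)
    case (Cons u Us)
    then obtain n where n: "n \<le> length Us" "R.dimension n Z (R.Span Z Us)" by blast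
    show ?case
    proof (cases "u \<in> R.Span Z Us")
      case True
      then have "R.Span Z (u # Us) = R.Span Z Us"
        using R.Span_base_incl[OF Z, of Us] R.mono_Span[OF Z, of Us u]
          R.mono_Span_subset[OF Z, of "u # Us" Us] by auto
      with n show ?thesis by (metis le_Suc_eq list.size(4) add.right_neutral add_Suc_right)
    next
      case False
      then have "R.dimension (Suc n) Z (R.line_extension Z u (R.Span Z Us))"
        using n by (intro R.Suc_dim) auto
      then show ?thesis using n(1) by (intro exI[of _ "Suc n"]) auto
    qed
  qed (use R.zero_dim[of Z] in simp)
  obtain Us where "set Us = W" "distinct Us" using finite_distinct_list[OF W] by blast
  with *[of Us, unfolded Span_eq_lspan[OF Z]] distinct_card[of Us] show ?thesis by simp
qed

text \<open>Used with \<open>N = K\<close>, \<open>E = L\<close> to see that the indices are finite,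
  and with the two henselizations for the lower bound \<open>e f\<close> of their degree.\<close>

lemma (in valued_extension) card_products_le_dimension:
  assumes near: "\<And>x. x \<in> N \<Longrightarrow> x \<noteq> 0 \<Longrightarrow> \<exists>d\<in>K. near x d"
    and N: "subfield N ambient" and dim: "ring.dimension ambient n N E" "L \<subseteq> E"
    and U: "finite U" "U \<subseteq> L - {0}"
      "\<And>x x'. x \<in> U \<Longrightarrow> x' \<in> U \<Longrightarrow> x \<noteq> x' \<Longrightarrow> \<mu> x - \<mu> x' \<notin> value_group K \<mu>"
    and Y: "finite Y" "residue_independent Y"
  shows "card U * card Y \<le> n"
proof -
  interpret R: field "ambient :: 'a ring" by (rule field_ambient)
  obtain ps where ps: "set ps = U \<times> Y" "distinct ps" 
    using finite_distinct_list[OF finite_cartesian_product[OF U(1) Y(1)]] by blast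
  have "R.independent N (map (\<lambda>(x, y). x * y) ps)"
  proof (rule independent_ambientI[OF N ps(2)])
    fix c assume c: "\<And>p. p \<in> set ps \<Longrightarrow> c p \<in> N" "(\<Sum>p\<in>set ps. c p * (case p of (x, y) \<Rightarrow> x * y)) = 0"
    have "(\<Sum>x\<in>U. \<Sum>y\<in>Y. c (x, y) * (x * y)) = 0"
      using c(2) U(1) Y(1) by (simp add: ps(1) sum.cartesian_product case_prod_unfold)
    then show "\<forall>p\<in>set ps. c p = 0"
      using products_independent[OF near U(1) _ U(3) Y, of N "\<lambda>x y. c (x, y)"] U(2) c(1) by (auto simp: ps(1))
  qed
  moreover have "set (map (\<lambda>(x, y). x * y) ps) \<subseteq> E"
  proof -
    have "x * y \<in> E" if "x \<in> U" "y \<in> Y" for x y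
    proof -
      have "x \<in> L" "y \<in> L"
        using that U(2) Y(2) by (auto simp: residue_independent_def valuation_ring_eq)
      then show ?thesis using subfield_closed(4)[OF subfield_L] dim(2) by blast
    qed
    then show ?thesis by (auto simp: ps(1))
  qed
  ultimately have "length ps \<le> n"
    using R.independent_length_le_dimension[OF N dim(1)] by fastforce
  then show ?thesis using distinct_card[OF ps(2)] by (simp add: ps(1) card_cartesian_product)
qed

section \<open>The residue field\<close>

context valued_extension
begin

definition res_ring :: "'a set \<Rightarrow> 'a ring"
  where "res_ring N = ambient\<lparr>carrier := valuation_ring N \<mu>\<rparr>"

definition res :: "'a \<Rightarrow> 'a set"
  where "res x = maximal_ideal_of L \<mu> +>\<^bsub>res_ring L\<^esub> x"

lemma res_ring_simps [simp]:
  "carrier (res_ring L) = valuation_ring L \<mu>" "x \<otimes>\<^bsub>res_ring L\<^esub> y = x * y"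
  "x \<oplus>\<^bsub>res_ring L\<^esub> y = x + y" "\<one>\<^bsub>res_ring L\<^esub> = 1" "\<zero>\<^bsub>res_ring L\<^esub> = 0"
  unfolding res_ring_def by simp_all

lemma cring_res_ring: "cring (res_ring L)"
proof -
  interpret B: subring_set "valuation_ring L \<mu>" by (rule subring_valuation_ring[OF subfield_L])
  show ?thesis
  proof (intro cringI abelian_groupI comm_monoidI)
    fix x assume "x \<in> carrier (res_ring L)"
    then show "\<exists>y\<in>carrier (res_ring L). y \<oplus>\<^bsub>res_ring L\<^esub> x = \<zero>\<^bsub>res_ring L\<^esub>"
      using B.minus_mem[of x] by (intro bexI[of _ "- x"]) auto
  qed (auto simp: algebra_simps intro: B.add_mem B.mult_mem)
qed

lemma ideal_maximal_ideal: "ideal (maximal_ideal_of L \<mu>) (res_ring L)"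
proof (rule idealI)
  interpret R: cring "res_ring L" by (rule cring_res_ring)
  show "ring (res_ring L)" by (rule R.ring_axioms)
  show "subgroup (maximal_ideal_of L \<mu>) (add_monoid (res_ring L))"
  proof (rule R.add.subgroupI)
    show "maximal_ideal_of L \<mu> \<subseteq> carrier (res_ring L)"
      using vmax_subset by (auto simp: maximal_ideal_eq valuation_ring_eq)
    show "maximal_ideal_of L \<mu> \<noteq> {}"
      using vmax_closed(1) subfield_closed(1)[OF subfield_L] by (auto simp: maximal_ideal_eq)
    fix x assume x: "x \<in> maximal_ideal_of L \<mu>"
    then have "x \<in> valuation_ring L \<mu>" "- x \<in> valuation_ring L \<mu>"
      using vmax_subset vring.minus_mem subfield_closed(5)[OF subfield_L]
      by (auto simp: maximal_ideal_eq valuation_ring_eq)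
    then have "\<ominus>\<^bsub>res_ring L\<^esub> x = - x" by (intro R.minus_equality) auto
    then show "\<ominus>\<^bsub>res_ring L\<^esub> x \<in> maximal_ideal_of L \<mu>"
      using x vmax_closed(3) subfield_closed(5)[OF subfield_L] by (auto simp: maximal_ideal_eq)
    fix y assume "y \<in> maximal_ideal_of L \<mu>"
    then show "x \<oplus>\<^bsub>res_ring L\<^esub> y \<in> maximal_ideal_of L \<mu>"
      using x vmax_closed(2) subfield_closed(3)[OF subfield_L] by (auto simp: maximal_ideal_eq)
  qed
  fix a x assume "a \<in> maximal_ideal_of L \<mu>" "x \<in> carrier (res_ring L)"
  then show "x \<otimes>\<^bsub>res_ring L\<^esub> a \<in> maximal_ideal_of L \<mu>" "a \<otimes>\<^bsub>res_ring L\<^esub> x \<in> maximal_ideal_of L \<mu>"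
    using vmax_closed(4,5) subfield_closed(4)[OF subfield_L]
    by (auto simp: maximal_ideal_eq valuation_ring_eq)
qed

lemma residue_field_eq: "residue_field L \<mu> = res_ring L Quot maximal_ideal_of L \<mu>"
  by (simp add: residue_field_def res_ring_def)

lemma residue_subfield_eq: "residue_subfield K L \<mu> = res ` valuation_ring K \<mu>"
  by (simp add: residue_subfield_def res_def[abs_def] res_ring_def)

lemma ring_hom_res: "ring_hom_ring (res_ring L) (residue_field L \<mu>) res"
  unfolding residue_field_eq res_def[abs_def]
  by (rule ideal.rcos_ring_hom_ring[OF ideal_maximal_ideal])

lemma carrier_residue_field: "carrier (residue_field L \<mu>) = res ` valuation_ring L \<mu>"
  by (auto simp: residue_field_eq FactRing_def A_RCOSETS_def' res_def)

lemma res_eq_zero_iff: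
  assumes "x \<in> valuation_ring L \<mu>" shows "res x = \<zero>\<^bsub>residue_field L \<mu>\<^esub> \<longleftrightarrow> x \<in> vmax"
proof -
  interpret ideal "maximal_ideal_of L \<mu>" "res_ring L" by (rule ideal_maximal_ideal)
  have "\<zero>\<^bsub>residue_field L \<mu>\<^esub> = maximal_ideal_of L \<mu>" by (simp add: residue_field_eq FactRing_def)
  moreover have "x \<in> maximal_ideal_of L \<mu> \<longleftrightarrow> x \<in> vmax"
    using assms by (auto simp: maximal_ideal_eq valuation_ring_eq)
  moreover have "res x = maximal_ideal_of L \<mu> \<longleftrightarrow> x \<in> maximal_ideal_of L \<mu>"
    unfolding res_def using rcos_const_imp_mem[of x] a_rcos_const[of x] assms by auto
  ultimately show ?thesis by simp
qed

lemma res_inverse: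
  assumes x: "x \<in> valuation_ring N \<mu>" "x \<notin> vmax" and N: "subfield N ambient"
  shows "inverse x \<in> valuation_ring N \<mu>"
proof -
  have "x \<noteq> 0" "\<mu> x = 0" using x by (auto simp: valuation_ring_eq vring_iff vmax_iff)
  then show ?thesis
    using x subfield_closed(6)[OF N] by (auto simp: valuation_ring_eq vring_iff val_inverse)
qed

lemma res_mult_inverse:
  assumes "x \<in> valuation_ring L \<mu>" "x \<notin> vmax"
  shows "res x \<otimes>\<^bsub>residue_field L \<mu>\<^esub> res (inverse x) = \<one>\<^bsub>residue_field L \<mu>\<^esub>"
proof -
  interpret H: ring_hom_ring "res_ring L" "residue_field L \<mu>" res by (rule ring_hom_res)
  have "x \<noteq> 0" using assms by (auto simp: vmax_iff)
  then show ?thesis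
    using H.hom_mult[of x "inverse x"] assms res_inverse[OF assms subfield_L] H.hom_one by simp
qed

lemma field_residue_field: "field (residue_field L \<mu>)"
proof -
  interpret F: cring "residue_field L \<mu>"
    unfolding residue_field_eq by (rule ideal.quotient_is_cring[OF ideal_maximal_ideal cring_res_ring])
  interpret H: ring_hom_ring "res_ring L" "residue_field L \<mu>" res by (rule ring_hom_res)
  show ?thesis
  proof (rule F.cring_fieldI)
    have "1 \<in> valuation_ring L \<mu>" by (rule subring_set.one_mem[OF subring_valuation_ring[OF subfield_L]])
    then have "\<one>\<^bsub>residue_field L \<mu>\<^esub> \<noteq> \<zero>\<^bsub>residue_field L \<mu>\<^esub>"
      using res_eq_zero_iff[of 1] H.hom_one by (auto simp: vmax_iff)
    then have "\<zero>\<^bsub>residue_field L \<mu>\<^esub> \<notin> Units (residue_field L \<mu>)"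
      by (auto simp: Units_def)
    moreover have "u \<in> Units (residue_field L \<mu>)"
      if u: "u \<in> carrier (residue_field L \<mu>)" "u \<noteq> \<zero>\<^bsub>residue_field L \<mu>\<^esub>" for u
    proof -
      obtain x where x: "x \<in> valuation_ring L \<mu>" "u = res x" using u(1) by (auto simp: carrier_residue_field)
      then have nz: "x \<notin> vmax" using u(2) res_eq_zero_iff by blast
      then have "res (inverse x) \<in> carrier (residue_field L \<mu>)"
        using res_inverse[OF x(1) _ subfield_L] by (auto simp: carrier_residue_field)
      then show ?thesis using res_mult_inverse[OF x(1) nz] u(1) F.m_comm unfolding x(2) Units_def by fastforce
    qed
    ultimately show "Units (residue_field L \<mu>) = carrier (residue_field L \<mu>) - {\<zero>\<^bsub>residue_field L \<mu>\<^esub>}"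
      by (auto simp: Units_def)
  qed
qed

lemma valuation_ring_K_subset: "valuation_ring K \<mu> \<subseteq> valuation_ring L \<mu>"
  using K_subset_L by (auto simp: valuation_ring_eq)

lemma subfield_residue_subfield: "subfield (residue_subfield K L \<mu>) (residue_field L \<mu>)"
proof -
  interpret F: field "residue_field L \<mu>" by (rule field_residue_field)
  interpret H: ring_hom_ring "res_ring L" "residue_field L \<mu>" res by (rule ring_hom_res)
  interpret A: subring_set "valuation_ring K \<mu>" by (rule subring_valuation_ring[OF subfield_M])
  note sub = valuation_ring_K_subset
  show ?thesis
    unfolding residue_subfield_eq
  proof (rule F.subfieldI'[OF F.subringI])
    show "res ` valuation_ring K \<mu> \<subseteq> carrier (residue_field L \<mu>)"
      using sub by (auto simp: carrier_residue_field)
    show "\<one>\<^bsub>residue_field L \<mu>\<^esub> \<in> res ` valuation_ring K \<mu>"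
      using H.hom_one by (auto intro!: image_eqI[of _ _ 1])
    show "\<ominus>\<^bsub>residue_field L \<mu>\<^esub> u \<in> res ` valuation_ring K \<mu>" if u: "u \<in> res ` valuation_ring K \<mu>" for u
    proof -
      obtain x where x: "x \<in> valuation_ring K \<mu>" "u = res x" using u by blast
      then have mem: "- x \<in> valuation_ring K \<mu>" "x \<in> valuation_ring L \<mu>" "- x \<in> valuation_ring L \<mu>"
        using A.minus_mem sub by auto
      have "res (- x) \<oplus>\<^bsub>residue_field L \<mu>\<^esub> res x = res 0"
        using H.hom_add[of "- x" x] mem by simp
      also have "\<dots> = \<zero>\<^bsub>residue_field L \<mu>\<^esub>" using H.hom_zero by simp
      finally have "\<ominus>\<^bsub>residue_field L \<mu>\<^esub> res x = res (- x)"
        using mem by (intro F.minus_equality) (auto simp: carrier_residue_field)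
      then show ?thesis using x(2) mem(1) by blast
    qed
    show "u \<oplus>\<^bsub>residue_field L \<mu>\<^esub> v \<in> res ` valuation_ring K \<mu>"
      "u \<otimes>\<^bsub>residue_field L \<mu>\<^esub> v \<in> res ` valuation_ring K \<mu>"
      if uv: "u \<in> res ` valuation_ring K \<mu>" "v \<in> res ` valuation_ring K \<mu>" for u v
    proof -
      obtain x y where xy: "x \<in> valuation_ring K \<mu>" "y \<in> valuation_ring K \<mu>" "u = res x" "v = res y"
        using uv by blast
      then have "u \<oplus>\<^bsub>residue_field L \<mu>\<^esub> v = res (x + y)" "u \<otimes>\<^bsub>residue_field L \<mu>\<^esub> v = res (x * y)"
        using H.hom_add[of x y] H.hom_mult[of x y] sub by auto
      then show "u \<oplus>\<^bsub>residue_field L \<mu>\<^esub> v \<in> res ` valuation_ring K \<mu>"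
        "u \<otimes>\<^bsub>residue_field L \<mu>\<^esub> v \<in> res ` valuation_ring K \<mu>"
        using A.add_mem A.mult_mem xy by auto
    qed
    fix u assume u: "u \<in> res ` valuation_ring K \<mu> - {\<zero>\<^bsub>residue_field L \<mu>\<^esub>}"
    then obtain x where x: "x \<in> valuation_ring K \<mu>" "u = res x" by blast
    then have xL: "x \<in> valuation_ring L \<mu>" using sub by blast
    then have nz: "x \<notin> vmax" using u x res_eq_zero_iff by blast
    have inv: "inverse x \<in> valuation_ring K \<mu>" by (rule res_inverse[OF x(1) nz subfield_M])
    then have "inv\<^bsub>residue_field L \<mu>\<^esub> u = res (inverse x)"
      using res_mult_inverse[OF xL nz] xL sub x(2)
      by (intro F.comm_inv_char) (auto simp: carrier_residue_field)
    then show "inv\<^bsub>residue_field L \<mu>\<^esub> u \<in> res ` valuation_ring K \<mu>" using inv by blast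
  qed
qed

text \<open>Integrality of the sum is proved along with the identity, since \<open>res\<close> is a
  homomorphism only on the valuation ring.\<close>

lemma combine_res:
  assumes "\<And>y. y \<in> set ys \<Longrightarrow> a y \<in> valuation_ring K \<mu>" "set ys \<subseteq> valuation_ring L \<mu>"
  shows "ring.combine (residue_field L \<mu>) (map (\<lambda>y. res (a y)) ys) (map res ys) = res (\<Sum>y\<leftarrow>ys. a y * y)
    \<and> (\<Sum>y\<leftarrow>ys. a y * y) \<in> valuation_ring L \<mu>"
proof -
  interpret H: ring_hom_ring "res_ring L" "residue_field L \<mu>" res by (rule ring_hom_res)
  interpret B: subring_set "valuation_ring L \<mu>" by (rule subring_valuation_ring[OF subfield_L])
  show ?thesis
    using assms
  proof (induction ys)
    case Nil
    then show ?case using res_eq_zero_iff[of 0] vmax_closed(1) by simp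
  next
    case (Cons y ys)
    have "a y \<in> valuation_ring L \<mu>" "y \<in> valuation_ring L \<mu>"
      using Cons.prems valuation_ring_K_subset by auto
    with Cons show ?case
      using H.hom_add[of "a y * y" "\<Sum>y\<leftarrow>ys. a y * y"] H.hom_mult[of "a y" y] B.mult_mem B.add_mem by auto
  qed
qed

lemma residue_independentI:
  assumes "ring.independent (residue_field L \<mu>) (residue_subfield K L \<mu>) (map res ys)"
    and ys: "distinct ys" "set ys \<subseteq> valuation_ring L \<mu>"
  shows "residue_independent (set ys)"
  unfolding residue_independent_def
proof (intro conjI allI impI ballI ys(2))
  interpret F: field "residue_field L \<mu>" by (rule field_residue_field)
  fix a y assume a: "\<forall>y\<in>set ys. a y \<in> valuation_ring K \<mu>" "(\<Sum>y\<in>set ys. a y * y) \<in> vmax" and y: "y \<in> set ys"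
  let ?ks = "map (\<lambda>y. res (a y)) ys"
  have "F.combine ?ks (map res ys) = \<zero>\<^bsub>residue_field L \<mu>\<^esub>"
    using combine_res[of ys a] a ys res_eq_zero_iff by (simp add: sum_list_distinct_conv_sum_set)
  moreover have "set ?ks \<subseteq> residue_subfield K L \<mu>" using a(1) by (auto simp: residue_subfield_eq)
  ultimately have "set (take (length (map res ys)) ?ks) \<subseteq> {\<zero>\<^bsub>residue_field L \<mu>\<^esub>}"
    using F.independent_imp_trivial_combine[OF subfield_residue_subfield assms(1)] by blast
  then have "res (a y) = \<zero>\<^bsub>residue_field L \<mu>\<^esub>" using y by auto
  then show "a y \<in> vmax" using res_eq_zero_iff a(1) y valuation_ring_K_subset by blast
qed

lemma residue_spanningI:
  assumes span: "ring.Span (residue_field L \<mu>) (residue_subfield K L \<mu>) (map res ys) = carrier (residue_field L \<mu>)"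
    and ys: "distinct ys" "set ys \<subseteq> valuation_ring L \<mu>"
  shows "residue_spanning (set ys)"
  unfolding residue_spanning_def
proof (intro conjI ballI ys(2))
  interpret F: field "residue_field L \<mu>" by (rule field_residue_field)
  interpret H: ring_hom_ring "res_ring L" "residue_field L \<mu>" res by (rule ring_hom_res)
  interpret B: subring_set "valuation_ring L \<mu>" by (rule subring_valuation_ring[OF subfield_L])
  fix b assume b: "b \<in> valuation_ring L \<mu>"
  have "set (map res ys) \<subseteq> carrier (residue_field L \<mu>)" using ys(2) by (auto simp: carrier_residue_field)
  moreover have "res b \<in> F.Span (residue_subfield K L \<mu>) (map res ys)"
    using b unfolding span by (auto simp: carrier_residue_field)
  ultimately obtain ks where ks: "set ks \<subseteq> residue_subfield K L \<mu>" "length ks = length ys"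
    "res b = F.combine ks (map res ys)"
    using F.Span_mem_iff_length_version[OF subfield_residue_subfield] by auto
  have "\<forall>k\<in>set ks. \<exists>a\<in>valuation_ring K \<mu>. k = res a" using ks(1) by (auto simp: residue_subfield_eq)
  then obtain g where g: "\<And>k. k \<in> set ks \<Longrightarrow> g k \<in> valuation_ring K \<mu> \<and> k = res (g k)" by metis
  define a where "a y = g (the (map_of (zip ys ks) y))" for y
  have ks_eq: "map (\<lambda>y. the (map_of (zip ys ks) y)) ys = ks" using ys(1) ks(2) by (rule map_map_of_zip)
  have mem: "the (map_of (zip ys ks) y) \<in> set ks" if "y \<in> set ys" for y
    using that arg_cong[OF ks_eq, of set] by auto
  have aK: "a y \<in> valuation_ring K \<mu>" if "y \<in> set ys" for y using g mem[OF that] by (simp add: a_def)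
  have "map (\<lambda>y. res (a y)) ys = map (\<lambda>y. the (map_of (zip ys ks) y)) ys"
    using g mem by (intro map_cong refl) (simp add: a_def)
  then have map: "map (\<lambda>y. res (a y)) ys = ks" unfolding ks_eq .
  define s where "s = (\<Sum>y\<in>set ys. a y * y)"
  have s: "res b = res s" "s \<in> valuation_ring L \<mu>"
    using combine_res[of ys a] aK ys ks(3) by (auto simp: map s_def sum_list_distinct_conv_sum_set)
  have "res (b - s) \<oplus>\<^bsub>residue_field L \<mu>\<^esub> res s = res s"
    using H.hom_add[of "b - s" s] b s B.diff_mem by simp
  then have "res (b - s) = \<zero>\<^bsub>residue_field L \<mu>\<^esub>"
    using F.r_right_minus_eq F.add.r_cancel_one b s B.diff_mem H.hom_closed by force
  then have "b - s \<in> vmax" using res_eq_zero_iff b s B.diff_mem by blast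
  then show "\<exists>a. (\<forall>y\<in>set ys. a y \<in> valuation_ring K \<mu>) \<and> b - (\<Sum>y\<in>set ys. a y * y) \<in> vmax"
    using aK unfolding s_def by blast
qed

end

section \<open>Finiteness of the indices and comparison with the degree\<close>

context valued_extension
begin

text \<open>The residue field is not known to be finite-dimensional beforehand. Lifts of an
  independent list are independent over \<open>K\<close>, so its length is at most
  \<open>[L : K]\<close>, and an independent list of greatest length is a basis.\<close>

lemma residue_basis_exists:
  assumes dim: "ring.dimension ambient n K L"
  obtains ys where "distinct ys" "ys \<noteq> []" "residue_independent (set ys)" "residue_spanning (set ys)"
    "residue_degree K L \<mu> = length ys"
proof -
  interpret F: field "residue_field L \<mu>" by (rule field_residue_field)
  define k where "k = residue_subfield K L \<mu>"
  have k: "subfield k (residue_field L \<mu>)" unfolding k_def by (rule subfield_residue_subfield)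
  have lift: "\<exists>ys. us = map res ys \<and> distinct ys \<and> set ys \<subseteq> valuation_ring L \<mu>"
    if us: "F.independent k us" for us
  proof -
    have "\<exists>x. x \<in> valuation_ring L \<mu> \<and> res x = u" if "u \<in> set us" for u
      using F.independent_in_carrier[OF us] that by (auto simp: carrier_residue_field)
    then obtain g where g: "\<And>u. u \<in> set us \<Longrightarrow> g u \<in> valuation_ring L \<mu> \<and> res (g u) = u" by metis
    have "us = map res (map g us)" using g by (simp add: map_idI)
    moreover have "distinct (map g us)"
    proof -
      have "inj_on g (set us)" by (rule inj_on_inverseI[of _ res]) (use g in auto)
      then show ?thesis using F.independent_distinct[OF k us] by (simp add: distinct_map)
    qed
    ultimately show ?thesis using g by (intro exI[of _ "map g us"]) auto
  qed
  have bound: "length us \<le> n" if us: "F.independent k us" for us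
  proof -
    obtain ys where ys: "us = map res ys" "distinct ys" "set ys \<subseteq> valuation_ring L \<mu>"
      using lift[OF us] by blast
    have "residue_independent (set ys)"
      using us ys unfolding k_def by (intro residue_independentI) auto
    then have "card {1::'a} * card (set ys) \<le> n"
      using near_refl subfield_closed(2)[OF subfield_L]
      by (intro card_products_le_dimension[OF _ subfield_M dim]) auto
    then show ?thesis using distinct_card[OF ys(2)] ys(1) by simp
  qed
  have "\<exists>us. F.independent k us \<and> (\<forall>vs. F.independent k vs \<longrightarrow> length vs \<le> length us)"
    by (rule ex_has_greatest_nat[where k = "[]" and b = "Suc n"]) (use bound in \<open>auto simp: less_Suc_eq_le\<close>)
  then obtain us where us: "F.independent k us" and max: "\<And>vs. F.independent k vs \<Longrightarrow> length vs \<le> length us"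
    by blast
  have us_carrier: "set us \<subseteq> carrier (residue_field L \<mu>)" using us by (rule F.independent_in_carrier)
  have span: "F.Span k us = carrier (residue_field L \<mu>)"
  proof
    show "F.Span k us \<subseteq> carrier (residue_field L \<mu>)" by (rule F.Span_subgroup_props(1)[OF k us_carrier])
    show "carrier (residue_field L \<mu>) \<subseteq> F.Span k us"
    proof (rule ccontr)
      assume "\<not> carrier (residue_field L \<mu>) \<subseteq> F.Span k us"
      then obtain v where "v \<in> carrier (residue_field L \<mu>)" "v \<notin> F.Span k us" by blast
      then have "F.independent k (v # us)" using us by (rule F.li_Cons)
      from max[OF this] show False by simp
    qed
  qed
  obtain ys where ys: "us = map res ys" "distinct ys" "set ys \<subseteq> valuation_ring L \<mu>"
    using lift[OF us] by blast
  show thesis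
  proof (rule that[OF ys(2)])
    show "ys \<noteq> []"
    proof
      assume "ys = []"
      then have "carrier (residue_field L \<mu>) = {\<zero>\<^bsub>residue_field L \<mu>\<^esub>}" using span ys(1) by simp
      then show False using F.one_closed F.one_not_zero by blast
    qed
    show "residue_independent (set ys)"
      using us ys unfolding k_def by (intro residue_independentI) auto
    show "residue_spanning (set ys)"
      using span ys unfolding k_def by (intro residue_spanningI) auto
    have "F.dimension (length us) k (carrier (residue_field L \<mu>))" using F.dimensionI[OF k us span] .
    then have "F.dim k (carrier (residue_field L \<mu>)) = length us"
      using F.dimI[OF k] by (simp add: over_def)
    then show "residue_degree K L \<mu> = length ys" by (simp add: residue_degree_def k_def ys(1))
  qed
qed

definition value_cosets :: "'g set set"
  where "value_cosets = (\<lambda>\<gamma>. (+) \<gamma> ` value_group K \<mu>) ` value_group L \<mu>"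

lemma zero_mem_value_group: "0 \<in> value_group K \<mu>"
  unfolding value_group_def by (rule image_eqI[of _ _ 1]) auto

lemma coset_eq_iff:
  "(+) \<gamma> ` value_group K \<mu> = (+) \<gamma>' ` value_group K \<mu> \<longleftrightarrow> \<gamma> - \<gamma>' \<in> value_group K \<mu>"
proof
  assume "(+) \<gamma> ` value_group K \<mu> = (+) \<gamma>' ` value_group K \<mu>"
  moreover have "\<gamma> \<in> (+) \<gamma> ` value_group K \<mu>"
    using zero_mem_value_group by (intro image_eqI[of _ _ 0]) auto
  ultimately obtain \<delta> where "\<delta> \<in> value_group K \<mu>" "\<gamma> = \<gamma>' + \<delta>" by blast
  then show "\<gamma> - \<gamma>' \<in> value_group K \<mu>" by simp
next
  assume d: "\<gamma> - \<gamma>' \<in> value_group K \<mu>"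
  have neg: "- \<delta> \<in> value_group K \<mu>" if "\<delta> \<in> value_group K \<mu>" for \<delta>
    using value_group_diff[OF zero_mem_value_group that subfield_M] by simp
  have sub: "(+) \<alpha> ` value_group K \<mu> \<subseteq> (+) \<beta> ` value_group K \<mu>"
    if ab: "\<alpha> - \<beta> \<in> value_group K \<mu>" for \<alpha> \<beta>
  proof
    fix x assume "x \<in> (+) \<alpha> ` value_group K \<mu>"
    then obtain \<delta> where \<delta>: "\<delta> \<in> value_group K \<mu>" "x = \<alpha> + \<delta>" by blast
    have "(\<alpha> - \<beta>) - (- \<delta>) \<in> value_group K \<mu>"
      by (intro value_group_diff[OF ab neg[OF \<delta>(1)] subfield_M])
    moreover have "x = \<beta> + ((\<alpha> - \<beta>) - (- \<delta>))" by (simp add: \<delta>(2))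
    ultimately show "x \<in> (+) \<beta> ` value_group K \<mu>" by blast
  qed
  have "\<gamma>' - \<gamma> \<in> value_group K \<mu>" using neg[OF d] by simp
  with d sub show "(+) \<gamma> ` value_group K \<mu> = (+) \<gamma>' ` value_group K \<mu>" by blast
qed

text \<open>An arbitrary finite set of cosets is allowed, because the finiteness of their number is
  itself deduced from this bound.\<close>

lemma card_cosets_le_dimension:
  assumes near: "\<And>x. x \<in> N \<Longrightarrow> x \<noteq> 0 \<Longrightarrow> \<exists>d\<in>K. near x d"
    and N: "subfield N ambient" and dim: "ring.dimension ambient n N E" "L \<subseteq> E"
    and Q: "finite Q" "Q \<subseteq> value_cosets" and Y: "finite Y" "residue_independent Y"
  shows "card Q * card Y \<le> n"
proof -
  have "\<exists>x. x \<in> L - {0} \<and> q = (+) (\<mu> x) ` value_group K \<mu>" if "q \<in> Q" for q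
    using that Q(2) by (auto simp: value_cosets_def value_group_def)
  then obtain g where g: "\<And>q. q \<in> Q \<Longrightarrow> g q \<in> L - {0} \<and> q = (+) (\<mu> (g q)) ` value_group K \<mu>" by metis
  have inj: "inj_on g Q"
  proof (rule inj_onI)
    fix q q' assume "q \<in> Q" "q' \<in> Q" "g q = g q'"
    then show "q = q'" using g[of q] g[of q'] by auto
  qed
  have "card (g ` Q) * card Y \<le> n"
  proof (rule card_products_le_dimension[OF near N dim _ _ _ Y])
    show "\<mu> x - \<mu> x' \<notin> value_group K \<mu>" if x: "x \<in> g ` Q" "x' \<in> g ` Q" "x \<noteq> x'" for x x'
    proof
      assume *: "\<mu> x - \<mu> x' \<in> value_group K \<mu>"
      obtain q q' where q: "q \<in> Q" "q' \<in> Q" "x = g q" "x' = g q'" using x by blast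
      have "q = q'" using g[OF q(1)] g[OF q(2)] * coset_eq_iff unfolding q(3,4) by metis
      then show False using x(3) q by simp
    qed
  qed (use Q(1) g in auto)
  then show ?thesis by (simp add: card_image[OF inj])
qed

lemma finite_value_cosets:
  assumes dim: "ring.dimension ambient n K L"
  shows "finite value_cosets"
proof (rule ccontr)
  assume "infinite value_cosets"
  then obtain Q where Q: "finite Q" "Q \<subseteq> value_cosets" "card Q = Suc n"
    using infinite_arbitrarily_large by blast
  have "residue_independent {1}"
    using subring_set.one_mem[OF subring_valuation_ring[OF subfield_L]]
    by (auto simp: residue_independent_def)
  then have "card Q * card {1::'a} \<le> n"
    using near_refl Q by (intro card_cosets_le_dimension[OF _ subfield_M dim]) auto
  with Q(3) show False by simp
qed

text \<open>If \<open>\<gamma>' - \<gamma>\<close> were positive and in the value group of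
  \<open>K\<close>, it would exceed the initial value \<open>\<gamma>'\<close>, against
  \<open>0 \<le> \<gamma>\<close>.\<close>

lemma initial_values_inj:
  "inj_on (\<lambda>\<gamma>. (+) \<gamma> ` value_group K \<mu>) initial_values"
proof (rule inj_onI)
  have *: "\<not> \<gamma> < \<gamma>'" if "\<gamma> \<in> initial_values" "\<gamma>' \<in> initial_values" "\<gamma>' - \<gamma> \<in> value_group K \<mu>" for \<gamma> \<gamma>'
  proof
    assume "\<gamma> < \<gamma>'"
    with that have "\<gamma>' < \<gamma>' - \<gamma>" "0 \<le> \<gamma>" unfolding initial_values_def by auto
    then show False by simp
  qed
  fix \<gamma> \<gamma>' assume \<gamma>: "\<gamma> \<in> initial_values" "\<gamma>' \<in> initial_values"
    "(+) \<gamma> ` value_group K \<mu> = (+) \<gamma>' ` value_group K \<mu>"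
  then have "\<gamma> - \<gamma>' \<in> value_group K \<mu>" "\<gamma>' - \<gamma> \<in> value_group K \<mu>"
    using coset_eq_iff by metis+
  with *[of \<gamma> \<gamma>'] *[of \<gamma>' \<gamma>] \<gamma>(1,2) show "\<gamma> = \<gamma>'" by (simp add: not_less)
qed

theorem efg_indices:
  assumes dim: "ring.dimension ambient n K L"
    and efg: "essentially_finitely_generated (valuation_ring K \<mu>) (valuation_ring L \<mu>)"
  shows "ramification_index K L \<mu> = initial_index K L \<mu> \<and> defect \<mu> K L \<mu> = 1"
proof -
  interpret R: field "ambient :: 'a ring" by (rule field_ambient)
  interpret L: valued_closure L \<mu> by (rule valued_closure_intermediate[OF K_subset_L subfield_L])
  obtain ys where ys: "distinct ys" "ys \<noteq> []" "residue_independent (set ys)" "residue_spanning (set ys)"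
    "residue_degree K L \<mu> = length ys" by (rule residue_basis_exists[OF dim])
  define f where "f = residue_degree K L \<mu>"
  define e where "e = ramification_index K L \<mu>"
  have f: "f = card (set ys)" "f > 0" using ys distinct_card[of ys] by (auto simp: f_def)
  have e: "e = card value_cosets"
    by (simp add: e_def ramification_index_def subgroup_index_def value_cosets_def)
  have fin: "finite value_cosets" by (rule finite_value_cosets[OF dim])
  have "\<mu> 1 \<in> value_group L \<mu>"
    unfolding value_group_def by (rule image_eqI[of _ _ 1]) (use subfield_closed(2)[OF subfield_L] in auto)
  then have "value_cosets \<noteq> {}" by (auto simp: value_cosets_def)
  then have "e > 0" using fin by (simp add: e card_gt_0_iff)
  have \<epsilon>: "initial_index K L \<mu> = card initial_values"
    by (simp add: initial_index_def group_initial_index_def initial_values_def)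
  have sub: "(\<lambda>\<gamma>. (+) \<gamma> ` value_group K \<mu>) ` initial_values \<subseteq> value_cosets"
    by (auto simp: value_cosets_def initial_values_def)
  have fin_init: "finite initial_values"
    using finite_imageD[OF finite_subset[OF sub fin] initial_values_inj] .
  have \<epsilon>_le: "card initial_values \<le> e"
    unfolding e by (rule card_inj_on_le[OF initial_values_inj sub fin])
  have "\<exists>z. z \<in> L - {0} \<and> \<mu> z = \<gamma>" if "\<gamma> \<in> initial_values" for \<gamma>
    using that by (auto simp: initial_values_def value_group_def)
  then obtain z where z: "\<And>\<gamma>. \<gamma> \<in> initial_values \<Longrightarrow> z \<gamma> \<in> L - {0} \<and> \<mu> (z \<gamma>) = \<gamma>" by metis
  define W where "W = (\<lambda>(y, \<gamma>). y * z \<gamma>) ` (set ys \<times> initial_values)"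
  have W: "finite W" "card W \<le> f * card initial_values"
    using fin_init card_image_le[of "set ys \<times> initial_values"] by (auto simp: W_def f card_cartesian_product)
  have eq: "henselization \<mu> L = lspan (henselization \<mu> K) W"
    unfolding W_def by (rule henselization_eq_lspan[OF efg fin_init z _ ys(4)]) auto
  obtain m where m: "m \<le> card W" "R.dimension m (henselization \<mu> K) (henselization \<mu> L)"
    using dimension_lspan[OF subfield_henselization W(1)] unfolding eq by blast
  have "card value_cosets * card (set ys) \<le> m"
    by (rule card_cosets_le_dimension[OF henselization_near subfield_henselization m(2)
          L.subset_henselization fin order_refl _ ys(3)]) auto
  \<comment> \<open>The chain \<open>e * f \<le> m \<le> f * \<epsilon> \<le> f * e\<close>
    collapses. Positivity of \<open>f\<close> gives \<open>\<epsilon> = e\<close>, and positivity of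
    both makes the quotient in the defect equal to 1.\<close>
  then have "e * f \<le> m" by (simp add: e f)
  moreover have "m \<le> f * card initial_values" using m(1) W(2) by simp
  moreover have "f * card initial_values \<le> f * e" using \<epsilon>_le by simp
  moreover have "f * e = e * f" by (rule mult.commute)
  ultimately have "f * card initial_values = f * e" and m_eq: "m = e * f" by linarith+
  then have "card initial_values = e" using f(2) by simp
  moreover have "R.dim (henselization \<mu> K) (henselization \<mu> L) = m"
    using R.dimI[OF subfield_henselization m(2)] by (simp add: over_def)
  then have "defect \<mu> K L \<mu> = 1"
    using f(2) \<open>e > 0\<close> m_eq by (simp add: defect_def flip: e_def f_def)
  ultimately show ?thesis using \<epsilon> by (simp add: e_def)
qed

end

section \<open>Passage to the ambient ring record\<close>

lemma nat_pow_ambient: "x [^]\<^bsub>ambient\<^esub> (n::nat) = (x::'a::field) ^ n"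
proof -
  interpret R: ring "ambient :: 'a ring" by (rule ring_ambient)
  show ?thesis by (induction n) (auto simp: mult.commute)
qed

text \<open>Polynomials over a ring record are lists with the leading coefficient first, whereas
  \<open>Poly\<close> takes the constant coefficient first.\<close>

lemma eval_ambient: "ring.eval ambient p (x::'a::field) = poly (Poly (rev p)) x"
proof -
  interpret R: ring "ambient :: 'a ring" by (rule ring_ambient)
  show ?thesis
    by (induction p) (auto simp: nat_pow_ambient Poly_append poly_monom)
qed

text \<open>The closure is given as algebraic over \<open>L\<close>; over \<open>K\<close> this
  follows because \<open>L(x)\<close> is finite over \<open>L\<close> and \<open>L\<close> is finite
  over \<open>K\<close>. Roots exist because every polynomial over the closure splits.\<close>

lemma closed_extension_of_algebraic_closure:
  fixes K L :: "'a::field set"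
  assumes ac: "algebraic_closure (ambient :: 'a ring) L" and K: "subfield K ambient"
    and fin: "ring.finite_dimension ambient K L"
  shows "closed_extension K"
proof (rule closed_extension.intro)
  interpret C: algebraic_closure "ambient :: 'a ring" L by (rule ac)
  have L: "subfield L ambient" by (rule C.subfield_axioms)
  show "subfield K ambient" by (rule K)
  show "\<exists>x. poly p x = 0" if p: "degree p > 0" for p :: "'a poly"
  proof -
    define P where "P = rev (coeffs p)"
    have "p \<noteq> 0" using p by auto
    then have P: "P \<in> carrier (poly_ring ambient)"
      by (auto simp: P_def univ_poly_def polynomial_def hd_rev last_coeffs_eq_coeff_degree)
    have "length P - 1 = degree p" using \<open>p \<noteq> 0\<close> by (simp add: P_def degree_eq_length_coeffs)
    then have "C.roots P \<noteq> {#}"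
      using C.roots_over_carrier[OF P] p unfolding C.splitted_def by auto
    then obtain x where "C.is_root P x" using C.roots_mem_iff_is_root[OF P] by blast
    then have "C.eval P x = 0" by (simp add: C.is_root_def)
    then show ?thesis by (auto simp: eval_ambient P_def)
  qed
  show "\<exists>p. p \<noteq> 0 \<and> coeffs_in K p \<and> poly p x = 0" for x
  proof -
    have "(C.algebraic over L) x" by (rule C.algebraic_extension) simp
    then have "C.finite_dimension L (C.simple_extension L x)"
      using C.finite_dimension_simple_extension[OF L] by simp
    then have "C.finite_dimension K (C.simple_extension L x)"
      by (rule C.telescopic_base_dim(1)[OF K L fin])
    moreover have "subring (C.simple_extension L x) ambient"
      using C.simple_extension_is_subring[OF subfieldE(1)[OF L]] by simp
    ultimately have "(C.algebraic over K) x"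
      using C.finite_dimension_imp_algebraic[OF K] C.simple_extension_mem[OF subfieldE(1)[OF L]] by simp
    then obtain P where P: "P \<in> carrier (K[X]\<^bsub>ambient\<^esub>)" "P \<noteq> []" "C.eval P x = 0"
      using C.algebraicE[OF subfieldE(1)[OF K]] by auto
    then have PK: "set P \<subseteq> K" "hd P \<noteq> 0" by (auto simp: univ_poly_def polynomial_def)
    obtain c Q where cQ: "P = c # Q" using P(2) by (cases P) auto
    have "coeff (Poly (rev P)) (length Q) = c" by (simp add: cQ nth_default_def nth_append)
    then have "Poly (rev P) \<noteq> 0" using PK(2) cQ by (metis coeff_0 list.sel(1))
    moreover have "coeffs_in K (Poly (rev P))"
    proof -
      have "coeff (Poly (rev P)) i \<in> K" for i
      proof (cases "i < length P")
        case True
        then have "rev P ! i \<in> set P" by (metis length_rev nth_mem set_rev)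
        with True PK(1) show ?thesis by (auto simp: nth_default_def)
      qed (simp add: nth_default_def subfield_closed(1)[OF K])
      then show ?thesis by (simp add: coeffs_in_def)
    qed
    ultimately show ?thesis using P(3) by (intro exI[of _ "Poly (rev P)"]) (simp add: eval_ambient)
  qed
qed

theorem theorem4p1:
  fixes K L :: "'a::field set"
    and \<omega> \<mu> :: "'a \<Rightarrow> 'g::linordered_ab_group_add"
  assumes "algebraic_closure (ambient :: 'a ring) L"
    and "subfield K (ambient :: 'a ring)" and "K \<subseteq> L"
    and "ring.finite_dimension (ambient :: 'a ring) K L"
    and "valuation_on L \<omega>"
    and "valuation_on UNIV \<mu>" and "extends_on L \<mu> \<omega>"
    and "essentially_finitely_generated (valuation_ring K \<omega>) (valuation_ring L \<omega>)"
  shows "ramification_index K L \<omega> = initial_index K L \<omega> \<and> defect \<mu> K L \<omega> = 1"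
proof -
  interpret R: field "ambient :: 'a ring" by (rule field_ambient)
  have L: "subfield L ambient"
    using assms(1) by (auto simp: algebraic_closure_def)
  interpret valued_extension K \<mu> L
    by (intro valued_extension.intro valued_closure.intro valued_field.intro
        valued_extension_axioms.intro closed_extension_of_algebraic_closure[OF assms(1,2,4)] assms L)
  \<comment> \<open>\<open>\<omega>\<close> is arbitrary outside \<open>L\<close>; all notions
    evaluate it only at nonzero elements of \<open>L\<close>, where it agrees with
    \<open>\<mu>\<close>, so \<open>\<mu>\<close> can replace it.\<close>
  have eq: "\<omega> x = \<mu> x" if "x \<in> L" "x \<noteq> 0" for x
    using assms(7) that by (auto simp: extends_on_def)
  have "value_group N \<omega> = value_group N \<mu>" "valuation_ring N \<omega> = valuation_ring N \<mu>"
    "maximal_ideal_of N \<omega> = maximal_ideal_of N \<mu>" if "N \<subseteq> L" for N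
  proof -
    have eqN: "\<omega> x = \<mu> x" if "x \<in> N" "x \<noteq> 0" for x using eq that \<open>N \<subseteq> L\<close> by blast
    show "value_group N \<omega> = value_group N \<mu>"
      unfolding value_group_def by (intro image_cong refl) (simp add: eqN)
    show "valuation_ring N \<omega> = valuation_ring N \<mu>" "maximal_ideal_of N \<omega> = maximal_ideal_of N \<mu>"
      unfolding valuation_ring_def maximal_ideal_of_def by (metis (no_types, opaque_lifting) eqN)+
  qed
  note * = this[OF order_refl] this[OF assms(3)]
  obtain n where n: "R.dimension n K L" using assms(4) by (auto simp: R.finite_dimension_def)
  have idx: "ramification_index K L \<omega> = ramification_index K L \<mu>"
    "initial_index K L \<omega> = initial_index K L \<mu>" "residue_degree K L \<omega> = residue_degree K L \<mu>"
    by (simp_all only: ramification_index_def initial_index_def residue_degree_def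
        residue_field_def residue_subfield_def *)
  then have "defect \<mu> K L \<omega> = defect \<mu> K L \<mu>" by (simp only: defect_def)
  moreover have "ramification_index K L \<mu> = initial_index K L \<mu> \<and> defect \<mu> K L \<mu> = 1"
    using assms(8) unfolding * by (rule efg_indices[OF n])
  ultimately show ?thesis by (simp only: idx)
qed

end
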